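(* Let $M$ be an (oriented) surface immersed in $\mathbb S^3$ and let $\mathcal N:M\to\mathbb S^5\subseteq\mathfrak o(4)$ be its Gauss map. Then the following are equivalent: (i) $M$ has constant mean curvature; (ii) $\mathcal N$ is harmonic; (iii) the complex quadratic form $\mathcal Q_{\mathcal N}$ induced by $\mathcal N$ on $M$ is holomorphic.
   Context: $O(4)$ carries the bi-invariant metric $\langle u,v\rangle=\frac12\operatorname{tr}(uv^T)$ on its Lie algebra $\mathfrak o(4)$ of skew-symmetric $4\times4$ matrices; $O(3)$ is the subgroup fixing $e_1\in\mathbb R^4$, and $\mathbb S^3=O(4)/O(3)$ isometrically via $\pi(x)=x e_1$. $\mathbb S^5$ is the unit sphere of $\mathfrak o(4)$. For $x\in O(4)$ let $\ell_x$ be the restriction of $d\pi_x$ to $(T_x(xO(3)))^\perp$, a linear isometry onto $T_{\pi(x)}\mathbb S^3$. For $p\in\mathbb S^3$, $\Gamma_p:T_p\mathbb S^3\to\mathfrak o(4)$ is $\Gamma_p(u)=d(R_{x^{-1}})_x\ell_x^{-1}(u)$ for any $x\in\pi^{-1}(p)$, where $R_y(z)=zy$ (independent of $x$). If $M$ is oriented by a unit normal field $\eta$ (tangent to $\mathbb S^3$), its Gauss map is $\mathcal N(p)=\Gamma_p(\eta(p))$. Surfaces are connected. Harmonic means vanishing tension field as a map into $\mathbb S^5$. Complex quadratic form: if $F:U\subseteq\mathbb C\to M$ is a local conformal parametrization with complex coordinate $z=x+iy$, put $2F_z=F_x-iF_y$ and $2\mathcal N_z=\mathcal N_x-i\mathcal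 N_y$; then $\mathcal Q_{\mathcal N}=\langle\mathcal N_z,\Gamma(F_z)\rangle\,dz^2$, with $\langle\cdot,\cdot\rangle$ and $\Gamma$ extended complex (bi)linearly. *)

theory Defs
  imports "HOL-Analysis.Analysis"
begin

section \<open>Smooth maps\<close>

text \<open>Used for open sets \<^term>\<open>S\<close> only.\<close>

primrec Ck_on :: "nat \<Rightarrow> ('a::real_normed_vector \<Rightarrow> 'b::real_normed_vector) \<Rightarrow> 'a set \<Rightarrow> bool" where
  "Ck_on 0 f S \<longleftrightarrow> continuous_on S f"
| "Ck_on (Suc k) f S \<longleftrightarrow>
     f differentiable_on S \<and> (\<forall>v. Ck_on k (\<lambda>x. frechet_derivative f (at x) v) S)"

definition smooth_on :: "('a::real_normed_vector \<Rightarrow> 'b::real_normed_vector) \<Rightarrow> 'a set \<Rightarrow> bool" where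
  "smooth_on f S \<longleftrightarrow> (\<forall>k. Ck_on k f S)"


section \<open>Smooth surfaces\<close>

text \<open>Local parametrizations have open domains in \<open>\<complex> = \<real>\<^sup>2\<close>; an atlas is a set of pairs
  consisting of a domain and a parametrization.\<close>

type_synonym 'a param = "complex set \<times> (complex \<Rightarrow> 'a)"

definition is_param :: "'a topology \<Rightarrow> 'a param \<Rightarrow> bool" where
  "is_param M = (\<lambda>(U, F). open U \<and> openin M (F ` U) \<and>
     homeomorphic_map (top_of_set U) (subtopology M (F ` U)) F)"

definition smooth_transition :: "'a param \<Rightarrow> 'a param \<Rightarrow> bool" where
  "smooth_transition = (\<lambda>(U, F) (V, G). smooth_on (inv_into U F \<circ> G) {z \<in> V. G z \<in> F ` U})"

definition smooth_surface :: "'a topology \<Rightarrow> 'a param set \<Rightarrow> bool" where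
  "smooth_surface M A \<longleftrightarrow>
     Hausdorff_space M \<and>
     second_countable M \<and>
     connected_space M \<and>
     (\<forall>P\<in>A. is_param M P) \<and>
     topspace M = (\<Union>(U, F)\<in>A. F ` U) \<and>
     (\<forall>P\<in>A. \<forall>Q\<in>A. smooth_transition P Q)"

text \<open>Membership in the maximal atlas generated by \<^term>\<open>A\<close>.\<close>

definition smooth_param :: "'a topology \<Rightarrow> 'a param set \<Rightarrow> 'a param \<Rightarrow> bool" where
  "smooth_param M A P \<longleftrightarrow>
     is_param M P \<and> (\<forall>Q\<in>A. smooth_transition P Q \<and> smooth_transition Q P)"


section \<open>Partial derivatives\<close>

definition coord :: "2 \<Rightarrow> complex" where
  "coord i = (if i = 1 then 1 else \<i>)"

definition pd :: "2 \<Rightarrow> (complex \<Rightarrow> 'b::real_normed_vector) \<Rightarrow> complex \<Rightarrow> 'b" where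
  "pd i h z = frechet_derivative h (at z) (coord i)"


section \<open>Oriented immersed surfaces in the 3-sphere\<close>

text \<open>\<^term>\<open>f\<close> is the immersion and \<^term>\<open>\<eta>\<close> the unit normal field tangent to the 3-sphere,
  which is the unit sphere of \<open>\<real>\<^sup>4\<close>.\<close>

definition oriented_immersed_surface ::
  "'a topology \<Rightarrow> 'a param set \<Rightarrow> ('a \<Rightarrow> real^4) \<Rightarrow> ('a \<Rightarrow> real^4) \<Rightarrow> bool" where
  "oriented_immersed_surface M A f \<eta> \<longleftrightarrow>
     smooth_surface M A \<and>
     (\<forall>p\<in>topspace M. norm (f p) = 1 \<and> norm (\<eta> p) = 1 \<and> \<eta> p \<bullet> f p = 0) \<and>
     (\<forall>(U, F)\<in>A. smooth_on (f \<circ> F) U \<and> smooth_on (\<eta> \<circ> F) U \<and>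
        (\<forall>z\<in>U. inj (frechet_derivative (f \<circ> F) (at z)) \<and>
               (\<forall>v. \<eta> (F z) \<bullet> frechet_derivative (f \<circ> F) (at z) v = 0)))"

definition metric :: "('a \<Rightarrow> real^4) \<Rightarrow> (complex \<Rightarrow> 'a) \<Rightarrow> complex \<Rightarrow> real^2^2" where
  "metric f F z = (\<chi> i j. pd i (f \<circ> F) z \<bullet> pd j (f \<circ> F) z)"

definition inv_metric :: "('a \<Rightarrow> real^4) \<Rightarrow> (complex \<Rightarrow> 'a) \<Rightarrow> complex \<Rightarrow> real^2^2" where
  "inv_metric f F z = matrix_inv (metric f F z)"

definition christoffel ::
  "('a \<Rightarrow> real^4) \<Rightarrow> (complex \<Rightarrow> 'a) \<Rightarrow> complex \<Rightarrow> 2 \<Rightarrow> 2 \<Rightarrow> 2 \<Rightarrow> real" where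
  "christoffel f F z k i j = (\<Sum>l\<in>UNIV. inv_metric f F z $ k $ l *
     (pd i (\<lambda>w. metric f F w $ j $ l) z + pd j (\<lambda>w. metric f F w $ i $ l) z
      - pd l (\<lambda>w. metric f F w $ i $ j) z)) / 2"

text \<open>The position vector is orthogonal to \<^term>\<open>\<eta>\<close>, so pairing the second derivatives
  taken in \<open>\<real>\<^sup>4\<close> with \<^term>\<open>\<eta>\<close> gives the second fundamental form in the 3-sphere.\<close>

definition second_ff ::
  "('a \<Rightarrow> real^4) \<Rightarrow> ('a \<Rightarrow> real^4) \<Rightarrow> (complex \<Rightarrow> 'a) \<Rightarrow> complex \<Rightarrow> real^2^2" where
  "second_ff f \<eta> F z = (\<chi> i j. pd i (pd j (f \<circ> F)) z \<bullet> \<eta> (F z))"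

definition mean_curvature ::
  "('a \<Rightarrow> real^4) \<Rightarrow> ('a \<Rightarrow> real^4) \<Rightarrow> (complex \<Rightarrow> 'a) \<Rightarrow> complex \<Rightarrow> real" where
  "mean_curvature f \<eta> F z = trace (inv_metric f F z ** second_ff f \<eta> F z) / 2"

text \<open>The value of \<^const>\<open>mean_curvature\<close> at a point of the surface does not depend on the
  parametrization around it.\<close>

definition constant_mean_curvature ::
  "'a param set \<Rightarrow> ('a \<Rightarrow> real^4) \<Rightarrow> ('a \<Rightarrow> real^4) \<Rightarrow> bool" where
  "constant_mean_curvature A f \<eta> \<longleftrightarrow>
     (\<exists>H. \<forall>(U, F)\<in>A. \<forall>z\<in>U. mean_curvature f \<eta> F z = H)"


section \<open>The orthogonal group over the 3-sphere\<close>

text \<open>On complex matrices \<open>lie_inner\<close> is the complex bilinear extension of the inner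
  product on real ones.\<close>

definition lie_inner :: "'k::field^4^4 \<Rightarrow> 'k^4^4 \<Rightarrow> 'k" where
  "lie_inner u v = trace (u ** transpose v) / 2"

definition O4 :: "(real^4^4) set" where
  "O4 = {x. orthogonal_matrix x}"

definition e1 :: "real^4" where
  "e1 = axis 1 1"

definition O3 :: "(real^4^4) set" where
  "O3 = {y \<in> O4. y *v e1 = e1}"

definition proj :: "real^4^4 \<Rightarrow> real^4" where
  "proj x = x *v e1"

definition bi_invariant :: "real^4^4 \<Rightarrow> real^4^4 \<Rightarrow> real^4^4 \<Rightarrow> real" where
  "bi_invariant x X Y = lie_inner (matrix_inv x ** X) (matrix_inv x ** Y)"

text \<open>The tangent space of an embedded submanifold \<^term>\<open>S\<close> at \<^term>\<open>x\<close>.\<close>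

definition tangent_space :: "'b::real_normed_vector set \<Rightarrow> 'b \<Rightarrow> 'b set" where
  "tangent_space S x = {v. \<exists>\<gamma>::real \<Rightarrow> 'b. (\<forall>t. \<gamma> t \<in> S) \<and> \<gamma> 0 = x \<and>
     (\<gamma> has_vector_derivative v) (at 0)}"

definition horizontal :: "real^4^4 \<Rightarrow> (real^4^4) set" where
  "horizontal x = {X \<in> tangent_space O4 x.
     \<forall>Y \<in> tangent_space ((\<lambda>y. x ** y) ` O3) x. bi_invariant x X Y = 0}"

text \<open>\<^const>\<open>proj\<close> and right multiplications are restrictions of maps defined on all
  matrices, and so are their differentials.\<close>

definition lift :: "real^4^4 \<Rightarrow> real^4 \<Rightarrow> real^4^4" where
  "lift x = inv_into (horizontal x) (frechet_derivative proj (at x))"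

definition Gamma_at :: "real^4^4 \<Rightarrow> real^4 \<Rightarrow> real^4^4" where
  "Gamma_at x u = frechet_derivative (\<lambda>z. z ** matrix_inv x) (at x) (lift x u)"

text \<open>\<^term>\<open>Gamma_at x u\<close>, for \<^term>\<open>u\<close> tangent to the sphere at \<^term>\<open>proj x\<close>, is the same
  for all \<^term>\<open>x\<close> in a fibre of \<^const>\<open>proj\<close>, so the choice is immaterial.\<close>

definition Gamma :: "real^4 \<Rightarrow> real^4 \<Rightarrow> real^4^4" where
  "Gamma p = Gamma_at (SOME x. x \<in> O4 \<and> proj x = p)"

definition gauss_map :: "('a \<Rightarrow> real^4) \<Rightarrow> ('a \<Rightarrow> real^4) \<Rightarrow> 'a \<Rightarrow> real^4^4" where
  "gauss_map f \<eta> p = Gamma (f p) (\<eta> p)"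


section \<open>Harmonicity\<close>

text \<open>The trace, with respect to the induced metric, of the covariant derivative of
  \<open>d\<N>\<close>. The Levi-Civita connection of the unit sphere of the Lie algebra is the flat derivative
  followed by the orthogonal projection onto the tangent space of the sphere; the terms
  \<open>\<partial>\<^sub>k \<N>\<close> are already tangent.\<close>

definition sphere_tangential :: "real^4^4 \<Rightarrow> real^4^4 \<Rightarrow> real^4^4" where
  "sphere_tangential n v = v - lie_inner v n *\<^sub>R n"

definition tension ::
  "('a \<Rightarrow> real^4) \<Rightarrow> ('a \<Rightarrow> real^4^4) \<Rightarrow> (complex \<Rightarrow> 'a) \<Rightarrow> complex \<Rightarrow> real^4^4" where
  "tension f \<N> F z = (\<Sum>i\<in>UNIV. \<Sum>j\<in>UNIV. inv_metric f F z $ i $ j *\<^sub>R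
     (sphere_tangential (\<N> (F z)) (pd i (pd j (\<N> \<circ> F)) z)
      - (\<Sum>k\<in>UNIV. christoffel f F z k i j *\<^sub>R pd k (\<N> \<circ> F) z)))"

definition harmonic :: "'a param set \<Rightarrow> ('a \<Rightarrow> real^4) \<Rightarrow> ('a \<Rightarrow> real^4^4) \<Rightarrow> bool" where
  "harmonic A f \<N> \<longleftrightarrow> (\<forall>(U, F)\<in>A. \<forall>z\<in>U. tension f \<N> F z = 0)"


section \<open>The complex quadratic form\<close>

text \<open>The surface is oriented by \<^term>\<open>\<eta>\<close>: a basis \<open>(u, v)\<close> of a tangent plane is positive
  if \<open>det (p, u, v, \<eta>) > 0\<close>.\<close>

definition conformal_param ::
  "'a topology \<Rightarrow> 'a param set \<Rightarrow> ('a \<Rightarrow> real^4) \<Rightarrow> ('a \<Rightarrow> real^4) \<Rightarrow> 'a param \<Rightarrow> bool" where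
  "conformal_param M A f \<eta> P \<longleftrightarrow> smooth_param M A P \<and>
     (case P of (U, F) \<Rightarrow> \<forall>z\<in>U.
        norm (pd 1 (f \<circ> F) z) = norm (pd 2 (f \<circ> F) z) \<and>
        pd 1 (f \<circ> F) z \<bullet> pd 2 (f \<circ> F) z = 0 \<and>
        det (vector [f (F z), pd 1 (f \<circ> F) z, pd 2 (f \<circ> F) z, \<eta> (F z)] :: real^4^4) > 0)"

definition wirtinger_vec :: "(complex \<Rightarrow> real^4) \<Rightarrow> complex \<Rightarrow> complex^4" where
  "wirtinger_vec h z =
     (\<chi> i. (complex_of_real (pd 1 h z $ i) - \<i> * complex_of_real (pd 2 h z $ i)) / 2)"

definition wirtinger_mat :: "(complex \<Rightarrow> real^4^4) \<Rightarrow> complex \<Rightarrow> complex^4^4" where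
  "wirtinger_mat h z = (\<chi> i j.
     (complex_of_real (pd 1 h z $ i $ j) - \<i> * complex_of_real (pd 2 h z $ i $ j)) / 2)"

definition complex_Gamma :: "real^4 \<Rightarrow> complex^4 \<Rightarrow> complex^4^4" where
  "complex_Gamma p w = (\<chi> i j.
     complex_of_real (Gamma p (\<chi> k. Re (w $ k)) $ i $ j)
     + \<i> * complex_of_real (Gamma p (\<chi> k. Im (w $ k)) $ i $ j))"

definition quadratic_form ::
  "('a \<Rightarrow> real^4) \<Rightarrow> ('a \<Rightarrow> real^4^4) \<Rightarrow> (complex \<Rightarrow> 'a) \<Rightarrow> complex \<Rightarrow> complex" where
  "quadratic_form f \<N> F z =
     lie_inner (wirtinger_mat (\<N> \<circ> F) z) (complex_Gamma (f (F z)) (wirtinger_vec (f \<circ> F) z))"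

definition holomorphic_quadratic_form ::
  "'a topology \<Rightarrow> 'a param set \<Rightarrow> ('a \<Rightarrow> real^4) \<Rightarrow> ('a \<Rightarrow> real^4) \<Rightarrow> ('a \<Rightarrow> real^4^4) \<Rightarrow> bool"
  where
  "holomorphic_quadratic_form M A f \<eta> \<N> \<longleftrightarrow>
     (\<forall>U F. conformal_param M A f \<eta> (U, F) \<longrightarrow> quadratic_form f \<N> F holomorphic_on U)"

end

theory Submission
  imports Defs
begin

text \<open>For a unit vector \<open>p\<close> and \<open>u\<close> orthogonal to it, the horizontal lift of \<open>u\<close> at \<open>x\<close> with \<open>x e\<^sub>1 = p\<close> is
  \<open>x (a e\<^sub>1\<^sup>T - e\<^sub>1 a\<^sup>T)\<close> with \<open>a = x\<^sup>T u\<close>, so \<open>\<Gamma>\<^sub>p(u) = u p\<^sup>T - p u\<^sup>T = u \<and> p\<close>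
  (\<open>Gamma_eq_wedge\<close>). The Gauss map is therefore \<open>\<N> = \<eta> \<and> f\<close>, and everything can be computed from
  position, normal and their derivatives in \<open>\<real>\<^sup>4\<close>. Call the mean curvature \<open>H\<close>; each of the three
  conditions says that \<open>dH = 0\<close>.

  \<^item> Constant mean curvature. \<open>H\<close> is invariant under coordinate changes
    (\<open>mean_curvature_reparametrization\<close>), so it is a locally constant function on the connected
    surface once its derivative vanishes in every chart (\<open>constant_iff_derivative_zero\<close>).

  \<^item> Harmonicity. By the Gauss and Weingarten formulas all parts of the tension field except one are
    multiples of \<open>\<eta> \<and> f\<close> or cancel by symmetry, and the remaining one is \<open>V \<and> f\<close> with \<open>V\<close>
    the trace of the Hessian of \<open>\<eta>\<close>. The traced Codazzi equation identifies the part of \<open>V\<close> tangent to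
    the surface as \<open>- 2 grad H\<close> (\<open>traced_codazzi\<close>, \<open>tension_zero_iff\<close>).

  \<^item> Quadratic form. In a conformal parametrization \<open>\<langle>\<N>\<^sub>z, \<Gamma>(f\<^sub>z)\<rangle> = \<eta>\<^sub>z \<cdot> f\<^sub>z\<close>, the Hopf
    differential up to sign, and the Codazzi equations turn its \<open>\<partial>\<close>-bar derivative into a nonzero multiple of
    \<open>H\<^sub>z\<close> (\<open>quadratic_form_holomorphic_iff\<close>).

  The last condition is about conformal parametrizations only, so drawing conclusions from it
  requires that every point has one: the existence of isothermal coordinates for a smooth metric
  (\<open>isothermal_coordinates\<close>), which takes about half of the text. It is obtained from a local
  diffeomorphism \<open>w\<close> solving the Beltrami equation \<open>w_zbar = \<mu> w\<^sub>z\<close>. After rescaling around the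
  point and cutting off, \<open>\<mu>\<close> is a constant of modulus less than 1 plus a doubly periodic
  function \<open>\<nu>\<close> that is small together with its derivatives. On Fourier series the equation reads
  \<open>g = \<nu> (1 + \<sigma> g)\<close> up to the constant term, where the Fourier multiplier \<open>\<sigma>\<close> is bounded.
  In the algebra of absolutely convergent Fourier series multiplication by a small \<open>\<nu>\<close> has small norm, and
  so the Neumann series converges; weights \<open>(1 + \<epsilon> |n|)\<^sup>s\<close> with small \<open>\<epsilon>\<close> give rapid decay of the coefficients
  and hence smoothness (\<open>neumann_solution\<close>, \<open>beltrami_torus\<close>, \<open>beltrami_local\<close>). That smooth
  functions supported in a cell have rapidly decaying Fourier coefficients and are the sum of their
  series is derived from the discrete Fourier transform (\<open>fourier_expansion\<close>).\<close>

section \<open>Calculus of smooth maps\<close>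

lemma Ck_on_continuous: "Ck_on k f S \<Longrightarrow> continuous_on S f"
  by (cases k) (auto intro: differentiable_imp_continuous_on)

lemma Ck_on_SucD: "Ck_on (Suc k) f S \<Longrightarrow> Ck_on k f S"
proof (induction k arbitrary: f)
  case 0
  then show ?case by (auto intro: differentiable_imp_continuous_on)
next
  case (Suc k)
  then show ?case by auto
qed

lemma differentiable_on_open_at:
  "open S \<Longrightarrow> f differentiable_on S \<longleftrightarrow> (\<forall>x\<in>S. f differentiable at x)"
  unfolding differentiable_on_def by (metis at_within_open)

lemma Ck_on_cong:
  assumes "open S" "\<And>x. x \<in> S \<Longrightarrow> f x = g x"
  shows "Ck_on k f S \<longleftrightarrow> Ck_on k g S"
  using assms(2)
proof (induction k arbitrary: f g)
  case 0
  then show ?case by (auto intro!: continuous_on_cong)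
next
  case (Suc k)
  have "g differentiable_on S" if "f differentiable_on S" "\<And>x. x \<in> S \<Longrightarrow> f x = g x" for f g :: "'a \<Rightarrow> 'b"
    using that assms(1) unfolding differentiable_on_def differentiable_def
    by (metis has_derivative_transform)
  then have *: "f differentiable_on S \<longleftrightarrow> g differentiable_on S"
    using Suc(2) by metis
  show ?case
  proof (cases "f differentiable_on S")
    case True
    have "frechet_derivative f (at x) = frechet_derivative g (at x)" if "x \<in> S" for x
      by (rule frechet_derivative_transform_within_open[OF _ assms(1) that Suc(2)])
         (use differentiable_on_open_at[OF assms(1)] True that in blast)
    then have "Ck_on k (\<lambda>x. frechet_derivative f (at x) v) S
        \<longleftrightarrow> Ck_on k (\<lambda>x. frechet_derivative g (at x) v) S" for v
      by (intro Suc(1)) auto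
    then show ?thesis using * by auto
  qed (use * in auto)
qed

lemma Ck_on_subset:
  assumes "Ck_on k f S" "T \<subseteq> S"
  shows "Ck_on k f T"
  using assms
  by (induction k arbitrary: f) (auto intro: continuous_on_subset differentiable_on_subset)

text \<open>Most uses of \<^const>\<open>Ck_on\<close> supply the derivative explicitly.\<close>

lemma Ck_on_SucI:
  assumes "open S" "\<And>x. x \<in> S \<Longrightarrow> (f has_derivative f' x) (at x)"
    and "\<And>v. Ck_on k (\<lambda>x. f' x v) S"
  shows "Ck_on (Suc k) f S"
proof -
  have "frechet_derivative f (at x) = f' x" if "x \<in> S" for x
    using frechet_derivative_at[OF assms(2)[OF that]] by simp
  then have "Ck_on k (\<lambda>x. frechet_derivative f (at x) v) S" for v
    using assms(3)[of v] Ck_on_cong[OF assms(1), of "\<lambda>x. frechet_derivative f (at x) v" "\<lambda>x. f' x v"] by simp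
  moreover have "f differentiable_on S"
    using assms by (auto simp: differentiable_on_open_at differentiable_def)
  ultimately show ?thesis by simp
qed

lemma Ck_on_SucE:
  assumes "open S" "Ck_on (Suc k) f S" "x \<in> S"
  shows "(f has_derivative frechet_derivative f (at x)) (at x)"
  using assms by (auto simp: differentiable_on_open_at frechet_derivative_works)

lemma Ck_on_const: "open S \<Longrightarrow> Ck_on k (\<lambda>x. c) S"
proof (induction k arbitrary: c)
  case (Suc k)
  then show ?case by (intro Ck_on_SucI[where f'="\<lambda>x v. 0"]) auto
qed auto

lemma Ck_on_bounded_linear:
  assumes "open S" "bounded_linear f"
  shows "Ck_on k f S"
proof (cases k)
  case 0
  then show ?thesis
    using assms by (auto intro: linear_continuous_on)
next
  case (Suc j)
  show ?thesis unfolding Suc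
    by (rule Ck_on_SucI[where f'="\<lambda>x. f"])
       (use assms in \<open>auto intro: bounded_linear_imp_has_derivative Ck_on_const\<close>)
qed

lemma Ck_on_add:
  assumes "open S" "Ck_on k f S" "Ck_on k g S"
  shows "Ck_on k (\<lambda>x. f x + g x) S"
  using assms(2,3)
proof (induction k arbitrary: f g)
  case 0
  then show ?case by (auto intro: continuous_intros)
next
  case (Suc k)
  show ?case
    by (rule Ck_on_SucI[OF assms(1) has_derivative_add[OF Ck_on_SucE[OF assms(1) Suc(2)] Ck_on_SucE[OF assms(1) Suc(3)]]])
       (use Suc in auto)
qed

lemma Ck_on_sum:
  assumes "open S" "\<And>i. i \<in> I \<Longrightarrow> Ck_on k (f i) S"
  shows "Ck_on k (\<lambda>x. \<Sum>i\<in>I. f i x) S"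
  using assms(2)
proof (induction I rule: infinite_finite_induct)
  case (insert i I)
  then show ?case using Ck_on_add[OF assms(1), of k "f i" "\<lambda>x. \<Sum>i\<in>I. f i x"] by simp
qed (use Ck_on_const[OF assms(1)] in auto)

lemma Ck_on_bilinear:
  assumes "open S" "bounded_bilinear B" "Ck_on k f S" "Ck_on k g S"
  shows "Ck_on k (\<lambda>x. B (f x) (g x)) S"
  using assms(3,4)
proof (induction k arbitrary: f g)
  case 0
  then show ?case using assms(2) by (auto intro: bounded_bilinear.continuous_on)
next
  case (Suc k)
  note d = Ck_on_SucE[OF assms(1) Suc(2)] Ck_on_SucE[OF assms(1) Suc(3)]
  show ?case
  proof (rule Ck_on_SucI[OF assms(1) bounded_bilinear.FDERIV[OF assms(2) d]])
    fix v
    show "Ck_on k (\<lambda>x. B (f x) (frechet_derivative g (at x) v) + B (frechet_derivative f (at x) v) (g x)) S"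
    proof (rule Ck_on_add[OF assms(1)])
      have "Ck_on k (\<lambda>x. frechet_derivative f (at x) v) S" "Ck_on k (\<lambda>x. frechet_derivative g (at x) v) S"
        using Suc.prems by simp_all
      then show "Ck_on k (\<lambda>x. B (f x) (frechet_derivative g (at x) v)) S"
        "Ck_on k (\<lambda>x. B (frechet_derivative f (at x) v) (g x)) S"
        using Suc.IH Ck_on_SucD[OF Suc.prems(1)] Ck_on_SucD[OF Suc.prems(2)] by blast+
    qed
  qed
qed

lemma Ck_on_bounded_linear_comp:
  assumes "open S" "bounded_linear L" "Ck_on k f S"
  shows "Ck_on k (\<lambda>x. L (f x)) S"
  using assms(3)
proof (induction k arbitrary: f)
  case 0
  then show ?case using assms(2) by (auto intro: bounded_linear.continuous_on)
next
  case (Suc k)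
  show ?case
    by (rule Ck_on_SucI[OF assms(1) bounded_linear.has_derivative[OF assms(2) Ck_on_SucE[OF assms(1) Suc(2)]]])
       (use Suc.IH Suc.prems in auto)
qed

text \<open>The chain rule expresses the derivative of a composite by products of maps of one order less, which
  is what the induction needs; a basis of the intermediate space is used for that purpose.\<close>

lemma Ck_on_comp:
  fixes g :: "'a::real_normed_vector \<Rightarrow> 'c::euclidean_space"
  assumes "open S" "open T" "g ` S \<subseteq> T" "Ck_on k f T" "Ck_on k g S"
  shows "Ck_on k (\<lambda>x. f (g x)) S"
  using assms(4,5)
proof (induction k arbitrary: f)
  case 0
  then show ?case using continuous_on_compose2[of T f S g] assms(3) by simp
next
  case (Suc k)
  have f: "(f has_derivative frechet_derivative f (at y)) (at y)" if "y \<in> T" for y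
    using Ck_on_SucE[OF assms(2) Suc(2) that] .
  have g: "(g has_derivative frechet_derivative g (at x)) (at x)" if "x \<in> S" for x
    using Ck_on_SucE[OF assms(1) Suc(3) that] .
  have fg: "((\<lambda>x. f (g x)) has_derivative (\<lambda>v. frechet_derivative f (at (g x)) (frechet_derivative g (at x) v))) (at x)"
    if "x \<in> S" for x
    by (rule has_derivative_compose[OF g[OF that] f]) (use that assms(3) in blast)
  \<comment> \<open>Expanding the inner derivative in a basis makes the chain rule a sum of products.\<close>
  have eq: "frechet_derivative f (at (g x)) (frechet_derivative g (at x) v) =
     (\<Sum>b\<in>Basis. (frechet_derivative g (at x) v \<bullet> b) *\<^sub>R frechet_derivative f (at (g x)) b)" if "x \<in> S" for x v
  proof -
    interpret bounded_linear "frechet_derivative f (at (g x))"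
      by (rule has_derivative_bounded_linear[OF f]) (use that assms(3) in blast)
    have "frechet_derivative f (at (g x)) (frechet_derivative g (at x) v) =
      frechet_derivative f (at (g x)) (\<Sum>b\<in>Basis. (frechet_derivative g (at x) v \<bullet> b) *\<^sub>R b)"
      by (simp only: euclidean_representation)
    also have "\<dots> = (\<Sum>b\<in>Basis. (frechet_derivative g (at x) v \<bullet> b) *\<^sub>R frechet_derivative f (at (g x)) b)"
      by (simp only: sum scaleR)
    finally show ?thesis .
  qed
  show ?case
  proof (rule Ck_on_SucI[OF assms(1) fg])
    fix v
    have "Ck_on k (\<lambda>x. (frechet_derivative g (at x) v \<bullet> b) *\<^sub>R frechet_derivative f (at (g x)) b) S" for b
    proof (rule Ck_on_bilinear[OF assms(1) bounded_bilinear_scaleR])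
      show "Ck_on k (\<lambda>x. frechet_derivative g (at x) v \<bullet> b) S"
        by (rule Ck_on_bounded_linear_comp[OF assms(1) bounded_linear_inner_left]) (use Suc.prems(2) in simp)
      show "Ck_on k (\<lambda>x. frechet_derivative f (at (g x)) b) S"
        by (rule Suc.IH) (use Suc.prems(1) Ck_on_SucD[OF Suc(3)] in simp_all)
    qed
    then have "Ck_on k (\<lambda>x. (\<Sum>b\<in>Basis. (frechet_derivative g (at x) v \<bullet> b) *\<^sub>R frechet_derivative f (at (g x)) b)) S"
      by (intro Ck_on_sum assms(1))
    then show "Ck_on k (\<lambda>x. frechet_derivative f (at (g x)) (frechet_derivative g (at x) v)) S"
      using Ck_on_cong[OF assms(1), of "\<lambda>x. frechet_derivative f (at (g x)) (frechet_derivative g (at x) v)"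
          "\<lambda>x. \<Sum>b\<in>Basis. (frechet_derivative g (at x) v \<bullet> b) *\<^sub>R frechet_derivative f (at (g x)) b" k] eq
      by simp
  qed
qed

lemma smooth_on_cong:
  "open S \<Longrightarrow> (\<And>x. x \<in> S \<Longrightarrow> f x = g x) \<Longrightarrow> smooth_on f S \<longleftrightarrow> smooth_on g S"
  unfolding smooth_on_def using Ck_on_cong by blast

lemma smooth_on_subset: "smooth_on f S \<Longrightarrow> T \<subseteq> S \<Longrightarrow> smooth_on f T"
  unfolding smooth_on_def using Ck_on_subset by blast

lemma smooth_on_continuous: "smooth_on f S \<Longrightarrow> continuous_on S f"
  unfolding smooth_on_def using Ck_on_continuous by blast

lemma smooth_on_const: "open S \<Longrightarrow> smooth_on (\<lambda>x. c) S"
  unfolding smooth_on_def using Ck_on_const by blast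

lemma smooth_on_bounded_linear: "open S \<Longrightarrow> bounded_linear f \<Longrightarrow> smooth_on f S"
  unfolding smooth_on_def using Ck_on_bounded_linear by blast

lemma smooth_on_add: "open S \<Longrightarrow> smooth_on f S \<Longrightarrow> smooth_on g S \<Longrightarrow> smooth_on (\<lambda>x. f x + g x) S"
  unfolding smooth_on_def using Ck_on_add by blast

lemma smooth_on_bilinear:
  "open S \<Longrightarrow> bounded_bilinear B \<Longrightarrow> smooth_on f S \<Longrightarrow> smooth_on g S \<Longrightarrow> smooth_on (\<lambda>x. B (f x) (g x)) S"
  unfolding smooth_on_def using Ck_on_bilinear by blast

lemmas smooth_on_scaleR = smooth_on_bilinear[OF _ bounded_bilinear_scaleR]
lemmas smooth_on_inner = smooth_on_bilinear[OF _ bounded_bilinear_inner]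
lemmas smooth_on_mult = smooth_on_bilinear[OF _ bounded_bilinear_mult]

lemma smooth_on_bounded_linear_comp:
  "open S \<Longrightarrow> bounded_linear L \<Longrightarrow> smooth_on f S \<Longrightarrow> smooth_on (\<lambda>x. L (f x)) S"
  unfolding smooth_on_def using Ck_on_bounded_linear_comp by blast

lemma smooth_on_uminus: "open S \<Longrightarrow> smooth_on f S \<Longrightarrow> smooth_on (\<lambda>x. - f x) S"
  by (rule smooth_on_bounded_linear_comp[OF _ bounded_linear_minus[OF bounded_linear_ident]])

lemma smooth_on_diff: "open S \<Longrightarrow> smooth_on f S \<Longrightarrow> smooth_on g S \<Longrightarrow> smooth_on (\<lambda>x. f x - g x) S"
  using smooth_on_add[of S f "\<lambda>x. - g x"] smooth_on_uminus[of S g] by simp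

lemma smooth_on_comp:
  fixes g :: "'a::real_normed_vector \<Rightarrow> 'c::euclidean_space"
  shows "open S \<Longrightarrow> open T \<Longrightarrow> g ` S \<subseteq> T \<Longrightarrow> smooth_on f T \<Longrightarrow> smooth_on g S \<Longrightarrow> smooth_on (\<lambda>x. f (g x)) S"
  unfolding smooth_on_def using Ck_on_comp by blast

lemma smooth_on_imp_has_derivative:
  "open S \<Longrightarrow> smooth_on f S \<Longrightarrow> x \<in> S \<Longrightarrow> (f has_derivative frechet_derivative f (at x)) (at x)"
  unfolding smooth_on_def using Ck_on_SucE by blast

lemma smooth_on_frechet: "smooth_on f S \<Longrightarrow> smooth_on (\<lambda>x. frechet_derivative f (at x) v) S"
  unfolding smooth_on_def by (metis Ck_on.simps(2))

text \<open>For maps given by different formulas on overlapping open sets.\<close>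

lemma smooth_on_local:
  assumes "\<And>x. x \<in> S \<Longrightarrow> \<exists>T. open T \<and> x \<in> T \<and> smooth_on f T"
  shows "smooth_on f S"
proof -
  have "Ck_on k f S" if "\<And>x. x \<in> S \<Longrightarrow> \<exists>T. open T \<and> x \<in> T \<and> Ck_on k f T" for k
    using that
  proof (induction k arbitrary: f)
    case 0
    show ?case unfolding Ck_on.simps continuous_on_eq_continuous_within
    proof
      fix x assume "x \<in> S"
      then obtain T where "open T" "x \<in> T" "continuous_on T f" using 0 by auto
      then show "continuous (at x within S) f"
        by (simp add: continuous_at_imp_continuous_within continuous_on_eq_continuous_at)
    qed
  next
    case (Suc k)
    have "f differentiable_on S"
      unfolding differentiable_on_def
    proof
      fix x assume "x \<in> S"
      then obtain T where "open T" "x \<in> T" "Ck_on (Suc k) f T" using Suc.prems by blast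
      then show "f differentiable (at x within S)"
        using differentiable_at_withinI differentiable_on_open_at by fastforce
    qed
    moreover have "Ck_on k (\<lambda>x. frechet_derivative f (at x) v) S" for v
      by (rule Suc.IH) (metis Suc.prems Ck_on.simps(2))
    ultimately show ?case by simp
  qed
  then show ?thesis using assms unfolding smooth_on_def by blast
qed

lemma smooth_on_inverse_real: "smooth_on (inverse :: real \<Rightarrow> real) (- {0})"
proof -
  have "Ck_on k (inverse :: real \<Rightarrow> real) (- {0})" for k
  proof (induction k)
    case 0
    then show ?case by (auto intro!: continuous_intros)
  next
    case (Suc k)
    show ?case
    proof (rule Ck_on_SucI)
      fix x :: real assume "x \<in> - {0}"
      then show "(inverse has_derivative (\<lambda>h. - (inverse x * h * inverse x))) (at x)"
        by (intro has_derivative_inverse') auto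
    next
      fix v :: real
      have "Ck_on k (\<lambda>x. (-v) * (inverse x * inverse x)) (- {0})"
        by (intro Ck_on_bilinear[OF _ bounded_bilinear_mult] Ck_on_const Suc) auto
      then show "Ck_on k (\<lambda>x. - (inverse x * v * inverse x)) (- {0})"
        by (simp add: mult_ac)
    qed auto
  qed
  then show ?thesis by (simp add: smooth_on_def)
qed

lemma smooth_on_divide:
  fixes f g :: "'a::real_normed_vector \<Rightarrow> real"
  assumes "open S" "smooth_on f S" "smooth_on g S" "\<And>x. x \<in> S \<Longrightarrow> g x \<noteq> 0"
  shows "smooth_on (\<lambda>x. f x / g x) S"
  unfolding divide_inverse
  by (rule smooth_on_mult[OF assms(1,2)], rule smooth_on_comp[OF assms(1) _ _ smooth_on_inverse_real assms(3)])
     (use assms in auto)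

lemma smooth_on_sqrt: "smooth_on sqrt {0<..}"
proof -
  have "Ck_on k sqrt {0<..}" for k
  proof (induction k)
    case 0
    then show ?case by (auto intro!: continuous_intros)
  next
    case (Suc k)
    show ?case
    proof (rule Ck_on_SucI)
      fix x :: real assume "x \<in> {0<..}"
      then show "(sqrt has_derivative (*) (inverse (sqrt x) / 2)) (at x)"
        using DERIV_real_sqrt[of x] by (simp add: has_field_derivative_def)
    next
      fix v :: real
      have "Ck_on k (\<lambda>x. inverse (sqrt x)) {0<..}"
        using smooth_on_inverse_real
        by (intro Ck_on_comp[where f=inverse and T="-{0}", OF _ _ _ _ Suc]) (auto simp: smooth_on_def)
      then have "Ck_on k (\<lambda>x. (v/2) * inverse (sqrt x)) {0<..}"
        by (rule Ck_on_bilinear[OF _ bounded_bilinear_mult Ck_on_const, rotated 2]) auto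
      then show "Ck_on k (\<lambda>x. inverse (sqrt x) / 2 * v) {0<..}"
        by (simp add: mult_ac)
    qed auto
  qed
  then show ?thesis by (simp add: smooth_on_def)
qed

section \<open>Mixed partial derivatives commute\<close>

text \<open>The mean value inequality is applied twice, along \<open>v\<close> to the derivative in direction \<open>u\<close> and
  then along \<open>u\<close>. The second difference on the left is symmetric in \<open>u\<close> and \<open>v\<close>; its
  leading coefficient is the iterated derivative.\<close>

lemma mixed_difference_bound:
  fixes f :: "'a::real_normed_vector \<Rightarrow> 'b::real_normed_vector"
  assumes "open S" "Ck_on 2 f S" "z \<in> S" "e > 0"
  shows "\<exists>d>0. \<forall>s. 0 < s \<and> s < d \<longrightarrow>
     norm (f (z + s *\<^sub>R u + s *\<^sub>R v) - f (z + s *\<^sub>R u) - f (z + s *\<^sub>R v) + f z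
       - (s * s) *\<^sub>R frechet_derivative (\<lambda>y. frechet_derivative f (at y) u) (at z) v) \<le> e * s * s"
proof -
  let ?Du = "\<lambda>y. frechet_derivative f (at y) u"
  let ?Duv = "\<lambda>y. frechet_derivative ?Du (at y) v"
  have C1: "Ck_on (Suc 0) ?Du S" and C0: "continuous_on S ?Duv"
    using assms(2) by (auto simp: numeral_2_eq_2)
  have f: "(f has_derivative frechet_derivative f (at y)) (at y)" if "y \<in> S" for y
    using Ck_on_SucE[OF assms(1) _ that, of "Suc 0" f] assms(2) by (simp only: numeral_2_eq_2)
  have Du: "(?Du has_derivative frechet_derivative ?Du (at y)) (at y)" if "y \<in> S" for y
    using Ck_on_SucE[OF assms(1) C1 that] .
  obtain r1 where r1: "r1 > 0" "ball z r1 \<subseteq> S"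
    using assms(1,3) open_contains_ball by blast
  obtain r2 where r2: "r2 > 0" "\<And>y. y \<in> S \<Longrightarrow> dist y z < r2 \<Longrightarrow> dist (?Duv y) (?Duv z) < e"
    using C0 assms(3,4) unfolding continuous_on_iff by metis
  define c where "c = ?Duv z"
  define N where "N = norm u + norm v + 1"
  have N: "N > 0" by (auto simp: N_def add_nonneg_pos)
  define d where "d = min r1 r2 / N"
  have "d > 0" using r1 r2 N by (simp add: d_def)
  moreover have "norm (f (z + s *\<^sub>R u + s *\<^sub>R v) - f (z + s *\<^sub>R u) - f (z + s *\<^sub>R v) + f z - (s * s) *\<^sub>R c) \<le> e * s * s"
    if s: "0 < s" "s < d" for s
  proof -
    have near: "z + a *\<^sub>R u + b *\<^sub>R v \<in> S \<and> norm (?Duv (z + a *\<^sub>R u + b *\<^sub>R v) - c) \<le> e"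
      if "a \<in> {0..s}" "b \<in> {0..s}" for a b
    proof -
      have "norm (a *\<^sub>R u + b *\<^sub>R v) \<le> a * norm u + b * norm v"
        using that by (intro norm_triangle_le) auto
      also have "\<dots> \<le> s * norm u + s * norm v"
        using that by (intro add_mono mult_right_mono) auto
      also have "\<dots> < s * N" using s by (simp add: N_def algebra_simps)
      also have "\<dots> < min r1 r2" using s N by (simp add: d_def field_simps)
      finally have "norm (a *\<^sub>R u + b *\<^sub>R v) < min r1 r2" .
      then have *: "dist (z + a *\<^sub>R u + b *\<^sub>R v) z < r1" "dist (z + a *\<^sub>R u + b *\<^sub>R v) z < r2"
        by (auto simp: dist_norm add.assoc)
      then have "z + a *\<^sub>R u + b *\<^sub>R v \<in> S" using r1 by (auto simp: dist_commute)
      with r2(2)[OF this *(2)] show ?thesis by (auto simp: c_def dist_norm)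
    qed
    have inner: "norm (?Du (z + a *\<^sub>R u + s *\<^sub>R v) - ?Du (z + a *\<^sub>R u) - s *\<^sub>R c) \<le> e * s" if a: "a \<in> {0..s}" for a
    proof -
      define k where "k b = ?Du (z + a *\<^sub>R u + b *\<^sub>R v) - b *\<^sub>R c" for b
      have "norm (k s - k 0) \<le> e * norm (s - 0)"
      proof (rule differentiable_bound[of "{0..s}" k "\<lambda>b h. h *\<^sub>R (?Duv (z + a *\<^sub>R u + b *\<^sub>R v) - c)"])
        fix b assume b: "b \<in> {0..s}"
        let ?y = "z + a *\<^sub>R u + b *\<^sub>R v"
        have lin: "linear (frechet_derivative ?Du (at ?y))"
          using Du near[OF a b] has_derivative_linear by blast
        have "((\<lambda>b. ?Du (z + a *\<^sub>R u + b *\<^sub>R v)) has_derivative (\<lambda>h. frechet_derivative ?Du (at ?y) (h *\<^sub>R v))) (at b within {0..s})"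
          by (rule has_derivative_compose[of "\<lambda>b. z + a *\<^sub>R u + b *\<^sub>R v"])
             (use near[OF a b] Du in \<open>auto intro!: derivative_eq_intros\<close>)
        then have "((\<lambda>b. ?Du (z + a *\<^sub>R u + b *\<^sub>R v)) has_derivative (\<lambda>h. h *\<^sub>R ?Duv ?y)) (at b within {0..s})"
          by (simp only: linear_cmul[OF lin])
        then show "(k has_derivative (\<lambda>h. h *\<^sub>R (?Duv ?y - c))) (at b within {0..s})"
          unfolding k_def scaleR_diff_right by (rule has_derivative_diff) (auto intro!: derivative_eq_intros)
        show "onorm (\<lambda>h. h *\<^sub>R (?Duv ?y - c)) \<le> e"
          by (rule onorm_le) (use near[OF a b] in \<open>auto simp: mult.commute[of e] intro: mult_left_mono\<close>)
      qed (use s in auto)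
      then show ?thesis using s by (simp add: k_def algebra_simps)
    qed
    define m where "m a = f (z + a *\<^sub>R u + s *\<^sub>R v) - f (z + a *\<^sub>R u) - (a * s) *\<^sub>R c" for a
    have "norm (m s - m 0) \<le> (e * s) * norm (s - 0)"
    proof (rule differentiable_bound[of "{0..s}" m "\<lambda>a h. h *\<^sub>R (?Du (z + a *\<^sub>R u + s *\<^sub>R v) - ?Du (z + a *\<^sub>R u) - s *\<^sub>R c)"])
      fix a assume a: "a \<in> {0..s}"
      let ?y = "z + a *\<^sub>R u"
      have in1: "?y + s *\<^sub>R v \<in> S" using near[OF a, of s] s by auto
      have in2: "?y \<in> S" using near[OF a, of 0] s by auto
      have lin: "linear (frechet_derivative f (at (?y + s *\<^sub>R v)))" "linear (frechet_derivative f (at ?y))"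
        using f in1 in2 has_derivative_linear by blast+
      have "((\<lambda>a. f (z + a *\<^sub>R u + s *\<^sub>R v)) has_derivative (\<lambda>h. frechet_derivative f (at (?y + s *\<^sub>R v)) (h *\<^sub>R u))) (at a within {0..s})"
        by (rule has_derivative_compose[of "\<lambda>a. z + a *\<^sub>R u + s *\<^sub>R v"])
           (use in1 f in \<open>auto intro!: derivative_eq_intros\<close>)
      moreover have "((\<lambda>a. f (z + a *\<^sub>R u)) has_derivative (\<lambda>h. frechet_derivative f (at ?y) (h *\<^sub>R u))) (at a within {0..s})"
        by (rule has_derivative_compose[of "\<lambda>a. z + a *\<^sub>R u"])
           (use in2 f in \<open>auto intro!: derivative_eq_intros\<close>)
      ultimately have "((\<lambda>a. f (z + a *\<^sub>R u + s *\<^sub>R v)) has_derivative (\<lambda>h. h *\<^sub>R ?Du (?y + s *\<^sub>R v))) (at a within {0..s})"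
        "((\<lambda>a. f (z + a *\<^sub>R u)) has_derivative (\<lambda>h. h *\<^sub>R ?Du ?y)) (at a within {0..s})"
        by (simp_all only: linear_cmul[OF lin(1)] linear_cmul[OF lin(2)])
      then show "(m has_derivative (\<lambda>h. h *\<^sub>R (?Du (?y + s *\<^sub>R v) - ?Du ?y - s *\<^sub>R c))) (at a within {0..s})"
        unfolding m_def scaleR_diff_right
        by (intro has_derivative_diff) (auto intro!: derivative_eq_intros)
      show "onorm (\<lambda>h. h *\<^sub>R (?Du (?y + s *\<^sub>R v) - ?Du ?y - s *\<^sub>R c)) \<le> e * s"
        by (rule onorm_le) (use inner[OF a] in \<open>auto simp: mult.commute[of "e * s"] intro: mult_left_mono\<close>)
    qed (use s in auto)
    then show ?thesis using s by (simp add: m_def algebra_simps)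
  qed
  ultimately show ?thesis unfolding c_def by blast
qed

lemma frechet_derivative_commute:
  fixes f :: "'a::real_normed_vector \<Rightarrow> 'b::real_normed_vector"
  assumes "open S" "Ck_on 2 f S" "z \<in> S"
  shows "frechet_derivative (\<lambda>y. frechet_derivative f (at y) u) (at z) v =
         frechet_derivative (\<lambda>y. frechet_derivative f (at y) v) (at z) u" (is "?a = ?b")
proof (rule ccontr)
  assume "?a \<noteq> ?b"
  define e where "e = norm (?a - ?b) / 3"
  have e: "e > 0" using \<open>?a \<noteq> ?b\<close> by (simp add: e_def)
  obtain d1 where d1: "d1 > 0" "\<And>s. 0 < s \<Longrightarrow> s < d1 \<Longrightarrow>
     norm (f (z + s *\<^sub>R u + s *\<^sub>R v) - f (z + s *\<^sub>R u) - f (z + s *\<^sub>R v) + f z - (s * s) *\<^sub>R ?a) \<le> e * s * s"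
    using mixed_difference_bound[OF assms e, of u v] by blast
  obtain d2 where d2: "d2 > 0" "\<And>s. 0 < s \<Longrightarrow> s < d2 \<Longrightarrow>
     norm (f (z + s *\<^sub>R v + s *\<^sub>R u) - f (z + s *\<^sub>R v) - f (z + s *\<^sub>R u) + f z - (s * s) *\<^sub>R ?b) \<le> e * s * s"
    using mixed_difference_bound[OF assms e, of v u] by blast
  define s where "s = min d1 d2 / 2"
  have s: "0 < s" "s < d1" "s < d2" using d1 d2 by (auto simp: s_def)
  define R where "R = f (z + s *\<^sub>R u + s *\<^sub>R v) - f (z + s *\<^sub>R u) - f (z + s *\<^sub>R v) + f z"
  have R2: "R = f (z + s *\<^sub>R v + s *\<^sub>R u) - f (z + s *\<^sub>R v) - f (z + s *\<^sub>R u) + f z"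
    by (simp add: R_def algebra_simps)
  have "(s * s) * norm (?a - ?b) = norm ((R - (s * s) *\<^sub>R ?b) - (R - (s * s) *\<^sub>R ?a))"
    using s by (simp add: scaleR_diff_right[symmetric])
  also have "\<dots> \<le> e * s * s + e * s * s"
    using d1(2)[OF s(1,2)] d2(2)[OF s(1,3)] unfolding R_def[symmetric] R2[symmetric]
    by (intro norm_triangle_le_diff) linarith
  finally have "(s * s) * (3 * e) \<le> (s * s) * (2 * e)" by (simp add: e_def algebra_simps)
  then show False using s e by simp
qed

lemma smooth_on_imp_Ck_on: "smooth_on f S \<Longrightarrow> Ck_on k f S"
  by (simp add: smooth_on_def)


section \<open>Fourier series on the torus\<close>

definition frq :: "int \<times> int \<Rightarrow> complex" where
  "frq n = Complex (of_int (fst n)) (of_int (snd n))"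

definition character :: "int \<times> int \<Rightarrow> complex \<Rightarrow> complex" where
  "character n z = cis (frq n \<bullet> z)"

definition fourier_sum :: "(int \<times> int \<Rightarrow> complex) \<Rightarrow> complex \<Rightarrow> complex" where
  "fourier_sum a z = (\<Sum>\<^sub>\<infinity>n. a n * character n z)"

text \<open>Decay faster than every power, in the summable form in which it enters estimates of series.\<close>

definition rapid :: "(int \<times> int \<Rightarrow> complex) \<Rightarrow> bool" where
  "rapid a \<longleftrightarrow> (\<forall>s. (\<lambda>n. (1 + norm (frq n)) ^ s * norm (a n)) summable_on UNIV)"

lemma frq_0 [simp]: "frq 0 = 0"
  by (simp add: frq_def complex_eq_iff)

lemma frq_add: "frq (m + n) = frq m + frq n"
  by (simp add: frq_def complex_eq_iff)

lemma frq_eq_0_iff [simp]: "frq n = 0 \<longleftrightarrow> n = 0"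
  by (cases n) (auto simp: frq_def complex_eq_iff zero_prod_def)

lemma character_add: "character (m + n) z = character m z * character n z"
  by (simp add: character_def frq_add cis_mult inner_add_left)

lemma character_0 [simp]: "character 0 z = 1"
  by (simp add: character_def)

lemma norm_character [simp]: "norm (character n z) = 1"
  by (simp add: character_def)

lemma rapid_summable: "rapid a \<Longrightarrow> (\<lambda>n. norm (a n)) summable_on UNIV"
  unfolding rapid_def by (erule allE[of _ 0]) simp

lemma rapid_mult:
  assumes "rapid a" "\<And>n. norm (c n) \<le> K * (1 + norm (frq n)) ^ j"
  shows "rapid (\<lambda>n. c n * a n)"
  unfolding rapid_def
proof
  fix s
  have "(\<lambda>n. K * ((1 + norm (frq n)) ^ (s + j) * norm (a n))) summable_on UNIV"
    using assms(1) unfolding rapid_def by (intro summable_on_cmult_right) blast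
  then show "(\<lambda>n. (1 + norm (frq n)) ^ s * norm (c n * a n)) summable_on UNIV"
  proof (rule summable_on_comparison_test)
    fix n
    have "(1 + norm (frq n)) ^ s * norm (c n * a n) \<le> (1 + norm (frq n)) ^ s * ((K * (1 + norm (frq n)) ^ j) * norm (a n))"
      unfolding norm_mult by (intro mult_left_mono mult_right_mono assms) auto
    then show "(1 + norm (frq n)) ^ s * norm (c n * a n) \<le> K * ((1 + norm (frq n)) ^ (s + j) * norm (a n))"
      by (simp add: power_add mult_ac)
  qed auto
qed

lemma abs_summable_fourier_sum:
  assumes "(\<lambda>n. norm (a n)) summable_on UNIV"
  shows "(\<lambda>n. a n * character n z) summable_on UNIV"
  by (rule abs_summable_summable) (use assms in \<open>simp add: norm_mult\<close>)

lemma fourier_sum_has_sum: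
  assumes "(\<lambda>n. norm (a n)) summable_on UNIV"
  shows "((\<lambda>n. a n * character n z) has_sum fourier_sum a z) UNIV"
  unfolding fourier_sum_def by (rule has_sum_infsum[OF abs_summable_fourier_sum[OF assms]])

lemma norm_fourier_sum_le:
  assumes "(\<lambda>n. norm (a n)) summable_on UNIV"
  shows "norm (fourier_sum a z) \<le> (\<Sum>\<^sub>\<infinity>n. norm (a n))"
  by (rule norm_infsum_le[OF fourier_sum_has_sum[OF assms] has_sum_infsum[OF assms]]) (simp add: norm_mult)

lemma norm_cis_minus_1: "norm (cis t - 1) \<le> \<bar>t\<bar>"
proof -
  have "norm (cis t - cis 0) \<le> 1 * norm (t - 0)"
    by (rule differentiable_bound[of UNIV cis "\<lambda>x h. h *\<^sub>R (\<i> * cis x)"])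
       (auto intro!: onorm_le derivative_eq_intros simp: norm_mult)
  then show ?thesis by simp
qed

lemma norm_cis_minus_linear: "norm (cis t - 1 - \<i> * of_real t) \<le> t\<^sup>2"
proof -
  let ?k = "\<lambda>x. cis x - x *\<^sub>R \<i>"
  have "norm (?k t - ?k 0) \<le> \<bar>t\<bar> * norm (t - 0)"
  proof (rule differentiable_bound[of "cball 0 \<bar>t\<bar>" ?k "\<lambda>x h. h *\<^sub>R (\<i> * (cis x - 1))"])
    fix x :: real assume x: "x \<in> cball 0 \<bar>t\<bar>"
    have "(cis has_derivative (\<lambda>h. h *\<^sub>R (\<i> * cis x))) (at x within cball 0 \<bar>t\<bar>)"
      by (auto intro!: derivative_eq_intros)
    moreover have "((\<lambda>x. x *\<^sub>R \<i>) has_derivative (\<lambda>h. h *\<^sub>R \<i>)) (at x within cball 0 \<bar>t\<bar>)"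
      by (auto intro!: derivative_eq_intros)
    ultimately have "(?k has_derivative (\<lambda>h. h *\<^sub>R (\<i> * cis x) - h *\<^sub>R \<i>)) (at x within cball 0 \<bar>t\<bar>)"
      by (rule has_derivative_diff)
    then show "(?k has_derivative (\<lambda>h. h *\<^sub>R (\<i> * (cis x - 1)))) (at x within cball 0 \<bar>t\<bar>)"
      by (simp add: algebra_simps)
    have *: "norm (cis x - 1) \<le> \<bar>t\<bar>" using norm_cis_minus_1[of x] x by simp
    show "onorm (\<lambda>h. h *\<^sub>R (\<i> * (cis x - 1))) \<le> \<bar>t\<bar>"
      by (rule onorm_le) (use * in \<open>simp add: norm_mult mult.commute[of "\<bar>t\<bar>"] mult_left_mono\<close>)
  qed auto
  then show ?thesis by (simp add: power2_eq_square scaleR_conv_of_real mult.commute algebra_simps)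
qed

lemma abs_inner_frq_le: "\<bar>frq n \<bullet> v\<bar> \<le> (1 + norm (frq n)) * norm v"
  by (rule order_trans[OF Cauchy_Schwarz_ineq2]) (simp add: algebra_simps)

lemma fourier_sum_add:
  assumes "(\<lambda>n. norm (a n)) summable_on UNIV" "(\<lambda>n. norm (b n)) summable_on UNIV"
  shows "fourier_sum (\<lambda>n. a n + b n) z = fourier_sum a z + fourier_sum b z"
proof -
  have "((\<lambda>n. (a n + b n) * character n z) has_sum (fourier_sum a z + fourier_sum b z)) UNIV"
    using has_sum_add[OF fourier_sum_has_sum[OF assms(1), of z] fourier_sum_has_sum[OF assms(2), of z]]
    by (simp add: algebra_simps)
  then show ?thesis unfolding fourier_sum_def by (rule infsumI)
qed

lemma fourier_sum_cmult:
  assumes "(\<lambda>n. norm (a n)) summable_on UNIV"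
  shows "fourier_sum (\<lambda>n. c * a n) z = c * fourier_sum a z"
proof -
  have "((\<lambda>n. (c * a n) * character n z) has_sum (c * fourier_sum a z)) UNIV"
    using has_sum_cmult_right[OF fourier_sum_has_sum[OF assms(1), of z], of c]
    by (simp add: mult_ac)
  then show ?thesis unfolding fourier_sum_def by (rule infsumI)
qed

text \<open>The remainder of the first order expansion of each character is quadratic, so the derivative of
  the series is found by summing one estimate.\<close>

lemma fourier_sum_has_derivative:
  assumes "rapid a"
  shows "(fourier_sum a has_derivative (\<lambda>v. fourier_sum (\<lambda>n. (\<i> * of_real (frq n \<bullet> v)) * a n) z)) (at z)"
proof -
  define D where "D v = fourier_sum (\<lambda>n. (\<i> * of_real (frq n \<bullet> v)) * a n) z" for v
  define C where "C = (\<Sum>\<^sub>\<infinity>n. (1 + norm (frq n)) ^ 2 * norm (a n))"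
  have r: "rapid (\<lambda>n. (\<i> * of_real (frq n \<bullet> v)) * a n)" for v
  proof (rule rapid_mult[OF assms, where j = 1])
    fix n show "norm (\<i> * complex_of_real (frq n \<bullet> v)) \<le> norm v * (1 + norm (frq n)) ^ 1"
      using abs_inner_frq_le[of n v] by (simp add: norm_mult mult.commute)
  qed
  have sC: "(\<lambda>n. (1 + norm (frq n)) ^ 2 * norm (a n)) summable_on UNIV"
    using assms unfolding rapid_def by blast
  have sa: "(\<lambda>n. norm (a n)) summable_on UNIV"
    using assms by (rule rapid_summable)
  have est: "norm (fourier_sum a (z + h) - fourier_sum a z - D h) \<le> C * norm h * norm h" for h
  proof -
    have "((\<lambda>n. a n * character n (z + h) - a n * character n z - (\<i> * of_real (frq n \<bullet> h)) * a n * character n z)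
       has_sum (fourier_sum a (z + h) - fourier_sum a z - D h)) UNIV"
      unfolding D_def diff_conv_add_uminus using sa rapid_summable[OF r]
      by (intro has_sum_add has_sum_uminusI fourier_sum_has_sum)
    moreover have "((\<lambda>n. (1 + norm (frq n)) ^ 2 * norm (a n) * (norm h * norm h)) has_sum C * (norm h * norm h)) UNIV"
      unfolding C_def by (intro has_sum_cmult_left has_sum_infsum sC)
    ultimately have "norm (fourier_sum a (z + h) - fourier_sum a z - D h) \<le> C * (norm h * norm h)"
    proof (rule norm_infsum_le)
      fix n
      have "a n * character n (z + h) - a n * character n z - (\<i> * of_real (frq n \<bullet> h)) * a n * character n z
          = a n * character n z * (cis (frq n \<bullet> h) - 1 - \<i> * of_real (frq n \<bullet> h))"
        by (simp add: character_def inner_add_right cis_mult[symmetric] algebra_simps)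
      then have "norm (a n * character n (z + h) - a n * character n z - (\<i> * of_real (frq n \<bullet> h)) * a n * character n z)
         \<le> norm (a n) * (frq n \<bullet> h)\<^sup>2"
        using norm_cis_minus_linear[of "frq n \<bullet> h"] by (simp add: norm_mult mult_left_mono)
      also have "\<dots> \<le> norm (a n) * ((1 + norm (frq n)) * norm h)\<^sup>2"
      proof (rule mult_left_mono)
        have "\<bar>frq n \<bullet> h\<bar>\<^sup>2 \<le> ((1 + norm (frq n)) * norm h)\<^sup>2"
          by (intro power_mono abs_inner_frq_le) auto
        then show "(frq n \<bullet> h)\<^sup>2 \<le> ((1 + norm (frq n)) * norm h)\<^sup>2" by simp
      qed auto
      finally show "norm (a n * character n (z + h) - a n * character n z - (\<i> * of_real (frq n \<bullet> h)) * a n * character n z)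
         \<le> (1 + norm (frq n)) ^ 2 * norm (a n) * (norm h * norm h)"
        by (simp add: power_mult_distrib power2_eq_square mult_ac)
    qed
    then show ?thesis by (simp add: mult.assoc)
  qed
  have lin: "bounded_linear D"
  proof (rule bounded_linear_intro)
    fix x y
    show "D (x + y) = D x + D y"
      unfolding D_def using fourier_sum_add[OF rapid_summable[OF r[of x]] rapid_summable[OF r[of y]], of z]
      by (simp add: inner_add_right algebra_simps)
  next
    fix c x
    show "D (c *\<^sub>R x) = c *\<^sub>R D x"
      unfolding D_def using fourier_sum_cmult[OF rapid_summable[OF r[of x]], of "of_real c" z]
      unfolding inner_scaleR_right of_real_mult by (simp add: scaleR_conv_of_real mult_ac)
  next
    fix x
    have "norm (D x) \<le> (\<Sum>\<^sub>\<infinity>n. norm ((\<i> * of_real (frq n \<bullet> x)) * a n))"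
      unfolding D_def by (rule norm_fourier_sum_le[OF rapid_summable[OF r]])
    also have "\<dots> \<le> (\<Sum>\<^sub>\<infinity>n. norm x * ((1 + norm (frq n)) ^ 1 * norm (a n)))"
    proof (rule infsum_mono)
      show "(\<lambda>n. norm x * ((1 + norm (frq n)) ^ 1 * norm (a n))) summable_on UNIV"
        using assms unfolding rapid_def by (intro summable_on_cmult_right) blast
      fix n
      show "norm ((\<i> * of_real (frq n \<bullet> x)) * a n) \<le> norm x * ((1 + norm (frq n)) ^ 1 * norm (a n))"
        using mult_right_mono[OF abs_inner_frq_le[of n x], of "norm (a n)"] by (simp add: norm_mult mult_ac)
    qed (use rapid_summable[OF r] in auto)
    also have "\<dots> = norm x * (\<Sum>\<^sub>\<infinity>n. (1 + norm (frq n)) ^ 1 * norm (a n))"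
      by (rule infsum_cmult_right')
    finally show "norm (D x) \<le> norm x * (\<Sum>\<^sub>\<infinity>n. (1 + norm (frq n)) ^ 1 * norm (a n))" .
  qed
  have "(fourier_sum a has_derivative D) (at z)"
    unfolding has_derivative_at
  proof
    show "bounded_linear D" by (rule lin)
    show "(\<lambda>h. norm (fourier_sum a (z + h) - fourier_sum a z - D h) / norm h) \<midarrow>0\<rightarrow> 0"
    proof (rule Lim_null_comparison)
      show "\<forall>\<^sub>F h in at 0. norm (norm (fourier_sum a (z + h) - fourier_sum a z - D h) / norm h) \<le> C * norm h"
        using est by (intro eventuallyI) (auto simp: divide_le_eq)
      show "((\<lambda>h. C * norm h) \<longlongrightarrow> 0) (at 0)"
        by (auto intro!: tendsto_eq_intros)
    qed
  qed
  then show ?thesis unfolding D_def .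
qed

lemma rapid_derivative: "rapid a \<Longrightarrow> rapid (\<lambda>n. (\<i> * of_real (frq n \<bullet> v)) * a n)"
proof (erule rapid_mult[where j = 1])
  fix n show "norm (\<i> * complex_of_real (frq n \<bullet> v)) \<le> norm v * (1 + norm (frq n)) ^ 1"
    using abs_inner_frq_le[of n v] by (simp add: norm_mult mult.commute)
qed

lemma smooth_on_fourier_sum:
  assumes "rapid a"
  shows "smooth_on (fourier_sum a) UNIV"
proof -
  have "Ck_on k (fourier_sum a) UNIV" for k
    using assms
  proof (induction k arbitrary: a)
    case 0
    have "continuous (at z) (fourier_sum a)" for z
      using fourier_sum_has_derivative[OF 0] by (rule has_derivative_continuous)
    then show ?case by (auto intro: continuous_at_imp_continuous_on)
  next
    case (Suc k)
    show ?case
      by (rule Ck_on_SucI[OF open_UNIV fourier_sum_has_derivative[OF Suc.prems]])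
         (rule Suc.IH[OF rapid_derivative[OF Suc.prems]])
  qed
  then show ?thesis by (simp add: smooth_on_def)
qed

subsection \<open>Convolution\<close>

definition conv :: "(int \<times> int \<Rightarrow> complex) \<Rightarrow> (int \<times> int \<Rightarrow> complex) \<Rightarrow> int \<times> int \<Rightarrow> complex" where
  "conv a b n = (\<Sum>\<^sub>\<infinity>k. a (n - k) * b k)"

lemma has_sum_product_nonneg:
  fixes f :: "'i \<Rightarrow> real" and g :: "'j \<Rightarrow> real"
  assumes "(f has_sum S) UNIV" "(g has_sum T) UNIV" "\<And>x. f x \<ge> 0" "\<And>x. g x \<ge> 0"
  shows "((\<lambda>(x,y). f x * g y) has_sum S * T) UNIV"
proof -
  have row: "((\<lambda>y. case (x,y) of (x,y) \<Rightarrow> f x * g y) has_sum f x * T) UNIV" for x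
    using has_sum_cmult_right[OF assms(2), of "f x"] by simp
  have tot: "((\<lambda>x. f x * T) has_sum S * T) UNIV"
    by (rule has_sum_cmult_left[OF assms(1)])
  have "(\<lambda>(x,y). f x * g y) summable_on (UNIV \<times> UNIV)"
    by (rule summable_on_SigmaI[OF row has_sum_imp_summable[OF tot]]) (use assms in auto)
  then have "((\<lambda>(x,y). f x * g y) has_sum S * T) (UNIV \<times> UNIV)"
    by (intro has_sum_SigmaI[OF row tot])
  then show ?thesis by simp
qed

lemma bij_shear: "bij (\<lambda>(n::int\<times>int, k::int\<times>int). (n - k, k))"
  by (rule bijI') (force simp: algebra_simps)+

text \<open>The substitution \<open>(n, k) \<mapsto> (n - k, k)\<close> turns convolutions into products.\<close>

lemma has_sum_shear:
  assumes "(F has_sum S) (UNIV :: ((int\<times>int)\<times>(int\<times>int)) set)"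
  shows "((\<lambda>(n,k). F (n - k, k)) has_sum S) UNIV"
  using has_sum_reindex_bij_betw[OF bij_shear, of F S] assms by (simp add: case_prod_unfold)

text \<open>Weighted summability is stable under convolution as soon as the weight is submultiplicative.\<close>

lemma conv_weighted:
  fixes w :: "int \<times> int \<Rightarrow> real"
  assumes w: "\<And>n. w n \<ge> 1" "\<And>m n. w (m + n) \<le> w m * w n"
    and a: "((\<lambda>n. w n * norm (a n)) has_sum S) UNIV" and b: "((\<lambda>n. w n * norm (b n)) has_sum T) UNIV"
  shows "(\<lambda>n. w n * norm (conv a b n)) summable_on UNIV"
    "(\<Sum>\<^sub>\<infinity>n. w n * norm (conv a b n)) \<le> S * T"
    "(\<lambda>k. norm (a (n - k) * b k)) summable_on UNIV"
    "(\<lambda>(n,k). norm (a (n - k) * b k)) summable_on UNIV"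
proof -
  have w0: "w n \<ge> 0" for n using w(1)[of n] by simp
  let ?F = "\<lambda>(n,k). (w (n - k) * norm (a (n - k))) * (w k * norm (b k))"
  have F: "(?F has_sum S * T) UNIV"
    using has_sum_shear[OF has_sum_product_nonneg[OF a b]] w0 by (simp add: case_prod_unfold)
  have le: "w n * norm (a (n - k) * b k) \<le> ?F (n, k)" for n k
  proof -
    have "w n * (norm (a (n - k)) * norm (b k)) \<le> (w (n - k) * w k) * (norm (a (n - k)) * norm (b k))"
      using w(2)[of "n - k" k] by (intro mult_right_mono) auto
    then show ?thesis by (simp add: norm_mult mult_ac)
  qed
  have le1: "norm (a (n - k) * b k) \<le> w n * norm (a (n - k) * b k)" for n k
    using mult_right_mono[OF w(1)[of n], of "norm (a (n - k) * b k)"] by simp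
  have sG: "(\<lambda>(n,k). w n * norm (a (n - k) * b k)) summable_on UNIV"
    by (rule summable_on_comparison_test[OF has_sum_imp_summable[OF F]]) (use le w0 in auto)
  show s4: "(\<lambda>(n,k). norm (a (n - k) * b k)) summable_on UNIV"
    by (rule summable_on_comparison_test[OF sG]) (use le1 in auto)
  have row: "(\<lambda>k. norm (a (n - k) * b k)) summable_on UNIV" for n
    using summable_on_SigmaD1[where f = "\<lambda>n k. norm (a (n - k) * b k)" and A = UNIV and B = "\<lambda>_. UNIV" and x = n] s4 by simp
  show "(\<lambda>k. norm (a (n - k) * b k)) summable_on UNIV" by (rule row)
  define R where "R n = (\<Sum>\<^sub>\<infinity>k. w n * norm (a (n - k) * b k))" for n
  have rowR: "((\<lambda>k. case (n,k) of (n,k) \<Rightarrow> w n * norm (a (n - k) * b k)) has_sum R n) UNIV" for n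
    unfolding R_def using row[of n] by (auto intro!: has_sum_infsum summable_on_cmult_right)
  have Rtot: "(R has_sum (\<Sum>\<^sub>\<infinity>p. case p of (n,k) \<Rightarrow> w n * norm (a (n - k) * b k))) UNIV"
    using has_sum_SigmaD[where f = "\<lambda>(n,k). w n * norm (a (n - k) * b k)" and A = UNIV and B = "\<lambda>_. UNIV" and g = R, OF _ rowR]
      has_sum_infsum[OF sG] by simp
  have le3: "w n * norm (conv a b n) \<le> R n" for n
  proof -
    have "norm (conv a b n) \<le> (\<Sum>\<^sub>\<infinity>k. norm (a (n - k) * b k))"
      unfolding conv_def by (rule norm_infsum_bound[OF row])
    then show ?thesis unfolding R_def infsum_cmult_right' using w0 by (intro mult_left_mono)
  qed
  show s: "(\<lambda>n. w n * norm (conv a b n)) summable_on UNIV"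
    by (rule summable_on_comparison_test[OF has_sum_imp_summable[OF Rtot]]) (use le3 w0 in auto)
  have "(\<Sum>\<^sub>\<infinity>n. w n * norm (conv a b n)) \<le> (\<Sum>\<^sub>\<infinity>n. R n)"
    by (rule infsum_mono[OF s has_sum_imp_summable[OF Rtot] le3])
  also have "\<dots> = (\<Sum>\<^sub>\<infinity>p. case p of (n,k) \<Rightarrow> w n * norm (a (n - k) * b k))"
    by (rule infsumI[OF Rtot])
  also have "\<dots> \<le> (\<Sum>\<^sub>\<infinity>p. ?F p)"
    by (rule infsum_mono[OF sG has_sum_imp_summable[OF F]]) (use le in auto)
  also have "\<dots> = S * T" by (rule infsumI[OF F])
  finally show "(\<Sum>\<^sub>\<infinity>n. w n * norm (conv a b n)) \<le> S * T" .
qed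

lemma fourier_sum_conv:
  assumes a: "(\<lambda>n. norm (a n)) summable_on UNIV" and b: "(\<lambda>n. norm (b n)) summable_on UNIV"
  shows "fourier_sum (conv a b) z = fourier_sum a z * fourier_sum b z"
proof -
  let ?G = "\<lambda>(n,k). (a (n - k) * character (n - k) z) * (b k * character k z)"
  have s: "(\<lambda>(n,k). norm (a (n - k) * b k)) summable_on UNIV"
    and row: "(\<lambda>k. norm (a (n - k) * b k)) summable_on UNIV" for n
    using conv_weighted[of "\<lambda>_. 1" a _ b] has_sum_infsum[OF a] has_sum_infsum[OF b] by simp_all
  let ?P = "\<lambda>(m,k). (a m * character m z) * (b k * character k z)"
  have "(\<lambda>(m,k). norm (a m) * norm (b k)) summable_on UNIV"
    by (rule has_sum_imp_summable[OF has_sum_product_nonneg[OF has_sum_infsum[OF a] has_sum_infsum[OF b]]]) auto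
  then have P: "?P summable_on (UNIV \<times> UNIV)"
    by (intro abs_summable_summable[of ?P]) (simp add: norm_mult case_prod_unfold)
  have Prow: "((\<lambda>k. ?P (m,k)) has_sum (a m * character m z) * fourier_sum b z) UNIV" for m
    using has_sum_cmult_right[OF fourier_sum_has_sum[OF b, of z], of "a m * character m z"] by simp
  have Ptot: "((\<lambda>m. (a m * character m z) * fourier_sum b z) has_sum fourier_sum a z * fourier_sum b z) UNIV"
    by (rule has_sum_cmult_left[OF fourier_sum_has_sum[OF a]])
  have "(?P has_sum fourier_sum a z * fourier_sum b z) (UNIV \<times> UNIV)"
    by (rule has_sum_SigmaI[OF Prow Ptot P])
  then have G: "(?G has_sum fourier_sum a z * fourier_sum b z) (UNIV \<times> UNIV)"
    using has_sum_shear[of ?P] by simp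
  have "((\<lambda>n. conv a b n * character n z) has_sum fourier_sum a z * fourier_sum b z) UNIV"
  proof (rule has_sum_SigmaD[OF G])
    fix n :: "int \<times> int"
    have "((\<lambda>k. a (n - k) * b k) has_sum conv a b n) UNIV"
      unfolding conv_def by (rule has_sum_infsum[OF abs_summable_summable[OF row]])
    from has_sum_cmult_left[OF this, of "character n z"]
    show "((\<lambda>k. ?G (n, k)) has_sum conv a b n * character n z) UNIV"
      by (simp add: character_add[symmetric] mult.assoc mult.left_commute[of "character _ z" "b _"])
  qed
  then show ?thesis unfolding fourier_sum_def by (rule infsumI)
qed


section \<open>Fourier expansion of functions supported in a cell\<close>

definition grid :: "nat \<Rightarrow> (int \<times> int) set" where
  "grid M = {- int M..<int M} \<times> {- int M..<int M}"

definition mesh :: "nat \<Rightarrow> real" where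
  "mesh M = pi / real M"

text \<open>Up to the factor \<open>(2 M)\<^sup>2\<close> these are the discrete Fourier coefficients for the square grid with
  \<open>2 M\<close> points in each direction that fills the cell \<open>[-\<pi>, \<pi>)\<^sup>2\<close>.\<close>

definition gsum :: "nat \<Rightarrow> (complex \<Rightarrow> complex) \<Rightarrow> int \<times> int \<Rightarrow> complex" where
  "gsum M \<phi> n = (\<Sum>p\<in>grid M. \<phi> (mesh M *\<^sub>R frq p) * cnj (character n (mesh M *\<^sub>R frq p)))"

lemma sum_roots_of_unity:
  assumes "i \<in> {- int M..<int M}" "j \<in> {- int M..<int M}"
  shows "(\<Sum>m\<in>{- int M..<int M}. cis (mesh M * (of_int m * of_int (i - j)))) = (if i = j then of_nat (2 * M) else 0)"
proof (cases "i = j")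
  case True
  then show ?thesis by simp
next
  case False
  have M: "M > 0" using assms by auto
  define t where "t = mesh M * of_int (i - j)"
  have sh: "(\<Sum>m\<in>{- int M..<int M}. cis (mesh M * (of_int m * of_int (i - j)))) = (\<Sum>k<2*M. cis (- real M * t) * cis t ^ k)"
    by (rule sum.reindex_bij_witness[of _ "\<lambda>k. int k - int M" "\<lambda>m. nat (m + int M)"])
       (auto simp: t_def Complex.DeMoivre cis_mult algebra_simps of_nat_nat)
  have "cis t ^ (2 * M) = cis (2 * pi * of_int (i - j))"
    unfolding Complex.DeMoivre t_def mesh_def by (rule arg_cong[where f = cis]) (use M in simp)
  also have "\<dots> = 1"
    by (rule cis_multiple_2pi) auto
  finally have one: "cis t ^ (2 * M) = 1" .
  have "cis t \<noteq> 1"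
  proof
    assume "cis t = 1"
    then have "cos t = 1" by (metis cis.sel(1) one_complex.sel(1))
    then obtain k :: int where k: "t = of_int k * 2 * pi"
      using cos_one_2pi_int by auto
    have "pi * real_of_int (i - j) = pi * (of_int k * 2 * real M)"
      using M k by (simp add: t_def mesh_def field_simps)
    then have "real_of_int (i - j) = real_of_int (k * 2 * int M)"
      unfolding mult_cancel_left by simp
    then have kM: "i - j = k * (2 * int M)"
      unfolding of_int_eq_iff by simp
    have "\<bar>i - j\<bar> < 2 * int M" "i - j \<noteq> 0" using assms False by auto
    then have "\<bar>k\<bar> * (2 * int M) < 1 * (2 * int M)" "k \<noteq> 0"
      unfolding kM abs_mult by auto
    then show False by (simp only: mult_less_cancel_right_disj) auto
  qed
  then have "(\<Sum>k<2*M. cis t ^ k) = 0"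
    using geometric_sum[of "cis t" "2 * M"] one by simp
  then show ?thesis using False unfolding sh sum_distrib_left[symmetric] by simp
qed

lemma finite_grid [simp]: "finite (grid M)"
  by (simp add: grid_def)

lemma gsum_inversion:
  assumes "q \<in> grid M"
  shows "(\<Sum>n\<in>grid M. gsum M \<phi> n * character n (mesh M *\<^sub>R frq q)) = of_nat (2 * M) ^ 2 * \<phi> (mesh M *\<^sub>R frq q)"
proof -
  let ?I = "{- int M..<int M}"
  have ker: "(\<Sum>n\<in>grid M. cnj (character n (mesh M *\<^sub>R frq p)) * character n (mesh M *\<^sub>R frq q)) =
    (if p = q then of_nat (2 * M) ^ 2 else 0)" if p: "p \<in> grid M" for p
  proof -
    have "(\<Sum>n\<in>grid M. cnj (character n (mesh M *\<^sub>R frq p)) * character n (mesh M *\<^sub>R frq q)) =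
      (\<Sum>(m,k)\<in>?I \<times> ?I. cis (mesh M * (of_int m * of_int (fst q - fst p))) * cis (mesh M * (of_int k * of_int (snd q - snd p))))"
      unfolding grid_def
      by (rule sum.cong) (auto simp: character_def cis_cnj cis_mult frq_def inner_complex_def algebra_simps)
    also have "\<dots> = (\<Sum>m\<in>?I. cis (mesh M * (of_int m * of_int (fst q - fst p)))) *
        (\<Sum>k\<in>?I. cis (mesh M * (of_int k * of_int (snd q - snd p))))"
      by (simp add: sum_product sum.cartesian_product)
    also have "\<dots> = (if p = q then of_nat (2 * M) ^ 2 else 0)"
      using sum_roots_of_unity[of "fst q" M "fst p"] sum_roots_of_unity[of "snd q" M "snd p"] p assms
      by (auto simp: grid_def power2_eq_square prod_eq_iff)
    finally show ?thesis .
  qed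
  have "(\<Sum>n\<in>grid M. gsum M \<phi> n * character n (mesh M *\<^sub>R frq q)) =
    (\<Sum>n\<in>grid M. \<Sum>p\<in>grid M. \<phi> (mesh M *\<^sub>R frq p) * (cnj (character n (mesh M *\<^sub>R frq p)) * character n (mesh M *\<^sub>R frq q)))"
    by (simp add: gsum_def sum_distrib_right mult.assoc)
  also have "\<dots> = (\<Sum>p\<in>grid M. \<phi> (mesh M *\<^sub>R frq p) * (\<Sum>n\<in>grid M. cnj (character n (mesh M *\<^sub>R frq p)) * character n (mesh M *\<^sub>R frq q)))"
    by (subst sum.swap) (simp add: sum_distrib_left)
  also have "\<dots> = (\<Sum>p\<in>grid M. if p = q then \<phi> (mesh M *\<^sub>R frq p) * of_nat (2 * M) ^ 2 else 0)"
    by (rule sum.cong) (auto simp: ker)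
  also have "\<dots> = of_nat (2 * M) ^ 2 * \<phi> (mesh M *\<^sub>R frq q)"
    using assms by simp
  finally show ?thesis .
qed

definition cell_supported :: "real \<Rightarrow> (complex \<Rightarrow> complex) \<Rightarrow> bool" where
  "cell_supported \<rho> \<phi> \<longleftrightarrow> (\<forall>z. \<phi> z \<noteq> 0 \<longrightarrow> \<bar>Re z\<bar> \<le> \<rho> \<and> \<bar>Im z\<bar> \<le> \<rho>)"

text \<open>The function vanishes near the boundary of the cell, so a shift by one mesh width moves no part of it
  across the boundary.\<close>

lemma gsum_shift:
  assumes "M > 0" "cell_supported \<rho> \<phi>" "\<rho> < pi" "v \<in> {(1,0), (0,1)}"
  shows "gsum M (\<lambda>z. \<phi> (z + mesh M *\<^sub>R frq v)) n = character n (mesh M *\<^sub>R frq v) * gsum M \<phi> n"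
proof -
  define G where "G p = \<phi> (mesh M *\<^sub>R frq p) * cnj (character n (mesh M *\<^sub>R frq p))" for p
  have G0: "G p = 0" if "\<bar>fst p\<bar> \<ge> int M \<or> \<bar>snd p\<bar> \<ge> int M" for p
  proof -
    have big: "pi \<le> \<bar>mesh M * of_int i\<bar>" if "\<bar>i\<bar> \<ge> int M" for i :: int
    proof -
      have "real M \<le> \<bar>of_int i\<bar>" using that by linarith
      then have "mesh M * real M \<le> mesh M * \<bar>of_int i\<bar>" by (intro mult_left_mono) (auto simp: mesh_def)
      then show ?thesis using assms(1) by (simp add: mesh_def abs_mult)
    qed
    have "\<phi> (mesh M *\<^sub>R frq p) = 0"
    proof (rule ccontr)
      assume "\<phi> (mesh M *\<^sub>R frq p) \<noteq> 0"
      then have "\<bar>mesh M * of_int (fst p)\<bar> \<le> \<rho>" "\<bar>mesh M * of_int (snd p)\<bar> \<le> \<rho>"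
        using assms(2) by (auto simp: cell_supported_def frq_def)
      then show False using big[of "fst p"] big[of "snd p"] that assms(3) by auto
    qed
    then show ?thesis by (simp add: G_def)
  qed
  have tm: "\<phi> (mesh M *\<^sub>R frq p + mesh M *\<^sub>R frq v) * cnj (character n (mesh M *\<^sub>R frq p)) = character n (mesh M *\<^sub>R frq v) * G (p + v)" for p
  proof -
    have "character n (mesh M *\<^sub>R frq v) * cnj (character n (mesh M *\<^sub>R frq (p + v))) = cnj (character n (mesh M *\<^sub>R frq p))"
      by (simp add: character_def cis_cnj cis_mult frq_add inner_add_right algebra_simps)
    then show ?thesis by (simp add: G_def frq_add scaleR_add_right mult_ac)
  qed
  have "(\<Sum>p\<in>grid M. G (p + v)) = (\<Sum>p\<in>(\<lambda>p. p + v) ` grid M. G p)"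
    by (subst sum.reindex) (auto simp: inj_on_def)
  also have "\<dots> = (\<Sum>p\<in>grid M \<inter> (\<lambda>p. p + v) ` grid M. G p)"
  proof (rule sum.mono_neutral_right)
    show "\<forall>p\<in>(\<lambda>p. p + v) ` grid M - grid M \<inter> (\<lambda>p. p + v) ` grid M. G p = 0"
      using assms(4) by (auto intro!: G0 simp: grid_def)
  qed auto
  also have "\<dots> = (\<Sum>p\<in>grid M. G p)"
  proof (rule sum.mono_neutral_left)
    show "\<forall>p\<in>grid M - grid M \<inter> (\<lambda>p. p + v) ` grid M. G p = 0"
    proof
      fix p assume p: "p \<in> grid M - grid M \<inter> (\<lambda>p. p + v) ` grid M"
      then have "p - v \<notin> grid M" by (metis Diff_iff IntI diff_add_cancel image_eqI)
      then show "G p = 0" using p assms(4) by (intro G0) (auto simp: grid_def)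
    qed
  qed auto
  finally have "(\<Sum>p\<in>grid M. G (p + v)) = gsum M \<phi> n" by (simp add: gsum_def G_def)
  then show ?thesis
    unfolding gsum_def[of M "\<lambda>z. \<phi> (z + mesh M *\<^sub>R frq v)"] by (simp add: tm sum_distrib_left[symmetric])
qed

definition dir_deriv :: "complex \<Rightarrow> (complex \<Rightarrow> complex) \<Rightarrow> complex \<Rightarrow> complex" where
  "dir_deriv v \<phi> = (\<lambda>z. frechet_derivative \<phi> (at z) v)"

definition diff_quot :: "real \<Rightarrow> complex \<Rightarrow> (complex \<Rightarrow> complex) \<Rightarrow> complex \<Rightarrow> complex" where
  "diff_quot h v \<phi> = (\<lambda>z. (\<phi> (z + h *\<^sub>R v) - \<phi> z) / of_real h)"

lemma smooth_dir_deriv: "smooth_on \<phi> UNIV \<Longrightarrow> smooth_on (dir_deriv v \<phi>) UNIV"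
  unfolding dir_deriv_def by (rule smooth_on_frechet)

lemma smooth_dir_deriv_funpow: "smooth_on \<phi> UNIV \<Longrightarrow> smooth_on ((dir_deriv v ^^ s) \<phi>) UNIV"
  by (induction s) (auto intro: smooth_dir_deriv)

lemma smooth_diff_quot:
  assumes "smooth_on \<phi> UNIV"
  shows "smooth_on (diff_quot h v \<phi>) UNIV"
proof -
  have "smooth_on (\<lambda>z. z + h *\<^sub>R v) UNIV"
    by (intro smooth_on_add smooth_on_bounded_linear[OF _ bounded_linear_ident] smooth_on_const open_UNIV)
  then have "smooth_on (\<lambda>z. \<phi> (z + h *\<^sub>R v)) UNIV"
    using smooth_on_comp[OF open_UNIV open_UNIV _ assms] by simp
  then have "smooth_on (\<lambda>z. \<phi> (z + h *\<^sub>R v) - \<phi> z) UNIV"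
    by (intro smooth_on_diff assms open_UNIV)
  then show ?thesis unfolding diff_quot_def
    by (intro smooth_on_bounded_linear_comp[OF open_UNIV bounded_linear_divide])
qed

lemma dir_deriv_diff_quot:
  assumes "smooth_on \<phi> UNIV"
  shows "dir_deriv u (diff_quot h v \<phi>) = diff_quot h v (dir_deriv u \<phi>)"
proof
  fix z
  note d = smooth_on_imp_has_derivative[OF open_UNIV assms UNIV_I]
  have "((\<lambda>z. \<phi> (z + h *\<^sub>R v)) has_derivative (\<lambda>w. frechet_derivative \<phi> (at (z + h *\<^sub>R v)) w)) (at z)"
    by (rule has_derivative_compose[OF _ d, of "\<lambda>z. z + h *\<^sub>R v" "\<lambda>w. w"]) (auto intro!: derivative_eq_intros)
  then have "(diff_quot h v \<phi> has_derivative (\<lambda>w. (frechet_derivative \<phi> (at (z + h *\<^sub>R v)) w - frechet_derivative \<phi> (at z) w) / of_real h)) (at z)"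
    unfolding diff_quot_def
    by (intro bounded_linear.has_derivative[OF bounded_linear_divide] has_derivative_diff d)
  from fun_cong[OF frechet_derivative_at[OF this], of u] show "dir_deriv u (diff_quot h v \<phi>) z = diff_quot h v (dir_deriv u \<phi>) z"
    by (simp add: dir_deriv_def diff_quot_def)
qed

lemma dir_deriv_funpow_diff_quot:
  assumes "smooth_on \<phi> UNIV"
  shows "(dir_deriv u ^^ s) (diff_quot h v \<phi>) = diff_quot h v ((dir_deriv u ^^ s) \<phi>)"
  using assms by (induction s) (auto simp: dir_deriv_diff_quot smooth_dir_deriv_funpow)

lemma norm_diff_quot_le:
  assumes "smooth_on \<phi> UNIV" "\<And>z. norm (dir_deriv v \<phi> z) \<le> B" "h > 0"
  shows "norm (diff_quot h v \<phi> z) \<le> B"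
proof -
  note d = smooth_on_imp_has_derivative[OF open_UNIV assms(1) UNIV_I]
  have "norm (\<phi> (z + h *\<^sub>R v) - \<phi> (z + 0 *\<^sub>R v)) \<le> B * norm (h - 0)"
  proof (rule differentiable_bound[of UNIV "\<lambda>t. \<phi> (z + t *\<^sub>R v)" "\<lambda>t r. r *\<^sub>R dir_deriv v \<phi> (z + t *\<^sub>R v)"])
    fix t :: real
    have "((\<lambda>t. \<phi> (z + t *\<^sub>R v)) has_derivative (\<lambda>r. frechet_derivative \<phi> (at (z + t *\<^sub>R v)) (r *\<^sub>R v))) (at t within UNIV)"
      by (rule has_derivative_compose[OF _ d, of "\<lambda>t. z + t *\<^sub>R v" "\<lambda>r. r *\<^sub>R v"]) (auto intro!: derivative_eq_intros)
    then show "((\<lambda>t. \<phi> (z + t *\<^sub>R v)) has_derivative (\<lambda>r. r *\<^sub>R dir_deriv v \<phi> (z + t *\<^sub>R v))) (at t within UNIV)"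
      unfolding dir_deriv_def by (simp only: linear_cmul[OF has_derivative_linear[OF d]])
    show "onorm (\<lambda>r. r *\<^sub>R dir_deriv v \<phi> (z + t *\<^sub>R v)) \<le> B"
      by (rule onorm_le) (use assms(2) in \<open>auto simp: mult.commute[of B] intro: mult_left_mono\<close>)
  qed auto
  then show ?thesis using assms(3) by (simp add: diff_quot_def norm_divide divide_le_eq)
qed

lemma gsum_diff_quot:
  assumes "M > 0" "cell_supported \<rho> \<phi>" "\<rho> < pi" "v \<in> {(1,0), (0,1)}"
  shows "gsum M (diff_quot (mesh M) (frq v) \<phi>) n = (character n (mesh M *\<^sub>R frq v) - 1) / of_real (mesh M) * gsum M \<phi> n"
proof -
  have "gsum M (diff_quot (mesh M) (frq v) \<phi>) n = (gsum M (\<lambda>z. \<phi> (z + mesh M *\<^sub>R frq v)) n - gsum M \<phi> n) / of_real (mesh M)"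
    unfolding gsum_def diff_quot_def
    by (simp add: sum_subtractf[symmetric] sum_divide_distrib algebra_simps diff_divide_distrib)
  then show ?thesis using gsum_shift[OF assms] by (simp add: algebra_simps diff_divide_distrib)
qed

text \<open>A difference quotient multiplies the coefficients by \<open>(e\<^sup>i\<^sup>h\<^sup>m - 1) / h\<close> and is bounded by a
  derivative. Every difference enlarges the support by one mesh width, which the condition on \<open>\<rho>\<close> allows for. The
  bound per grid point does not depend on the mesh, and so survives its refinement.\<close>

lemma gsum_iterated_bound:
  assumes "M > 0" "v \<in> {(1,0), (0,1)}"
  shows "smooth_on \<phi> UNIV \<Longrightarrow> cell_supported \<rho> \<phi> \<Longrightarrow> \<rho> + real s * mesh M < pi \<Longrightarrow>
    (\<And>z. norm ((dir_deriv (frq v) ^^ s) \<phi> z) \<le> B) \<Longrightarrow>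
    norm ((character n (mesh M *\<^sub>R frq v) - 1) / of_real (mesh M)) ^ s * norm (gsum M \<phi> n) \<le> real (2 * M) ^ 2 * B"
proof (induction s arbitrary: \<phi> \<rho>)
  case 0
  have "norm (gsum M \<phi> n) \<le> (\<Sum>p\<in>grid M. B)"
    unfolding gsum_def using 0(4) by (intro sum_norm_le) (simp add: norm_mult)
  then show ?case by (simp add: grid_def card_cartesian_product power2_eq_square)
next
  case (Suc s)
  have m: "mesh M > 0" using assms(1) by (simp add: mesh_def)
  have v: "\<bar>Re (frq v)\<bar> \<le> 1" "\<bar>Im (frq v)\<bar> \<le> 1" using assms(2) by (auto simp: frq_def)
  have supp: "cell_supported (\<rho> + mesh M) (diff_quot (mesh M) (frq v) \<phi>)"
    unfolding cell_supported_def
  proof (intro allI impI)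
    fix z assume "diff_quot (mesh M) (frq v) \<phi> z \<noteq> 0"
    then have "\<phi> (z + mesh M *\<^sub>R frq v) \<noteq> 0 \<or> \<phi> z \<noteq> 0" by (auto simp: diff_quot_def)
    then have "(\<bar>Re z + mesh M * Re (frq v)\<bar> \<le> \<rho> \<and> \<bar>Im z + mesh M * Im (frq v)\<bar> \<le> \<rho>) \<or> (\<bar>Re z\<bar> \<le> \<rho> \<and> \<bar>Im z\<bar> \<le> \<rho>)"
      using Suc.prems(2) unfolding cell_supported_def by fastforce
    moreover have "\<bar>mesh M * Re (frq v)\<bar> \<le> mesh M" "\<bar>mesh M * Im (frq v)\<bar> \<le> mesh M"
      using v m by (auto simp: abs_mult)
    ultimately show "\<bar>Re z\<bar> \<le> \<rho> + mesh M \<and> \<bar>Im z\<bar> \<le> \<rho> + mesh M" by linarith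
  qed
  have "norm ((character n (mesh M *\<^sub>R frq v) - 1) / of_real (mesh M)) ^ s * norm (gsum M (diff_quot (mesh M) (frq v) \<phi>) n) \<le> real (2 * M) ^ 2 * B"
  proof (rule Suc.IH[OF _ supp])
    show "norm ((dir_deriv (frq v) ^^ s) (diff_quot (mesh M) (frq v) \<phi>) z) \<le> B" for z
      unfolding dir_deriv_funpow_diff_quot[OF Suc.prems(1)]
      by (rule norm_diff_quot_le[OF smooth_dir_deriv_funpow[OF Suc.prems(1)] _ m]) (use Suc.prems(4) in simp)
  qed (use Suc.prems in \<open>auto simp: smooth_diff_quot algebra_simps\<close>)
  moreover have "\<rho> < pi"
  proof -
    have "0 \<le> real (Suc s) * mesh M" using m by simp
    then show ?thesis using Suc.prems(3) by linarith
  qed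
  ultimately show ?case
    unfolding gsum_diff_quot[OF assms(1) Suc.prems(2) \<open>\<rho> < pi\<close> assms(2)] norm_mult power_Suc
    by (simp only: mult_ac)
qed

text \<open>A chord of the unit circle compared with its arc: \<open>(e\<^sup>i\<^sup>h\<^sup>m - 1) / h\<close> is as large as \<open>m\<close>.\<close>

lemma norm_cis_minus_1_ge:
  assumes "\<bar>t\<bar> \<le> pi"
  shows "norm (cis t - 1) \<ge> \<bar>t\<bar> / pi"
proof -
  have pos: "norm (cis t - 1) \<ge> t / pi" if t: "0 \<le> t" "t \<le> pi" for t
  proof (cases "t \<le> pi / 2")
    case True
    have "concave_on {0..pi} sin"
      by (rule f''_le0_imp_concave[where f' = cos and f'' = "\<lambda>x. - sin x"])
         (auto intro!: derivative_eq_intros sin_ge_zero)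
    then have "sin ((1 - 2 * t / pi) *\<^sub>R 0 + (2 * t / pi) *\<^sub>R (pi / 2)) \<ge> (1 - 2 * t / pi) * sin 0 + (2 * t / pi) * sin (pi / 2)"
      using True t by (intro concave_onD) (auto simp: field_simps)
    then have "2 * t / pi \<le> sin t" by simp
    also have "\<dots> \<le> norm (cis t - 1)"
      using abs_Im_le_cmod[of "cis t - 1"] by simp
    finally show ?thesis using t by (simp add: field_simps)
  next
    case False
    have "cos t \<le> 0" using False t cos_monotone_0_pi_le[of "pi/2" t] by simp
    then have "1 \<le> norm (cis t - 1)"
      using abs_Re_le_cmod[of "cis t - 1"] by simp
    then show ?thesis using t by (simp add: field_simps) (metis mult_le_cancel_left_pos order_trans pi_gt_zero mult.right_neutral)
  qed
  show ?thesis
  proof (cases "t \<ge> 0")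
    case True
    then show ?thesis using pos[of t] assms by simp
  next
    case False
    have "norm (cis t - 1) = norm (cnj (cis t - 1))" by (rule complex_mod_cnj[symmetric])
    also have "cnj (cis t - 1) = cis (- t) - 1" by (simp add: cis_cnj)
    finally show ?thesis using pos[of "- t"] assms False by simp
  qed
qed


lemma norm_frq_le: "norm (frq n) \<le> \<bar>of_int (fst n)\<bar> + \<bar>of_int (snd n)\<bar>"
  using cmod_le[of "frq n"] by (simp add: frq_def)

lemma gsum_decay:
  assumes "M > 0" "n \<in> grid M" "smooth_on \<phi> UNIV" "cell_supported \<rho> \<phi>" "\<rho> + real s * mesh M < pi"
    and B: "\<And>z. norm ((dir_deriv 1 ^^ s) \<phi> z) \<le> B" "\<And>z. norm ((dir_deriv \<i> ^^ s) \<phi> z) \<le> B"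
  shows "norm (frq n) ^ s * norm (gsum M \<phi> n) \<le> (2 * pi) ^ s * (real (2 * M) ^ 2 * B)"
proof -
  have m: "mesh M > 0" using assms(1) by (simp add: mesh_def)
  have ang: "\<bar>of_int i\<bar> / pi \<le> norm ((cis (mesh M * of_int i) - 1) / of_real (mesh M))" if "i \<in> {- int M..<int M}" for i
  proof -
    have "\<bar>real_of_int i\<bar> \<le> real M" using that by auto
    then have "\<bar>mesh M * of_int i\<bar> \<le> pi"
      using m assms(1) by (simp add: abs_mult mesh_def field_simps)
    from norm_cis_minus_1_ge[OF this] show ?thesis
      using m by (simp add: norm_divide abs_mult field_simps)
  qed
  have one: "\<bar>of_int i\<bar> ^ s * norm (gsum M \<phi> n) \<le> pi ^ s * (real (2 * M) ^ 2 * B)"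
    if "i \<in> {- int M..<int M}" "character n (mesh M *\<^sub>R frq v) = cis (mesh M * of_int i)" "v \<in> {(1,0), (0,1)}"
      "\<And>z. norm ((dir_deriv (frq v) ^^ s) \<phi> z) \<le> B" for i v
  proof -
    have "(\<bar>of_int i\<bar> / pi) ^ s * norm (gsum M \<phi> n) \<le> norm ((cis (mesh M * of_int i) - 1) / of_real (mesh M)) ^ s * norm (gsum M \<phi> n)"
      by (intro mult_right_mono power_mono ang that) auto
    also have "\<dots> \<le> real (2 * M) ^ 2 * B"
      using gsum_iterated_bound[OF assms(1) that(3) assms(3,4,5) that(4), of n] that(2) by simp
    finally show ?thesis by (simp add: power_divide field_simps)
  qed
  have f: "frq (1, 0) = 1" "frq (0, 1) = \<i>" by (auto simp: frq_def complex_eq_iff)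
  have b1: "\<bar>of_int (fst n)\<bar> ^ s * norm (gsum M \<phi> n) \<le> pi ^ s * (real (2 * M) ^ 2 * B)"
  proof (rule one[of _ "(1, 0)"])
    show "norm ((dir_deriv (frq (1, 0)) ^^ s) \<phi> z) \<le> B" for z unfolding f by (rule B)
  qed (use assms(2) in \<open>auto simp: grid_def character_def frq_def inner_complex_def mult.commute\<close>)
  have b2: "\<bar>of_int (snd n)\<bar> ^ s * norm (gsum M \<phi> n) \<le> pi ^ s * (real (2 * M) ^ 2 * B)"
  proof (rule one[of _ "(0, 1)"])
    show "norm ((dir_deriv (frq (0, 1)) ^^ s) \<phi> z) \<le> B" for z unfolding f by (rule B)
  qed (use assms(2) in \<open>auto simp: grid_def character_def frq_def inner_complex_def mult.commute\<close>)
  define x where "x = max \<bar>real_of_int (fst n)\<bar> \<bar>real_of_int (snd n)\<bar>"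
  have "norm (frq n) \<le> 2 * x" using norm_frq_le[of n] by (simp add: x_def max_def split: if_splits)
  then have "norm (frq n) ^ s * norm (gsum M \<phi> n) \<le> (2 * x) ^ s * norm (gsum M \<phi> n)"
    by (intro mult_right_mono power_mono) auto
  also have "\<dots> = 2 ^ s * (x ^ s * norm (gsum M \<phi> n))" by (simp add: power_mult_distrib)
  also have "x ^ s * norm (gsum M \<phi> n) \<le> pi ^ s * (real (2 * M) ^ 2 * B)"
    using b1 b2 unfolding x_def max_def by (simp split: if_splits)
  finally show ?thesis by (simp add: power_mult_distrib mult.assoc)
qed

lemma summable_frq_weight: "(\<lambda>n. 1 / (1 + norm (frq n)) ^ 4) summable_on UNIV"
proof -
  define g where "g i = 1 / (1 + \<bar>real_of_int i\<bar>) ^ 2" for i :: int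
  have "(\<lambda>k::nat. 1 / (1 + real k) ^ 2) summable_on UNIV"
    using inverse_squares_sums by (intro summable_nonneg_imp_summable_on) (auto dest!: sums_summable simp: add.commute)
  then have "g summable_on range int" "g summable_on range (\<lambda>k. - int k)"
    by (subst summable_on_reindex; auto simp: inj_on_def g_def o_def)+
  then have "g summable_on (range int \<union> range (\<lambda>k. - int k))"
    by (rule summable_on_union)
  moreover have "range int \<union> range (\<lambda>k. - int k) = UNIV"
    by (auto simp: image_iff) (metis int_cases2)
  ultimately have g: "g summable_on UNIV" by simp
  have "(\<lambda>(i,k). g i * g k) summable_on UNIV"
    by (rule has_sum_imp_summable[OF has_sum_product_nonneg[OF has_sum_infsum[OF g] has_sum_infsum[OF g]]]) (auto simp: g_def)
  then show ?thesis
  proof (rule summable_on_comparison_test)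
    fix n :: "int \<times> int"
    obtain i k where n: "n = (i, k)" by (cases n)
    have "\<bar>of_int i\<bar> \<le> norm (frq n)" "\<bar>of_int k\<bar> \<le> norm (frq n)"
      using abs_Re_le_cmod[of "frq n"] abs_Im_le_cmod[of "frq n"] by (auto simp: n frq_def)
    then have "(1 + \<bar>of_int i\<bar>)\<^sup>2 * (1 + \<bar>of_int k\<bar>)\<^sup>2 \<le> (1 + norm (frq n))\<^sup>2 * (1 + norm (frq n))\<^sup>2"
      by (intro mult_mono power_mono) auto
    also have "\<dots> = (1 + norm (frq n)) ^ 4" by (simp add: power2_eq_square power4_eq_xxxx)
    finally have "(1 + \<bar>of_int i\<bar>)\<^sup>2 * (1 + \<bar>of_int k\<bar>)\<^sup>2 \<le> (1 + norm (frq n)) ^ 4" .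
    moreover have "0 < (1 + \<bar>real_of_int i\<bar>)\<^sup>2 * (1 + \<bar>real_of_int k\<bar>)\<^sup>2" by (auto intro!: mult_pos_pos zero_less_power add_pos_nonneg)
    ultimately show "1 / (1 + norm (frq n)) ^ 4 \<le> (case n of (i, k) \<Rightarrow> g i * g k)"
      using frac_le[of 1 1 "(1 + \<bar>real_of_int i\<bar>)\<^sup>2 * (1 + \<bar>real_of_int k\<bar>)\<^sup>2" "(1 + norm (frq n)) ^ 4"] by (simp add: n g_def)
  qed auto
qed

lemma one_plus_power_le:
  fixes r :: real
  assumes "r \<ge> 0"
  shows "(1 + r) ^ s \<le> 2 ^ s * (1 + r ^ s)"
proof (cases "r \<le> 1")
  case True
  have "(1 + r) ^ s \<le> 2 ^ s" using True assms by (intro power_mono) auto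
  also have "\<dots> \<le> 2 ^ s * (1 + r ^ s)" using assms by simp
  finally show ?thesis .
next
  case False
  have "(1 + r) ^ s \<le> (2 * r) ^ s" using False by (intro power_mono) auto
  also have "\<dots> \<le> 2 ^ s * (1 + r ^ s)" using assms by (simp add: power_mult_distrib)
  finally show ?thesis .
qed

lemma rapidI:
  assumes "\<And>s. \<exists>C. \<forall>n. (1 + norm (frq n)) ^ s * norm (a n) \<le> C"
  shows "rapid a"
  unfolding rapid_def
proof
  fix s
  obtain C where C: "\<And>n. (1 + norm (frq n)) ^ (s + 4) * norm (a n) \<le> C" using assms by blast
  have "(\<lambda>n. C * (1 / (1 + norm (frq n)) ^ 4)) summable_on UNIV"
    by (intro summable_on_cmult_right summable_frq_weight)
  then show "(\<lambda>n. (1 + norm (frq n)) ^ s * norm (a n)) summable_on UNIV"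
  proof (rule summable_on_comparison_test)
    fix n
    have "0 < (1 + norm (frq n)) ^ 4" by (intro zero_less_power add_pos_nonneg) auto
    then show "(1 + norm (frq n)) ^ s * norm (a n) \<le> C * (1 / (1 + norm (frq n)) ^ 4)"
      using C[of n] by (simp add: power_add pos_le_divide_eq mult_ac)
  qed auto
qed

text \<open>Dominated convergence for sums over \<open>\<int>\<^sup>2\<close>.\<close>

lemma infsum_dominated:
  fixes F :: "nat \<Rightarrow> int \<times> int \<Rightarrow> complex"
  assumes "\<And>n. (\<lambda>j. F j n) \<longlonglongrightarrow> G n" "\<And>j n. norm (F j n) \<le> B n" "B summable_on UNIV"
  shows "(\<lambda>j. \<Sum>\<^sub>\<infinity>n. F j n) \<longlonglongrightarrow> (\<Sum>\<^sub>\<infinity>n. G n)"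
proof (rule LIMSEQ_I)
  fix r :: real assume "r > 0"
  have GB: "norm (G n) \<le> B n" for n
    by (rule Lim_bounded[OF tendsto_norm[OF assms(1)]]) (use assms(2) in auto)
  have sF: "F j summable_on UNIV" for j
    by (rule abs_summable_summable[OF summable_on_comparison_test[OF assms(3)]]) (use assms(2) in auto)
  have sG: "G summable_on UNIV"
    by (rule abs_summable_summable[OF summable_on_comparison_test[OF assms(3)]]) (use GB in auto)
  obtain T where T: "finite T" "norm (infsum B UNIV - sum B T) \<le> r / 4"
    using infsum_finite_approximation[OF assms(3), of "r / 4"] \<open>r > 0\<close>
    by (auto simp: dist_norm abs_minus_commute)
  have tail: "norm (infsum H UNIV - sum H T) \<le> r / 4" if H: "\<And>n. norm (H n) \<le> B n" "H summable_on UNIV" for H :: "_ \<Rightarrow> complex"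
  proof -
    have "(H has_sum (infsum H UNIV - sum H T)) (UNIV - T)" "(B has_sum (infsum B UNIV - sum B T)) (UNIV - T)"
      by (intro has_sum_Diff has_sum_infsum has_sum_finite T H assms; simp)+
    then have "norm (infsum H UNIV - sum H T) \<le> infsum B UNIV - sum B T"
      by (rule norm_infsum_le) (use H in auto)
    then show ?thesis using T(2) abs_ge_self[of "infsum B UNIV - sum B T"]
      unfolding real_norm_def by linarith
  qed
  have "(\<lambda>j. \<Sum>n\<in>T. F j n) \<longlonglongrightarrow> (\<Sum>n\<in>T. G n)"
    by (intro tendsto_sum assms)
  then obtain N where N: "\<And>j. j \<ge> N \<Longrightarrow> norm ((\<Sum>n\<in>T. F j n) - (\<Sum>n\<in>T. G n)) < r / 4"
    using \<open>r > 0\<close> LIMSEQ_D[of _ _ "r / 4"] by fastforce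
  have "norm (infsum (F j) UNIV - infsum G UNIV) < r" if "j \<ge> N" for j
  proof -
    have "infsum (F j) UNIV - infsum G UNIV = (infsum (F j) UNIV - sum (F j) T) + (sum (F j) T - sum G T) - (infsum G UNIV - sum G T)"
      by simp
    also have "norm \<dots> \<le> norm (infsum (F j) UNIV - sum (F j) T) + norm (sum (F j) T - sum G T) + norm (infsum G UNIV - sum G T)"
      by (intro order_trans[OF norm_triangle_ineq4] add_mono norm_triangle_ineq order_refl)
    also have "\<dots> \<le> r / 4 + r / 4 + r / 4"
      using tail[OF assms(2) sF, of j] tail[OF GB sG] N[OF that] by linarith
    finally show ?thesis using \<open>r > 0\<close> by simp
  qed
  then show "\<exists>N. \<forall>j\<ge>N. norm ((\<Sum>\<^sub>\<infinity>n. F j n) - (\<Sum>\<^sub>\<infinity>n. G n)) < r" by blast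
qed

text \<open>By Tychonoff's theorem, since the product of countably many discs is compact and metrizable.\<close>

lemma bounded_pointwise_subsequence:
  fixes c :: "nat \<Rightarrow> int \<times> int \<Rightarrow> complex"
  assumes "\<And>j n. norm (c j n) \<le> B n"
  shows "\<exists>r a. strict_mono r \<and> (\<forall>n. (\<lambda>j. c (r j) n) \<longlonglongrightarrow> a n)"
proof -
  let ?K = "PiE UNIV (\<lambda>n. cball 0 (B n)) :: (int \<times> int \<Rightarrow> complex) set"
  have "compact ?K"
    unfolding compactin_euclidean_iff[symmetric] euclidean_product_topology[symmetric]
    by (simp add: compactin_PiE)
  then have "seq_compact ?K" by (simp add: compact_eq_seq_compact_metric)
  moreover have "c j \<in> ?K" for j using assms by (auto simp: PiE_def)
  ultimately obtain a r where ar: "strict_mono r" "(c \<circ> r) \<longlonglongrightarrow> a"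
    unfolding seq_compact_def by metis
  have "(\<lambda>j. (c \<circ> r) j n) \<longlonglongrightarrow> a n" for n
    by (rule continuous_on_tendsto_compose[OF continuous_on_product_coordinates ar(2)]) auto
  then show ?thesis using ar(1) by (auto simp: o_def)
qed

definition in_cell :: "complex \<Rightarrow> bool" where
  "in_cell z \<longleftrightarrow> \<bar>Re z\<bar> < pi \<and> \<bar>Im z\<bar> < pi"

text \<open>The coefficients are pointwise limits of discrete Fourier coefficients along refining grids. The bounds for the
  latter are uniform in the mesh, so they pass to the limit and also dominate the discrete inversion formula;
  this formula is exact at the grid points, which are dense because the dyadic grids are nested.\<close>

theorem fourier_expansion:
  assumes sm: "smooth_on \<phi> UNIV" and supp: "cell_supported \<rho> \<phi>" "\<rho> < pi"
    and bdd: "\<And>s. \<exists>B. \<forall>z. norm ((dir_deriv 1 ^^ s) \<phi> z) \<le> B \<and> norm ((dir_deriv \<i> ^^ s) \<phi> z) \<le> B"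
  shows "\<exists>a. rapid a \<and> (\<forall>z. in_cell z \<longrightarrow> fourier_sum a z = \<phi> z) \<and>
    (\<forall>s B. (\<forall>z. norm ((dir_deriv 1 ^^ s) \<phi> z) \<le> B \<and> norm ((dir_deriv \<i> ^^ s) \<phi> z) \<le> B) \<longrightarrow>
       (\<forall>n. norm (frq n) ^ s * norm (a n) \<le> (2 * pi) ^ s * B))"
proof -
  define bnd where "bnd s B \<longleftrightarrow> (\<forall>z. norm ((dir_deriv 1 ^^ s) \<phi> z) \<le> B \<and> norm ((dir_deriv \<i> ^^ s) \<phi> z) \<le> B)" for s B
  define M :: "nat \<Rightarrow> nat" where "M j = 2 ^ j" for j
  have Mpos: "M j > 0" for j by (simp add: M_def)
  have mesh0: "(\<lambda>j. mesh (M j)) \<longlonglongrightarrow> 0"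
  proof -
    have "(\<lambda>j. pi * (1 / 2) ^ j) \<longlonglongrightarrow> pi * 0"
      by (intro tendsto_intros LIMSEQ_power_zero) auto
    then show ?thesis by (simp add: mesh_def M_def power_divide)
  qed
  define c where "c j n = (if n \<in> grid (M j) then gsum (M j) \<phi> n / of_nat (2 * M j) ^ 2 else 0)" for j n
  have decay: "\<forall>\<^sub>F j in sequentially. \<forall>n. norm (frq n) ^ s * norm (c j n) \<le> (2 * pi) ^ s * B" if "bnd s B" for s B
  proof -
    have B0: "B \<ge> 0" using that norm_ge_zero order_trans unfolding bnd_def by blast
    have "(\<lambda>j. \<rho> + real s * mesh (M j)) \<longlonglongrightarrow> \<rho> + real s * 0"
      by (intro tendsto_intros mesh0)
    then have "\<forall>\<^sub>F j in sequentially. \<rho> + real s * mesh (M j) < pi"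
      using supp(2) by (auto dest: order_tendstoD)
    then show ?thesis
    proof eventually_elim
      case (elim j)
      show ?case
      proof
        fix n
        show "norm (frq n) ^ s * norm (c j n) \<le> (2 * pi) ^ s * B"
        proof (cases "n \<in> grid (M j)")
          case True
          have "norm (frq n) ^ s * norm (gsum (M j) \<phi> n) \<le> (2 * pi) ^ s * (real (2 * M j) ^ 2 * B)"
            using that unfolding bnd_def by (intro gsum_decay[OF Mpos True sm supp(1) elim]) auto
          then show ?thesis using True Mpos[of j]
            by (simp add: c_def norm_divide norm_power norm_mult field_simps)
        qed (use B0 in \<open>simp add: c_def\<close>)
      qed
    qed
  qed
  obtain B0 where B0: "bnd 0 B0" using bdd[of 0] unfolding bnd_def by blast
  obtain B4 where B4: "bnd 4 B4" using bdd[of 4] unfolding bnd_def by blast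
  define C where "C = 2 ^ 4 * ((2 * pi) ^ 0 * B0 + (2 * pi) ^ 4 * B4)"
  define W where "W n = C * (1 / (1 + norm (frq n)) ^ 4)" for n
  have sW: "W summable_on UNIV"
    unfolding W_def by (intro summable_on_cmult_right summable_frq_weight)
  have "\<forall>\<^sub>F j in sequentially. \<forall>n. norm (c j n) \<le> W n"
    using decay[OF B0] decay[OF B4]
  proof eventually_elim
    case (elim j)
    show ?case
    proof
      fix n
      have pos: "0 < (1 + norm (frq n)) ^ 4" by (intro zero_less_power add_pos_nonneg) auto
      have "(1 + norm (frq n)) ^ 4 * norm (c j n) \<le> (2 ^ 4 * (1 + norm (frq n) ^ 4)) * norm (c j n)"
        by (intro mult_right_mono one_plus_power_le) auto
      also have "\<dots> = 2 ^ 4 * (norm (frq n) ^ 0 * norm (c j n) + norm (frq n) ^ 4 * norm (c j n))"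
        by (simp add: algebra_simps)
      also have "\<dots> \<le> C" unfolding C_def by (intro mult_left_mono add_mono elim[THEN spec]) auto
      finally show "norm (c j n) \<le> W n" using pos by (simp add: W_def pos_le_divide_eq mult.commute)
    qed
  qed
  then obtain j0 where j0: "\<And>j n. j \<ge> j0 \<Longrightarrow> norm (c j n) \<le> W n"
    unfolding eventually_sequentially by blast
  obtain r0 a where r0: "strict_mono r0" and lim0: "\<And>n. (\<lambda>j. c (r0 j + j0) n) \<longlonglongrightarrow> a n"
    using bounded_pointwise_subsequence[of "\<lambda>j. c (j + j0)" W] j0 by auto
  define r where "r j = r0 j + j0" for j
  have r: "filterlim r sequentially sequentially"
    unfolding r_def using filterlim_subseq[OF r0] 
    by (rule filterlim_at_top_mono) (auto intro: always_eventually)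
  have lim: "(\<lambda>j. c (r j) n) \<longlonglongrightarrow> a n" for n
    using lim0 by (simp add: r_def)
  have cW: "norm (c (r j) n) \<le> W n" for j n
    by (rule j0) (simp add: r_def)
  have adecay: "norm (frq n) ^ s * norm (a n) \<le> (2 * pi) ^ s * B" if "bnd s B" for s B n
  proof (rule tendsto_upperbound)
    show "(\<lambda>j. norm (frq n) ^ s * norm (c (r j) n)) \<longlonglongrightarrow> norm (frq n) ^ s * norm (a n)"
      by (intro tendsto_intros lim)
    show "\<forall>\<^sub>F j in sequentially. norm (frq n) ^ s * norm (c (r j) n) \<le> (2 * pi) ^ s * B"
      using filterlim_iff[THEN iffD1, OF r, rule_format, OF decay[OF that]] by (rule eventually_mono) blast
  qed auto
  have ra: "rapid a"
  proof (rule rapidI)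
    fix s
    obtain Bs where Bs: "bnd s Bs" using bdd[of s] unfolding bnd_def by blast
    have "(1 + norm (frq n)) ^ s * norm (a n) \<le> 2 ^ s * ((2 * pi) ^ 0 * B0 + (2 * pi) ^ s * Bs)" for n
    proof -
      have "(1 + norm (frq n)) ^ s * norm (a n) \<le> (2 ^ s * (1 + norm (frq n) ^ s)) * norm (a n)"
        by (intro mult_right_mono one_plus_power_le) auto
      also have "\<dots> = 2 ^ s * (norm (frq n) ^ 0 * norm (a n) + norm (frq n) ^ s * norm (a n))"
        by (simp add: algebra_simps)
      also have "\<dots> \<le> 2 ^ s * ((2 * pi) ^ 0 * B0 + (2 * pi) ^ s * Bs)"
        by (intro mult_left_mono add_mono adecay B0 Bs) auto
      finally show ?thesis .
    qed
    then show "\<exists>C. \<forall>n. (1 + norm (frq n)) ^ s * norm (a n) \<le> C" by blast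
  qed
  have gridpt: "fourier_sum a (mesh (M i) *\<^sub>R frq q) = \<phi> (mesh (M i) *\<^sub>R frq q)" if q: "q \<in> grid (M i)" for i q
  proof -
    let ?z = "mesh (M i) *\<^sub>R frq q"
    have exact: "(\<Sum>\<^sub>\<infinity>n. c j n * character n ?z) = \<phi> ?z" if "j \<ge> i" for j
    proof -
      obtain d where d: "j = i + d" using \<open>j \<ge> i\<close> le_Suc_ex by blast
      define q' where "q' = (2 ^ d * fst q, 2 ^ d * snd q)"
      have z: "?z = mesh (M j) *\<^sub>R frq q'"
        by (simp add: q'_def frq_def complex_eq_iff mesh_def M_def d power_add field_simps)
      have "q' \<in> grid (M j)"
      proof -
        have "- int (M j) \<le> 2 ^ d * k \<and> 2 ^ d * k < int (M j)" if "- int (M i) \<le> k" "k < int (M i)" for k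
        proof -
          have "int (M j) = 2 ^ d * int (M i)" by (simp add: M_def d power_add)
          moreover have "2 ^ d * (- int (M i)) \<le> 2 ^ d * k" using that(1) by (intro mult_left_mono) auto
          moreover have "2 ^ d * k < 2 ^ d * int (M i)" using that(2) by (intro mult_strict_left_mono) auto
          ultimately show ?thesis by simp
        qed
        then show ?thesis using q by (auto simp: grid_def q'_def)
      qed
      from gsum_inversion[OF this, of \<phi>]
      have "(\<Sum>n\<in>grid (M j). gsum (M j) \<phi> n * character n ?z) = of_nat (2 * M j) ^ 2 * \<phi> ?z"
        unfolding z by simp
      then have "(\<Sum>n\<in>grid (M j). gsum (M j) \<phi> n * character n ?z) / of_nat (2 * M j) ^ 2 = \<phi> ?z"
        using Mpos[of j] by simp
      then have "(\<Sum>n\<in>grid (M j). c j n * character n ?z) = \<phi> ?z"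
        by (simp add: c_def sum_divide_distrib)
      moreover have "(\<Sum>\<^sub>\<infinity>n. c j n * character n ?z) = (\<Sum>\<^sub>\<infinity>n\<in>grid (M j). c j n * character n ?z)"
        by (rule infsum_cong_neutral) (auto simp: c_def)
      ultimately show ?thesis by simp
    qed
    have "(\<lambda>j. \<Sum>\<^sub>\<infinity>n. c (r j) n * character n ?z) \<longlonglongrightarrow> (\<Sum>\<^sub>\<infinity>n. a n * character n ?z)"
      by (rule infsum_dominated[OF _ _ sW]) (auto intro!: tendsto_intros lim simp: norm_mult cW)
    moreover have "\<forall>\<^sub>F j in sequentially. (\<Sum>\<^sub>\<infinity>n. c (r j) n * character n ?z) = \<phi> ?z"
      using filterlim_iff[THEN iffD1, OF r, rule_format, OF eventually_ge_at_top[of i]]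
      by (rule eventually_mono) (rule exact)
    then have "(\<lambda>j. \<Sum>\<^sub>\<infinity>n. c (r j) n * character n ?z) \<longlonglongrightarrow> \<phi> ?z"
      by (rule tendsto_eventually)
    ultimately show ?thesis unfolding fourier_sum_def by (rule LIMSEQ_unique)
  qed
  have cell: "fourier_sum a z = \<phi> z" if z: "in_cell z" for z
  proof -
    define q where "q i = (\<lfloor>Re z / mesh (M i)\<rfloor>, \<lfloor>Im z / mesh (M i)\<rfloor>)" for i
    have mp: "mesh (M i) > 0" for i using Mpos by (simp add: mesh_def)
    have near: "\<bar>mesh (M i) * of_int \<lfloor>x / mesh (M i)\<rfloor> - x\<bar> \<le> mesh (M i)" for x i
    proof -
      have "of_int \<lfloor>x / mesh (M i)\<rfloor> * mesh (M i) \<le> x"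
        by (subst pos_le_divide_eq[OF mp, symmetric]) (rule of_int_floor_le)
      moreover have "x < (of_int \<lfloor>x / mesh (M i)\<rfloor> + 1) * mesh (M i)"
        by (subst pos_divide_less_eq[OF mp, symmetric]) linarith
      ultimately show ?thesis by (simp add: algebra_simps abs_le_iff)
    qed
    have tends: "(\<lambda>i. mesh (M i) * of_int \<lfloor>x / mesh (M i)\<rfloor>) \<longlonglongrightarrow> x" for x
      by (rule LIM_zero_cancel, rule Lim_null_comparison[OF _ mesh0]) (use near in auto)
    have "(\<lambda>i. Complex (mesh (M i) * of_int \<lfloor>Re z / mesh (M i)\<rfloor>) (mesh (M i) * of_int \<lfloor>Im z / mesh (M i)\<rfloor>)) \<longlonglongrightarrow> Complex (Re z) (Im z)"
      by (intro tendsto_Complex tends)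
    then have qz: "(\<lambda>i. mesh (M i) *\<^sub>R frq (q i)) \<longlonglongrightarrow> z"
      by (simp add: q_def frq_def complex_eq_iff scaleR_complex.code)
    have "q i \<in> grid (M i)" for i
    proof -
      have "- int (M i) \<le> \<lfloor>x / mesh (M i)\<rfloor> \<and> \<lfloor>x / mesh (M i)\<rfloor> < int (M i)" if "\<bar>x\<bar> < pi" for x
      proof -
        have "\<bar>x\<bar> / mesh (M i) < pi / mesh (M i)" using that mp[of i] by (intro divide_strict_right_mono)
        also have "pi / mesh (M i) = real (M i)" using Mpos[of i] by (simp add: mesh_def)
        finally have "\<bar>x\<bar> / mesh (M i) < real (M i)" .
        moreover have "\<bar>x / mesh (M i)\<bar> = \<bar>x\<bar> / mesh (M i)" using mp[of i] by (simp add: abs_divide)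
        ultimately have "- real (M i) < x / mesh (M i)" "x / mesh (M i) < real (M i)" by linarith+
        then show ?thesis by (auto simp: le_floor_iff floor_less_iff)
      qed
      then show ?thesis using z by (simp add: q_def grid_def in_cell_def)
    qed
    then have eq: "fourier_sum a (mesh (M i) *\<^sub>R frq (q i)) = \<phi> (mesh (M i) *\<^sub>R frq (q i))" for i
      using gridpt by blast
    have "(\<lambda>i. fourier_sum a (mesh (M i) *\<^sub>R frq (q i))) \<longlonglongrightarrow> fourier_sum a z" "(\<lambda>i. \<phi> (mesh (M i) *\<^sub>R frq (q i))) \<longlonglongrightarrow> \<phi> z"
      by (rule continuous_on_tendsto_compose[OF smooth_on_continuous[OF smooth_on_fourier_sum[OF ra]] qz];
          simp add: continuous_on_tendsto_compose[OF smooth_on_continuous[OF sm] qz])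
        (rule continuous_on_tendsto_compose[OF smooth_on_continuous[OF sm] qz]; simp)
    then show ?thesis unfolding eq by (rule LIMSEQ_unique)
  qed
  show ?thesis
    using ra cell adecay unfolding bnd_def by blast
qed


section \<open>The Beltrami equation on the torus\<close>

text \<open>For fixed \<open>s\<close> and all \<open>\<epsilon> > 0\<close> these weights define the same space, but their submultiplicativity constant
  is 1 throughout and they tend to 1 as \<open>\<epsilon>\<close> tends to 0.\<close>

definition wt :: "real \<Rightarrow> nat \<Rightarrow> int \<times> int \<Rightarrow> real" where
  "wt \<epsilon> s n = (1 + \<epsilon> * norm (frq n)) ^ s"

lemma wt_ge_1: "\<epsilon> \<ge> 0 \<Longrightarrow> wt \<epsilon> s n \<ge> 1"
  by (simp add: wt_def one_le_power)

lemma wt_submult: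
  assumes "\<epsilon> \<ge> 0"
  shows "wt \<epsilon> s (m + n) \<le> wt \<epsilon> s m * wt \<epsilon> s n"
proof -
  have "1 + \<epsilon> * norm (frq (m + n)) \<le> 1 + \<epsilon> * (norm (frq m) + norm (frq n))"
    unfolding frq_add using assms by (intro add_left_mono mult_left_mono norm_triangle_ineq) auto
  also have "\<dots> \<le> (1 + \<epsilon> * norm (frq m)) * (1 + \<epsilon> * norm (frq n))"
    using assms by (simp add: algebra_simps)
  finally show ?thesis
    unfolding wt_def power_mult_distrib[symmetric] using assms by (intro power_mono) auto
qed

text \<open>The terms of the Neumann series of \<open>g = \<Pi> (a + a * (\<sigma> g))\<close>, where \<open>\<Pi>\<close> removes the constant
  term and \<open>*\<close> is convolution.\<close>

fun neumann :: "(int \<times> int \<Rightarrow> complex) \<Rightarrow> (int \<times> int \<Rightarrow> complex) \<Rightarrow> nat \<Rightarrow> int \<times> int \<Rightarrow> complex" where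
  "neumann a \<sigma> 0 n = (if n = 0 then 0 else a n)"
| "neumann a \<sigma> (Suc j) n = (if n = 0 then 0 else conv a (\<lambda>k. \<sigma> k * neumann a \<sigma> j k) n)"

lemma neumann_weighted:
  assumes "\<epsilon> \<ge> 0" "\<And>n. norm (\<sigma> n) \<le> K" and S: "((\<lambda>n. wt \<epsilon> s n * norm (a n)) has_sum S) UNIV"
  shows "(\<lambda>n. wt \<epsilon> s n * norm (neumann a \<sigma> j n)) summable_on UNIV \<and>
    (\<Sum>\<^sub>\<infinity>n. wt \<epsilon> s n * norm (neumann a \<sigma> j n)) \<le> S * (K * S) ^ j"
proof (induction j)
  case 0
  note w = wt_ge_1[OF assms(1)]
  have le: "wt \<epsilon> s n * norm (neumann a \<sigma> 0 n) \<le> wt \<epsilon> s n * norm (a n)" for n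
    using w[of s n] by (intro mult_left_mono) auto
  have pos: "0 \<le> wt \<epsilon> s n * norm (neumann a \<sigma> 0 n)" for n using w[of s n] by simp
  have s: "(\<lambda>n. wt \<epsilon> s n * norm (neumann a \<sigma> 0 n)) summable_on UNIV"
    by (rule summable_on_comparison_test[OF has_sum_imp_summable[OF S] le pos])
  show ?case using s infsum_mono[OF s has_sum_imp_summable[OF S] le] infsumI[OF S] by simp
next
  case (Suc j)
  note w = wt_ge_1[OF assms(1)]
  have w0: "0 \<le> wt \<epsilon> s n" for n using w[of s n] by simp
  let ?g = "\<lambda>n. \<sigma> n * neumann a \<sigma> j n"
  have K: "K \<ge> 0" using assms(2) norm_ge_zero order_trans by blast
  have le: "wt \<epsilon> s n * norm (?g n) \<le> K * (wt \<epsilon> s n * norm (neumann a \<sigma> j n))" for n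
    using mult_right_mono[OF assms(2)[of n], of "wt \<epsilon> s n * norm (neumann a \<sigma> j n)"] w[of s n]
    by (simp add: norm_mult mult_ac)
  have sK: "(\<lambda>n. K * (wt \<epsilon> s n * norm (neumann a \<sigma> j n))) summable_on UNIV"
    using Suc by (intro summable_on_cmult_right) auto
  have s: "(\<lambda>n. wt \<epsilon> s n * norm (?g n)) summable_on UNIV"
    by (rule summable_on_comparison_test[OF sK le]) (use w0 in auto)
  have "(\<Sum>\<^sub>\<infinity>n. wt \<epsilon> s n * norm (?g n)) \<le> (\<Sum>\<^sub>\<infinity>n. K * (wt \<epsilon> s n * norm (neumann a \<sigma> j n)))"
    by (rule infsum_mono[OF s sK le])
  also have "\<dots> \<le> K * (S * (K * S) ^ j)"
    unfolding infsum_cmult_right' using Suc K by (intro mult_left_mono) auto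
  finally have T: "(\<Sum>\<^sub>\<infinity>n. wt \<epsilon> s n * norm (?g n)) \<le> K * (S * (K * S) ^ j)" .
  have S0: "S \<ge> 0" by (rule has_sum_nonneg[OF S]) (use w0 in auto)
  note c = conv_weighted[OF w wt_submult[OF assms(1)] S has_sum_infsum[OF s]]
  have le2: "wt \<epsilon> s n * norm (neumann a \<sigma> (Suc j) n) \<le> wt \<epsilon> s n * norm (conv a ?g n)" for n
    using w[of s n] by (intro mult_left_mono) auto
  have pos: "0 \<le> wt \<epsilon> s n * norm (neumann a \<sigma> (Suc j) n)" for n using w[of s n] by simp
  have s2: "(\<lambda>n. wt \<epsilon> s n * norm (neumann a \<sigma> (Suc j) n)) summable_on UNIV"
    by (rule summable_on_comparison_test[OF c(1) le2 pos])
  have "(\<Sum>\<^sub>\<infinity>n. wt \<epsilon> s n * norm (neumann a \<sigma> (Suc j) n)) \<le> (\<Sum>\<^sub>\<infinity>n. wt \<epsilon> s n * norm (conv a ?g n))"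
    by (rule infsum_mono[OF s2 c(1) le2])
  also have "\<dots> \<le> S * (K * (S * (K * S) ^ j))"
    by (rule order_trans[OF c(2) mult_left_mono[OF T S0]])
  finally show ?case using s2 by (simp add: mult_ac)
qed

lemma neumann_double_summable:
  assumes "\<epsilon> \<ge> 0" "\<And>n. norm (\<sigma> n) \<le> K" and S: "((\<lambda>n. wt \<epsilon> s n * norm (a n)) has_sum S) UNIV" and "K * S < 1"
  shows "(\<lambda>(j,n). wt \<epsilon> s n * norm (neumann a \<sigma> j n)) summable_on UNIV"
    "(\<Sum>\<^sub>\<infinity>(j,n). wt \<epsilon> s n * norm (neumann a \<sigma> j n)) \<le> S / (1 - K * S)"
proof -
  define R where "R j = (\<Sum>\<^sub>\<infinity>n. wt \<epsilon> s n * norm (neumann a \<sigma> j n))" for j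
  have w: "wt \<epsilon> s n \<ge> 0" for n using wt_ge_1[OF assms(1), of s n] by simp
  note nw = neumann_weighted[where \<sigma> = \<sigma>, OF assms(1,2) S]
  have row: "((\<lambda>n. case (j,n) of (j,n) \<Rightarrow> wt \<epsilon> s n * norm (neumann a \<sigma> j n)) has_sum R j) UNIV" for j
    unfolding R_def using nw[where j = j] by (auto intro: has_sum_infsum)
  have K: "K \<ge> 0" using assms(2) norm_ge_zero order_trans by blast
  have S0: "S \<ge> 0" by (rule has_sum_nonneg[OF S]) (use w in auto)
  have Rle: "R j \<le> S * (K * S) ^ j" for j unfolding R_def using nw by blast
  have R0: "R j \<ge> 0" for j unfolding R_def using w by (intro infsum_nonneg) auto
  have "(\<lambda>j. S * (K * S) ^ j) sums (S * (1 / (1 - K * S)))"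
    using K S0 assms(4) by (intro sums_mult geometric_sums) auto
  then have geo: "((\<lambda>j. S * (K * S) ^ j) has_sum (S * (1 / (1 - K * S)))) UNIV"
    using K S0 by (intro sums_nonneg_imp_has_sum) auto
  have sR: "R summable_on UNIV"
    by (rule summable_on_comparison_test[OF has_sum_imp_summable[OF geo] Rle R0])
  have s: "(\<lambda>(j,n). wt \<epsilon> s n * norm (neumann a \<sigma> j n)) summable_on (UNIV \<times> UNIV)"
    by (rule summable_on_SigmaI[OF row sR]) (use w in auto)
  then show "(\<lambda>(j,n). wt \<epsilon> s n * norm (neumann a \<sigma> j n)) summable_on UNIV" by simp
  have "((\<lambda>(j,n). wt \<epsilon> s n * norm (neumann a \<sigma> j n)) has_sum infsum R UNIV) (UNIV \<times> UNIV)"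
    by (rule has_sum_SigmaI[OF row has_sum_infsum[OF sR] s])
  then have "(\<Sum>\<^sub>\<infinity>(j,n). wt \<epsilon> s n * norm (neumann a \<sigma> j n)) = infsum R UNIV"
    by (simp add: infsumI)
  also have "\<dots> \<le> S * (1 / (1 - K * S))"
    using infsum_mono[OF sR has_sum_imp_summable[OF geo] Rle] infsumI[OF geo] by simp
  finally show "(\<Sum>\<^sub>\<infinity>(j,n). wt \<epsilon> s n * norm (neumann a \<sigma> j n)) \<le> S / (1 - K * S)" by simp
qed

text \<open>As \<open>\<epsilon>\<close> tends to 0 the weighted norm tends to the unweighted one, so every power of the frequency
  admits a norm for which the operator is still a contraction.\<close>

lemma weighted_norm_small:
  assumes "rapid a" "(\<Sum>\<^sub>\<infinity>n. norm (a n)) < r"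
  shows "\<exists>\<epsilon>>0. \<exists>S<r. ((\<lambda>n. wt \<epsilon> s n * norm (a n)) has_sum S) UNIV"
proof -
  define e where "e j = inverse (real (Suc j))" for j
  have e: "e j > 0" "e j \<le> 1" for j by (auto simp: e_def field_simps)
  have B: "(\<lambda>n. (1 + norm (frq n)) ^ s * norm (a n)) summable_on UNIV"
    using assms(1) by (auto simp: rapid_def)
  have le: "wt (e j) s n * norm (a n) \<le> (1 + norm (frq n)) ^ s * norm (a n)" for j n
    unfolding wt_def using e[of j] mult_right_mono[of "e j" 1 "norm (frq n)"]
    by (intro mult_right_mono power_mono) auto
  have w: "wt (e j) s n \<ge> 0" for j n using wt_ge_1[of "e j" s n] e[of j] by simp
  have sj: "(\<lambda>n. wt (e j) s n * norm (a n)) summable_on UNIV" for j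
    by (rule summable_on_comparison_test[OF B le]) (use w in auto)
  have "(\<lambda>j. \<Sum>\<^sub>\<infinity>n. complex_of_real (wt (e j) s n * norm (a n))) \<longlonglongrightarrow> (\<Sum>\<^sub>\<infinity>n. complex_of_real (norm (a n)))"
  proof (rule infsum_dominated[OF _ _ B])
    fix n
    have "(\<lambda>j. (1 + e j * norm (frq n)) ^ s * norm (a n)) \<longlonglongrightarrow> (1 + 0 * norm (frq n)) ^ s * norm (a n)"
      unfolding e_def by (intro tendsto_intros LIMSEQ_inverse_real_of_nat)
    then show "(\<lambda>j. complex_of_real (wt (e j) s n * norm (a n))) \<longlonglongrightarrow> complex_of_real (norm (a n))"
      unfolding wt_def by (intro tendsto_of_real) simp
    show "norm (complex_of_real (wt (e j) s n * norm (a n))) \<le> (1 + norm (frq n)) ^ s * norm (a n)" for j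
      using le[of j n] w[of j n] by (simp only: norm_of_real) simp
  qed
  moreover have "(\<Sum>\<^sub>\<infinity>n. complex_of_real (wt (e j) s n * norm (a n))) = complex_of_real (\<Sum>\<^sub>\<infinity>n. wt (e j) s n * norm (a n))" for j
    by (rule infsumI[OF has_sum_of_real[OF has_sum_infsum[OF sj]]])
  moreover have "(\<Sum>\<^sub>\<infinity>n. complex_of_real (norm (a n))) = complex_of_real (\<Sum>\<^sub>\<infinity>n. norm (a n))"
    by (rule infsumI[OF has_sum_of_real[OF has_sum_infsum[OF rapid_summable[OF assms(1)]]]])
  ultimately have "(\<lambda>j. \<Sum>\<^sub>\<infinity>n. wt (e j) s n * norm (a n)) \<longlonglongrightarrow> (\<Sum>\<^sub>\<infinity>n. norm (a n))"
    by (simp add: tendsto_of_real_iff)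
  then have "\<forall>\<^sub>F j in sequentially. (\<Sum>\<^sub>\<infinity>n. wt (e j) s n * norm (a n)) < r"
    using assms(2) by (rule order_tendstoD)
  then obtain j where "(\<Sum>\<^sub>\<infinity>n. wt (e j) s n * norm (a n)) < r"
    using eventually_happens by fastforce
  then show ?thesis using e(1)[of j] has_sum_infsum[OF sj[of j]] by blast
qed

text \<open>The sum of the Neumann series in the unweighted norm. The weighted estimates bound the same series, so the
  solution lies in every weighted space.\<close>

theorem neumann_solution:
  assumes "rapid a" "\<And>n. norm (\<sigma> n) \<le> K" "K > 0" "K * (\<Sum>\<^sub>\<infinity>n. norm (a n)) < 1 / 2"
  shows "\<exists>g. rapid g \<and> K * (\<Sum>\<^sub>\<infinity>n. norm (g n)) < 1 \<and>
    (\<forall>n. g n = (if n = 0 then 0 else a n + conv a (\<lambda>k. \<sigma> k * g k) n))"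
proof -
  define \<tau> where "\<tau> = (\<Sum>\<^sub>\<infinity>n. norm (a n))"
  have \<tau>: "((\<lambda>n. wt 0 0 n * norm (a n)) has_sum \<tau>) UNIV"
    using has_sum_infsum[OF rapid_summable[OF assms(1)]] by (simp add: wt_def \<tau>_def)
  have K\<tau>: "K * \<tau> < 1 / 2" using assms(4) by (simp add: \<tau>_def)
  define N where "N = neumann a \<sigma>"
  have base: "(\<lambda>(j,n). norm (N j n)) summable_on UNIV" "(\<Sum>\<^sub>\<infinity>(j,n). norm (N j n)) \<le> \<tau> / (1 - K * \<tau>)"
    using neumann_double_summable[OF _ assms(2) \<tau>] K\<tau> by (auto simp: wt_def N_def)
  define g where "g n = (\<Sum>\<^sub>\<infinity>j. N j n)" for n
  have swp: "(\<lambda>(n,j). F n j) summable_on UNIV" if "(\<lambda>(j,n). F n j) summable_on UNIV"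
    for F :: "int \<times> int \<Rightarrow> nat \<Rightarrow> 'b::{comm_monoid_add, topological_space}"
    using summable_on_swap[of "\<lambda>(j,n). F n j" UNIV UNIV] that by simp
  have sj: "(\<lambda>j. norm (N j n)) summable_on UNIV" for n
    using summable_on_SigmaD1[where f = "\<lambda>n j. norm (N j n)" and A = UNIV and B = "\<lambda>_. UNIV" and x = n]
      swp[OF base(1)] by simp
  have gle: "norm (g n) \<le> (\<Sum>\<^sub>\<infinity>j. norm (N j n))" for n
    unfolding g_def by (rule norm_infsum_bound[OF sj])
  have wsum: "(\<lambda>n. wt \<epsilon> s n * norm (g n)) summable_on UNIV \<and>
      (\<Sum>\<^sub>\<infinity>n. wt \<epsilon> s n * norm (g n)) \<le> (\<Sum>\<^sub>\<infinity>(j,n). wt \<epsilon> s n * norm (N j n))"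
    if D: "(\<lambda>(j,n). wt \<epsilon> s n * norm (N j n)) summable_on UNIV" and \<epsilon>: "\<epsilon> \<ge> 0" for \<epsilon> s
  proof -
    have w: "wt \<epsilon> s n \<ge> 0" for n using wt_ge_1[OF \<epsilon>, of s n] by simp
    define R where "R n = (\<Sum>\<^sub>\<infinity>j. wt \<epsilon> s n * norm (N j n))" for n
    have D': "((\<lambda>(n,j). wt \<epsilon> s n * norm (N j n)) has_sum (\<Sum>\<^sub>\<infinity>(j,n). wt \<epsilon> s n * norm (N j n))) (UNIV \<times> UNIV)"
      using has_sum_infsum[OF D] has_sum_swap[where f = "\<lambda>(j,n). wt \<epsilon> s n * norm (N j n)" and A = UNIV and B = UNIV] by simp
    have row: "((\<lambda>j. case (n,j) of (n,j) \<Rightarrow> wt \<epsilon> s n * norm (N j n)) has_sum R n) UNIV" for n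
      unfolding R_def using sj[of n] by (auto intro!: has_sum_infsum summable_on_cmult_right)
    have R: "(R has_sum (\<Sum>\<^sub>\<infinity>(j,n). wt \<epsilon> s n * norm (N j n))) UNIV"
      by (rule has_sum_SigmaD[OF D' row])
    have le: "wt \<epsilon> s n * norm (g n) \<le> R n" for n
      unfolding R_def infsum_cmult_right' by (intro mult_left_mono gle w)
    have s: "(\<lambda>n. wt \<epsilon> s n * norm (g n)) summable_on UNIV"
      by (rule summable_on_comparison_test[OF has_sum_imp_summable[OF R] le]) (use w in auto)
    show ?thesis using s infsum_mono[OF s has_sum_imp_summable[OF R] le] infsumI[OF R] by simp
  qed
  have "rapid g"
    unfolding rapid_def
  proof
    fix s
    have "\<tau> < 1 / K" using K\<tau> assms(3) by (simp add: field_simps)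
    then obtain \<epsilon> S where eS: "\<epsilon> > 0" "S < 1 / K" "((\<lambda>n. wt \<epsilon> s n * norm (a n)) has_sum S) UNIV"
      using weighted_norm_small[OF assms(1), of "1 / K" s] by (auto simp: \<tau>_def)
    have "K * S < 1" using eS(2) assms(3) by (simp add: field_simps)
    then have "(\<lambda>(j,n). wt \<epsilon> s n * norm (N j n)) summable_on UNIV"
      unfolding N_def using eS by (intro neumann_double_summable(1)[OF _ assms(2) eS(3)]) auto
    then have sw: "(\<lambda>n. wt \<epsilon> s n * norm (g n)) summable_on UNIV" using wsum eS(1) by simp
    define m where "m = min \<epsilon> 1"
    have m: "0 < m" "m \<le> \<epsilon>" "m \<le> 1" using eS(1) by (auto simp: m_def)
    have "(\<lambda>n. (1 / m ^ s) * (wt \<epsilon> s n * norm (g n))) summable_on UNIV"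
      by (intro summable_on_cmult_right sw)
    then show "(\<lambda>n. (1 + norm (frq n)) ^ s * norm (g n)) summable_on UNIV"
    proof (rule summable_on_comparison_test)
      fix n
      have "(m * (1 + norm (frq n))) ^ s \<le> wt \<epsilon> s n"
        unfolding wt_def using m mult_right_mono[OF m(2), of "norm (frq n)"]
        by (intro power_mono) (auto simp: algebra_simps)
      then have "(1 + norm (frq n)) ^ s \<le> (1 / m ^ s) * wt \<epsilon> s n"
        using m unfolding power_mult_distrib by (simp add: field_simps)
      then show "(1 + norm (frq n)) ^ s * norm (g n) \<le> (1 / m ^ s) * (wt \<epsilon> s n * norm (g n))"
        using mult_right_mono[of _ _ "norm (g n)"] by (fastforce simp: mult.assoc)
    qed auto
  qed
  moreover have "K * (\<Sum>\<^sub>\<infinity>n. norm (g n)) < 1"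
  proof -
    have "(\<Sum>\<^sub>\<infinity>n. norm (g n)) \<le> \<tau> / (1 - K * \<tau>)"
      using wsum[of 0 0] base by (simp add: wt_def)
    then have "K * (\<Sum>\<^sub>\<infinity>n. norm (g n)) \<le> K * (\<tau> / (1 - K * \<tau>))"
      using assms(3) by (intro mult_left_mono) auto
    also have "\<dots> < 1" using K\<tau> by (simp add: field_simps)
    finally show ?thesis .
  qed
  moreover have "g n = (if n = 0 then 0 else a n + conv a (\<lambda>k. \<sigma> k * g k) n)" for n
  proof (cases "n = 0")
    case True
    have "N j 0 = 0" for j unfolding N_def by (cases j) auto
    then show ?thesis using True by (simp add: g_def)
  next
    case False
    have sN: "(\<lambda>j. N j k) summable_on UNIV" for k
      by (rule abs_summable_summable[OF sj])
    have a_le: "norm (a k) \<le> \<tau>" for k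
    proof -
      have "sum (\<lambda>n. norm (a n)) {k} \<le> \<tau>"
        unfolding \<tau>_def by (rule finite_sum_le_infsum[OF rapid_summable[OF assms(1)]]) auto
      then show ?thesis by simp
    qed
    have "(\<lambda>(j,k). (\<tau> * K) * norm (N j k)) summable_on UNIV"
      using summable_on_cmult_right[OF base(1), of "\<tau> * K"] by (simp add: case_prod_unfold)
    then have "(\<lambda>(j,k). norm (a (n - k) * (\<sigma> k * N j k))) summable_on UNIV"
    proof (rule summable_on_comparison_test)
      fix p :: "nat \<times> (int \<times> int)"
      obtain j k where p: "p = (j, k)" by (cases p)
      have "norm (a (n - k)) * norm (\<sigma> k) \<le> \<tau> * K"
        using a_le[of "n - k"] assms(2)[of k] order_trans[OF norm_ge_zero a_le] by (intro mult_mono) auto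
      then show "(case p of (j,k) \<Rightarrow> norm (a (n - k) * (\<sigma> k * N j k))) \<le> (case p of (j,k) \<Rightarrow> (\<tau> * K) * norm (N j k))"
        using mult_right_mono[of _ _ "norm (N j k)"] by (fastforce simp: p norm_mult mult.assoc)
    qed auto
    then have sw: "(\<lambda>(j,k). a (n - k) * (\<sigma> k * N j k)) summable_on (UNIV \<times> UNIV)"
      by (intro abs_summable_summable[of "\<lambda>(j,k). a (n - k) * (\<sigma> k * N j k)"]) (simp add: case_prod_unfold)
    have "(\<Sum>\<^sub>\<infinity>j. N (Suc j) n) = (\<Sum>\<^sub>\<infinity>j. \<Sum>\<^sub>\<infinity>k. a (n - k) * (\<sigma> k * N j k))"
      using False by (simp add: N_def conv_def)
    also have "\<dots> = (\<Sum>\<^sub>\<infinity>k. \<Sum>\<^sub>\<infinity>j. a (n - k) * (\<sigma> k * N j k))"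
      by (rule infsum_swap_banach[OF sw])
    also have "\<dots> = (\<Sum>\<^sub>\<infinity>k. a (n - k) * (\<sigma> k * g k))"
      by (simp add: g_def infsum_cmult_right')
    finally have tail: "(\<Sum>\<^sub>\<infinity>j. N (Suc j) n) = conv a (\<lambda>k. \<sigma> k * g k) n" by (simp add: conv_def)
    have "g n = N 0 n + (\<Sum>\<^sub>\<infinity>j\<in>range Suc. N j n)"
    proof -
      have U: "UNIV = insert (0::nat) (range Suc)" by (auto simp: image_iff) (metis not0_implies_Suc)
      have "(\<lambda>j. N j n) summable_on range Suc"
        by (rule summable_on_subset_banach[OF sN]) auto
      then have "(\<Sum>\<^sub>\<infinity>j\<in>insert 0 (range Suc). N j n) = N 0 n + (\<Sum>\<^sub>\<infinity>j\<in>range Suc. N j n)"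
        by (rule infsum_insert) auto
      then show ?thesis by (simp add: g_def flip: U)
    qed
    also have "(\<Sum>\<^sub>\<infinity>j\<in>range Suc. N j n) = (\<Sum>\<^sub>\<infinity>j. N (Suc j) n)"
      by (subst infsum_reindex) (auto simp: o_def)
    finally show ?thesis using False tail by (simp add: N_def)
  qed
  ultimately show ?thesis by blast
qed

text \<open>With \<open>w(z) = z + c cnj(z) + h(z)\<close> and \<open>h\<close> periodic, the equation becomes
  \<open>\<partial>\<close>-bar\<open> h - \<mu> \<partial>h = \<mu> - c + \<nu> (1 + \<partial>h)\<close>, where \<open>\<nu>\<close> is the sum of the series. On the frequency \<open>n\<close> the operators \<open>\<partial>\<close>-bar
  and \<open>\<partial>\<close> are \<open>(\<i>/2) n\<close> and \<open>(\<i>/2) cnj n\<close>, so for the left side \<open>g\<close> one has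
  \<open>\<partial>h = \<sigma> g\<close> with \<open>\<sigma>(n) = cnj n / (n - \<mu> cnj n)\<close>, of modulus at most \<open>1 / (1 - |\<mu>|)\<close>. The constant \<open>c\<close> absorbs the constant
  term, and the bound on \<open>g\<close> in \<open>neumann_solution\<close> keeps \<open>\<partial>w = 1 + \<partial>h\<close> away from 0.\<close>

theorem beltrami_torus:
  assumes "norm \<mu> < 1" "rapid a" "(\<Sum>\<^sub>\<infinity>n. norm (a n)) < (1 - norm \<mu>) / 2"
  shows "\<exists>w P. smooth_on w UNIV \<and> (\<forall>z. P z \<noteq> 0 \<and>
    (w has_derivative (\<lambda>v. P z * (v + (\<mu> + fourier_sum a z) * cnj v))) (at z))"
proof -
  define \<kappa> where "\<kappa> = 1 - norm \<mu>"
  have \<kappa>: "\<kappa> > 0" using assms(1) by (simp add: \<kappa>_def)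
  define d where "d n = frq n - \<mu> * cnj (frq n)" for n
  have d_ge: "norm (d n) \<ge> \<kappa> * norm (frq n)" for n
    using norm_triangle_ineq2[of "frq n" "\<mu> * cnj (frq n)"] by (simp add: d_def \<kappa>_def norm_mult algebra_simps)
  have d0: "d n \<noteq> 0" if "n \<noteq> 0" for n
  proof -
    have "0 < \<kappa> * norm (frq n)" using \<kappa> that by simp
    then have "0 < norm (d n)" using d_ge[of n] by linarith
    then show ?thesis by simp
  qed
  define \<sigma> where "\<sigma> n = cnj (frq n) / d n" for n
  have \<sigma>: "norm (\<sigma> n) \<le> 1 / \<kappa>" for n
  proof (cases "n = 0")
    case False
    then show ?thesis using d_ge[of n] \<kappa> d0[OF False] by (simp add: \<sigma>_def norm_divide field_simps)
  qed (use \<kappa> in \<open>simp add: \<sigma>_def\<close>)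
  obtain g where g: "rapid g" "(1 / \<kappa>) * (\<Sum>\<^sub>\<infinity>n. norm (g n)) < 1"
    "\<And>n. g n = (if n = 0 then 0 else a n + conv a (\<lambda>k. \<sigma> k * g k) n)"
  proof -
    have "(1 / \<kappa>) * (\<Sum>\<^sub>\<infinity>n. norm (a n)) < 1 / 2"
      using \<kappa> assms(3) unfolding \<kappa>_def[symmetric] by (simp add: field_simps)
    then have "\<exists>g. rapid g \<and> (1 / \<kappa>) * (\<Sum>\<^sub>\<infinity>n. norm (g n)) < 1 \<and>
        (\<forall>n. g n = (if n = 0 then 0 else a n + conv a (\<lambda>k. \<sigma> k * g k) n))"
      using \<kappa> by (intro neumann_solution[where \<sigma> = \<sigma>, OF assms(2) \<sigma>]) auto
    then show ?thesis using that by blast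
  qed
  have g0: "g 0 = 0" using g(3)[of 0] by simp
  define \<sigma>g where "\<sigma>g n = \<sigma> n * g n" for n
  have r\<sigma>g: "rapid \<sigma>g"
    unfolding \<sigma>g_def by (rule rapid_mult[OF g(1), where K = "1 / \<kappa>" and j = 0]) (use \<sigma> in auto)
  \<comment> \<open>The periodic part of the solution.\<close>
  define b where "b n = (2 / (\<i> * d n)) * g n" for n
  have rb: "rapid b"
    unfolding b_def
  proof (rule rapid_mult[OF g(1), where K = "2 / \<kappa>" and j = 0])
    fix n
    show "norm (2 / (\<i> * d n)) \<le> 2 / \<kappa> * (1 + norm (frq n)) ^ 0"
    proof (cases "n = 0")
      case False
      have "frq n \<noteq> 0" using False by simp
      then have "1 \<le> norm (frq n)"
      proof -
        obtain i k where n: "n = (i, k)" by (cases n)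
        have "\<bar>of_int i\<bar> \<le> norm (frq n)" "\<bar>of_int k\<bar> \<le> norm (frq n)"
          using abs_Re_le_cmod[of "frq n"] abs_Im_le_cmod[of "frq n"] by (auto simp: n frq_def)
        moreover have "i \<noteq> 0 \<or> k \<noteq> 0" using False by (auto simp: n zero_prod_def)
        then have "1 \<le> \<bar>i\<bar> \<or> 1 \<le> \<bar>k\<bar>" by linarith
        then have "1 \<le> \<bar>real_of_int i\<bar> \<or> 1 \<le> \<bar>real_of_int k\<bar>" by linarith
        ultimately show ?thesis by linarith
      qed
      then have "\<kappa> * 1 \<le> \<kappa> * norm (frq n)" using \<kappa> by (intro mult_left_mono) auto
      then have "\<kappa> \<le> norm (d n)" using d_ge[of n] by linarith
      then show ?thesis using \<kappa> by (simp add: norm_divide norm_mult frac_le)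
    qed (use \<kappa> in \<open>simp add: d_def\<close>)
  qed
  define \<kappa>0 where "\<kappa>0 = a 0 + conv a \<sigma>g 0"
  define w where "w z = z + (\<mu> + \<kappa>0) * cnj z + fourier_sum b z" for z
  define P where "P z = 1 + fourier_sum \<sigma>g z" for z
  have sg: "fourier_sum g z = fourier_sum a z * P z - \<kappa>0" for z
  proof -
    note sa = rapid_summable[OF assms(2)] and ss = rapid_summable[OF r\<sigma>g]
    have sc: "(\<lambda>n. norm (conv a \<sigma>g n)) summable_on UNIV"
      using conv_weighted(1)[of "\<lambda>_. 1" a _ \<sigma>g] has_sum_infsum[OF sa] has_sum_infsum[OF ss] by simp
    have "((\<lambda>n. (a n + conv a \<sigma>g n) * character n z) has_sum (fourier_sum a z + fourier_sum (conv a \<sigma>g) z)) UNIV"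
      using has_sum_add[OF fourier_sum_has_sum[OF sa, of z] fourier_sum_has_sum[OF sc, of z]] by (simp add: algebra_simps)
    moreover have "((\<lambda>n. if n = 0 then \<kappa>0 else 0) has_sum \<kappa>0) UNIV"
      by (rule has_sum_finite_neutralI[of "{0}"]) auto
    ultimately have "((\<lambda>n. (a n + conv a \<sigma>g n) * character n z + - (if n = 0 then \<kappa>0 else 0)) has_sum
       (fourier_sum a z + fourier_sum (conv a \<sigma>g) z + - \<kappa>0)) UNIV"
      by (intro has_sum_add has_sum_uminusI)
    moreover have "(a n + conv a \<sigma>g n) * character n z + - (if n = 0 then \<kappa>0 else 0) = g n * character n z" for n
      using g(3)[of n] by (simp add: \<kappa>0_def \<sigma>g_def[abs_def])
    ultimately have "fourier_sum g z = fourier_sum a z + fourier_sum (conv a \<sigma>g) z + - \<kappa>0"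
      unfolding fourier_sum_def[of g] by (simp add: infsumI)
    then show ?thesis by (simp add: fourier_sum_conv[OF sa ss] P_def algebra_simps)
  qed
  have der: "(w has_derivative (\<lambda>v. P z * (v + (\<mu> + fourier_sum a z) * cnj v))) (at z)" for z
  proof -
    have "fourier_sum (\<lambda>n. (\<i> * of_real (frq n \<bullet> v)) * b n) z = v * fourier_sum \<sigma>g z + cnj v * (fourier_sum g z + \<mu> * fourier_sum \<sigma>g z)" for v
    proof -
      have inner: "of_real (frq n \<bullet> v) = (cnj (frq n) * v + frq n * cnj v) / 2" for n
        by (simp add: complex_eq_iff inner_complex_def)
      have "(\<i> * of_real (frq n \<bullet> v)) * b n = v * \<sigma>g n + (cnj v * g n + (cnj v * \<mu>) * \<sigma>g n)" for n
      proof (cases "n = 0")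
        case False
        have "frq n = d n + \<mu> * cnj (frq n)" by (simp add: d_def)
        then have "cnj (frq n) * v + frq n * cnj v = cnj (frq n) * v + (d n + \<mu> * cnj (frq n)) * cnj v" by simp
        then show ?thesis unfolding inner b_def \<sigma>g_def \<sigma>_def using d0[OF False] by (simp add: field_simps)
      qed (simp add: b_def \<sigma>g_def g0)
      moreover have "((\<lambda>n. v * (\<sigma>g n * character n z) + (cnj v * (g n * character n z) + (cnj v * \<mu>) * (\<sigma>g n * character n z))) has_sum
          (v * fourier_sum \<sigma>g z + (cnj v * fourier_sum g z + (cnj v * \<mu>) * fourier_sum \<sigma>g z))) UNIV"
        by (intro has_sum_add has_sum_cmult_right fourier_sum_has_sum rapid_summable g(1) r\<sigma>g)
      ultimately have "((\<lambda>n. (\<i> * of_real (frq n \<bullet> v)) * b n * character n z) has_sum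
          (v * fourier_sum \<sigma>g z + (cnj v * fourier_sum g z + (cnj v * \<mu>) * fourier_sum \<sigma>g z))) UNIV"
        by (simp add: algebra_simps)
      then show ?thesis unfolding fourier_sum_def[of "\<lambda>n. (\<i> * of_real (frq n \<bullet> v)) * b n"]
        by (simp add: infsumI algebra_simps)
    qed
    then have "(fourier_sum b has_derivative (\<lambda>v. v * fourier_sum \<sigma>g z + cnj v * (fourier_sum g z + \<mu> * fourier_sum \<sigma>g z))) (at z)"
      using fourier_sum_has_derivative[OF rb, of z] by simp
    then have "(w has_derivative (\<lambda>v. v + (\<mu> + \<kappa>0) * cnj v + (v * fourier_sum \<sigma>g z + cnj v * (fourier_sum g z + \<mu> * fourier_sum \<sigma>g z)))) (at z)"
      unfolding w_def
      by (intro has_derivative_add has_derivative_ident has_derivative_mult_right has_derivative_cnj)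
    moreover have "v + (\<mu> + \<kappa>0) * cnj v + (v * fourier_sum \<sigma>g z + cnj v * (fourier_sum g z + \<mu> * fourier_sum \<sigma>g z)) = P z * (v + (\<mu> + fourier_sum a z) * cnj v)" for v
      unfolding sg by (simp add: P_def algebra_simps)
    ultimately show ?thesis by simp
  qed
  have P0: "P z \<noteq> 0" for z
  proof
    assume "P z = 0"
    then have "fourier_sum \<sigma>g z = - 1" by (simp add: P_def eq_neg_iff_add_eq_0 add.commute)
    then have "norm (fourier_sum \<sigma>g z) = 1" by simp
    moreover have "norm (fourier_sum \<sigma>g z) \<le> (\<Sum>\<^sub>\<infinity>n. norm (\<sigma>g n))"
      by (rule norm_fourier_sum_le[OF rapid_summable[OF r\<sigma>g]])
    moreover have "(\<Sum>\<^sub>\<infinity>n. norm (\<sigma>g n)) \<le> (\<Sum>\<^sub>\<infinity>n. (1 / \<kappa>) * norm (g n))"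
    proof (rule infsum_mono[OF rapid_summable[OF r\<sigma>g] summable_on_cmult_right[OF rapid_summable[OF g(1)]]])
      show "norm (\<sigma>g n) \<le> (1 / \<kappa>) * norm (g n)" for n
        unfolding \<sigma>g_def norm_mult by (intro mult_right_mono \<sigma>) auto
    qed
    ultimately show False using g(2) unfolding infsum_cmult_right' by linarith
  qed
  have "smooth_on w UNIV"
    unfolding w_def
    by (intro smooth_on_add smooth_on_fourier_sum rb open_UNIV smooth_on_bounded_linear bounded_linear_ident
        bounded_linear_compose[OF bounded_linear_mult_right bounded_linear_cnj])
  then show ?thesis using der P0 by blast
qed


section \<open>A smooth cutoff function\<close>

text \<open>A family containing \<open>exp (- 1 / x)\<close> whose span is closed under differentiation.\<close>

definition flat :: "nat \<Rightarrow> real \<Rightarrow> real" where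
  "flat k x = (if x > 0 then inverse x ^ k * exp (- inverse x) else 0)"

lemma flat_has_derivative:
  "(flat k has_real_derivative (flat (k + 2) x - real k * flat (k + 1) x)) (at x)"
proof (cases "x > 0")
  case True
  have "((\<lambda>x. inverse x ^ k * exp (- inverse x)) has_real_derivative (flat (k + 2) x - real k * flat (k + 1) x)) (at x)"
  proof -
    let ?y = "inverse x"
    have "((\<lambda>y. y ^ k * exp (- y)) has_real_derivative (real k * ?y ^ (k - 1) * exp (- ?y) - ?y ^ k * exp (- ?y))) (at ?y)"
      by (auto intro!: derivative_eq_intros)
    moreover have "(inverse has_real_derivative - (?y ^ Suc (Suc 0))) (at x)"
      using True by (intro DERIV_inverse) auto
    ultimately have "((\<lambda>x. inverse x ^ k * exp (- inverse x)) has_real_derivative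
      (real k * ?y ^ (k - 1) * exp (- ?y) - ?y ^ k * exp (- ?y)) * - (?y ^ Suc (Suc 0))) (at x)"
      by (rule DERIV_chain2)
    moreover have "(real k * ?y ^ (k - 1) * exp (- ?y) - ?y ^ k * exp (- ?y)) * - (?y ^ Suc (Suc 0)) =
      flat (k + 2) x - real k * flat (k + 1) x"
      using True by (cases k) (simp_all add: flat_def algebra_simps)
    ultimately show ?thesis by simp
  qed
  then show ?thesis
  proof (rule has_field_derivative_transform_within_open[where S = "{0<..}"])
    show "\<And>y. y \<in> {0<..} \<Longrightarrow> inverse y ^ k * exp (- inverse y) = flat k y" by (simp add: flat_def)
  qed (use True in auto)
next
  case False
  show ?thesis
  proof (cases "x < 0")
    case True
    have "((\<lambda>x. 0) has_real_derivative (flat (k + 2) x - real k * flat (k + 1) x)) (at x)"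
      using True by (simp add: flat_def)
    then show ?thesis
      by (rule has_field_derivative_transform_within_open[where S = "{..<0}"])
         (use True in \<open>auto simp: flat_def\<close>)
  next
    case x0: False
    then have x: "x = 0" using False by simp
    have "((\<lambda>h. flat k h / h) \<longlongrightarrow> 0) (at 0)"
    proof (rule filterlim_split_at)
      have "((\<lambda>y. y ^ (k + 1) / exp y) \<longlongrightarrow> (0::real)) at_top"
        by (rule tendsto_power_div_exp_0)
      then have "((\<lambda>h. inverse h ^ (k + 1) / exp (inverse h)) \<longlongrightarrow> 0) (at_right (0::real))"
        by (rule filterlim_compose[OF _ filterlim_inverse_at_top_right])
      then show "((\<lambda>h. flat k h / h) \<longlongrightarrow> 0) (at_right 0)"
        by (rule Lim_transform_eventually)
           (auto simp: flat_def exp_minus field_simps intro!: eventually_at_rightI[of 0 1])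
      show "((\<lambda>h. flat k h / h) \<longlongrightarrow> 0) (at_left 0)"
        by (rule tendsto_eventually) (auto simp: flat_def intro!: eventually_at_leftI[of "-1" 0])
    qed
    then show ?thesis
      by (simp add: x DERIV_def flat_def)
  qed
qed

lemma smooth_on_flat: "smooth_on (flat k) UNIV"
proof -
  have "Ck_on j (flat k) UNIV" for j
  proof (induction j arbitrary: k)
    case 0
    show ?case
      using DERIV_isCont[OF flat_has_derivative] by (auto intro: continuous_at_imp_continuous_on)
  next
    case (Suc j)
    show ?case
    proof (rule Ck_on_SucI[OF open_UNIV])
      show "(flat k has_derivative (*) (flat (k + 2) x - real k * flat (k + 1) x)) (at x)" for x
        using flat_has_derivative[of k x] by (simp add: has_field_derivative_def)
      fix v
      have "Ck_on j (\<lambda>x. flat (k + 2) x + (- real k) * flat (k + 1) x) UNIV"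
        using Suc.IH[of "k + 2"] Ck_on_bilinear[OF open_UNIV bounded_bilinear_mult Ck_on_const[OF open_UNIV] Suc.IH[of "k + 1"]]
        by (intro Ck_on_add[OF open_UNIV]) blast+
      from Ck_on_bilinear[OF open_UNIV bounded_bilinear_mult this Ck_on_const[OF open_UNIV, of j v]]
      show "Ck_on j (\<lambda>x. (flat (k + 2) x - real k * flat (k + 1) x) * v) UNIV" by simp
    qed
  qed
  then show ?thesis by (simp add: smooth_on_def)
qed

definition step :: "real \<Rightarrow> real" where
  "step t = flat 0 t / (flat 0 t + flat 0 (1 - t))"

lemma step_eq_0: "t \<le> 0 \<Longrightarrow> step t = 0"
  by (simp add: step_def flat_def)

lemma step_eq_1: "t \<ge> 1 \<Longrightarrow> step t = 1"
  by (simp add: step_def flat_def)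

lemma smooth_on_step: "smooth_on step UNIV"
proof -
  have lin: "smooth_on (\<lambda>t. 1 - t) (UNIV :: real set)"
    by (intro smooth_on_diff smooth_on_const smooth_on_bounded_linear bounded_linear_ident open_UNIV)
  have c: "smooth_on (\<lambda>t. flat 0 (1 - t)) UNIV"
    by (rule smooth_on_comp[OF open_UNIV open_UNIV _ smooth_on_flat lin]) simp
  have ne: "flat 0 t + flat 0 (1 - t) \<noteq> 0" for t
    using exp_gt_zero[of "- inverse t"] exp_gt_zero[of "- inverse (1 - t)"]
    by (auto simp: flat_def add_pos_pos less_imp_neq[THEN not_sym])
  show ?thesis
    unfolding step_def[abs_def]
    by (rule smooth_on_divide[OF open_UNIV smooth_on_flat smooth_on_add[OF open_UNIV smooth_on_flat c] ne])
qed

definition cut :: "complex \<Rightarrow> real" where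
  "cut z = step (2 - Re z) * step (2 + Re z) * (step (2 - Im z) * step (2 + Im z))"

lemma cut_eq_1: "\<bar>Re z\<bar> \<le> 1 \<Longrightarrow> \<bar>Im z\<bar> \<le> 1 \<Longrightarrow> cut z = 1"
  by (simp add: cut_def step_eq_1)

lemma cut_eq_0: "\<not> (\<bar>Re z\<bar> \<le> 2 \<and> \<bar>Im z\<bar> \<le> 2) \<Longrightarrow> cut z = 0"
  by (auto simp: cut_def step_eq_0 not_le abs_if split: if_splits)

lemma smooth_on_cut: "smooth_on cut UNIV"
proof -
  have "smooth_on (\<lambda>z. step (2 + s * L z)) UNIV" if "bounded_linear L" for L :: "complex \<Rightarrow> real" and s
  proof (rule smooth_on_comp[OF open_UNIV open_UNIV _ smooth_on_step])
    show "smooth_on (\<lambda>z. 2 + s * L z) UNIV"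
      by (intro smooth_on_add smooth_on_mult smooth_on_const smooth_on_bounded_linear that open_UNIV)
  qed simp
  from this[OF bounded_linear_Re, of "-1"] this[OF bounded_linear_Re, of 1]
    this[OF bounded_linear_Im, of "-1"] this[OF bounded_linear_Im, of 1]
  show ?thesis
    unfolding cut_def[abs_def] by (intro smooth_on_mult open_UNIV) simp_all
qed

section \<open>Local solutions of the Beltrami equation\<close>

definition box2 :: "real \<Rightarrow> complex set" where
  "box2 r = {z. \<bar>Re z\<bar> \<le> r \<and> \<bar>Im z\<bar> \<le> r}"

lemma box2_eq_cbox: "box2 r = cbox (Complex (- r) (- r)) (Complex r r)"
  by (auto simp: box2_def in_cbox_complex_iff)

lemma compact_box2: "compact (box2 r)"
  by (simp add: box2_eq_cbox compact_cbox)

lemma dir_deriv_eq_0_outside: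
  assumes "open S" "\<And>z. z \<in> S \<Longrightarrow> \<phi> z = 0" "z \<in> S"
  shows "(dir_deriv v ^^ s) \<phi> z = 0"
  using assms(2,3)
proof (induction s arbitrary: \<phi> z)
  case (Suc s)
  have "dir_deriv v \<phi> z = 0" if z: "z \<in> S" for z
  proof -
    have "((\<lambda>z. 0) has_derivative (\<lambda>v. 0)) (at z)" by simp
    then have "(\<phi> has_derivative (\<lambda>v. 0)) (at z)"
      by (rule has_derivative_transform_within_open[OF _ assms(1) z]) (simp add: Suc.prems(1))
    from frechet_derivative_at[OF this] show ?thesis by (simp add: dir_deriv_def fun_eq_iff)
  qed
  then show ?case unfolding funpow_Suc_right o_def by (intro Suc.IH Suc.prems(2)) auto
qed simp

text \<open>Rescaling around a point makes the variable part of the coefficient small together with its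
  derivatives: it is a smooth function of the scale as well, and vanishes at scale 0.\<close>

lemma rescaled_coefficient:
  fixes \<mu> :: "complex \<Rightarrow> complex"
  assumes "open U" "smooth_on \<mu> U" "z0 \<in> U" "e > 0"
  shows "\<exists>t>0. \<exists>\<phi>. smooth_on \<phi> UNIV \<and> cell_supported 2 \<phi> \<and>
    (\<forall>z\<in>box2 1. z0 + t *\<^sub>R z \<in> U \<and> \<phi> z = \<mu> (z0 + t *\<^sub>R z) - \<mu> z0) \<and>
    (\<forall>s\<in>{0,4}. \<forall>z. norm ((dir_deriv 1 ^^ s) \<phi> z) \<le> e \<and> norm ((dir_deriv \<i> ^^ s) \<phi> z) \<le> e)"
proof -
  define A where "A p = z0 + fst p *\<^sub>R snd p" for p :: "real \<times> complex"
  have smA: "smooth_on A UNIV"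
    unfolding A_def[abs_def]
    by (intro smooth_on_add smooth_on_const smooth_on_scaleR smooth_on_bounded_linear bounded_linear_fst bounded_linear_snd open_UNIV)
  define \<Omega> where "\<Omega> = A -` U"
  have \<Omega>: "open \<Omega>" unfolding \<Omega>_def
    using continuous_open_vimage[OF assms(1)] smooth_on_continuous[OF smA]
    by (metis continuous_on_open_vimage open_UNIV Int_UNIV_left assms(1) inf_commute)
  define \<Psi> where "\<Psi> p = cut (snd p) *\<^sub>R (\<mu> (A p) - \<mu> z0)" for p
  have sm\<mu>A: "smooth_on (\<lambda>p. \<mu> (A p)) \<Omega>"
    by (rule smooth_on_comp[OF \<Omega> assms(1) _ assms(2) smooth_on_subset[OF smA]]) (auto simp: \<Omega>_def)
  have smcut: "smooth_on (\<lambda>p. cut (snd p)) \<Omega>"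
    by (rule smooth_on_comp[OF \<Omega> open_UNIV _ smooth_on_cut smooth_on_bounded_linear[OF \<Omega> bounded_linear_snd]]) simp
  have sm\<Psi>: "smooth_on \<Psi> \<Omega>"
    unfolding \<Psi>_def[abs_def] by (intro smooth_on_scaleR smooth_on_diff smooth_on_const smcut sm\<mu>A \<Omega>)
  define dp where "dp v F = (\<lambda>p. frechet_derivative F (at p) (0, v))" for v :: complex and F :: "real \<times> complex \<Rightarrow> complex"
  have smdp: "smooth_on ((dp v ^^ s) \<Psi>) \<Omega>" for v s
    by (induction s) (auto simp: sm\<Psi> dp_def intro: smooth_on_frechet)
  obtain r where r: "r > 0" "cball z0 r \<subseteq> U" using assms(1,3) open_contains_cball by blast
  define t0 where "t0 = r / 6"
  have t0: "t0 > 0" using r by (simp add: t0_def)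
  have in\<Omega>: "(t, z) \<in> \<Omega>" if "\<bar>t\<bar> \<le> t0" "z \<in> box2 3" for t z
  proof -
    have "norm z \<le> 6" using that(2) cmod_le[of z] by (simp add: box2_def)
    then have "\<bar>t\<bar> * norm z \<le> t0 * 6" using that(1) by (intro mult_mono) auto
    then have "z0 + t *\<^sub>R z \<in> cball z0 r" by (simp add: t0_def dist_norm)
    then show ?thesis using r by (auto simp: \<Omega>_def A_def)
  qed
  define \<phi> where "\<phi> t z = (if z \<in> box2 2 then \<Psi> (t, z) else 0)" for t z
  have open_out: "open (- box2 2)" using compact_imp_closed[OF compact_box2] by blast
  have int3: "open {z. \<bar>Re z\<bar> < 3 \<and> \<bar>Im z\<bar> < 3}"
    by (intro open_Collect_conj open_Collect_less continuous_intros)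
  have \<phi>\<Psi>: "\<phi> t z = \<Psi> (t, z)" for t z
    using cut_eq_0[of z] by (auto simp: \<phi>_def \<Psi>_def box2_def)
  have sm\<phi>: "smooth_on (\<phi> t) UNIV" if t: "\<bar>t\<bar> \<le> t0" for t
  proof (rule smooth_on_local)
    fix z :: complex
    show "\<exists>T. open T \<and> z \<in> T \<and> smooth_on (\<phi> t) T"
    proof (cases "z \<in> box2 2")
      case True
      let ?T = "{z. \<bar>Re z\<bar> < 3 \<and> \<bar>Im z\<bar> < 3}"
      have "smooth_on (\<lambda>z. \<Psi> (t, z)) ?T"
      proof (rule smooth_on_comp[OF int3 \<Omega> _ sm\<Psi>])
        have "smooth_on (\<lambda>z. (t, 0) + (0, z)) ?T"
          by (intro smooth_on_add smooth_on_const smooth_on_bounded_linear bounded_linear_Pair bounded_linear_zero bounded_linear_ident int3)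
        then show "smooth_on (Pair t) ?T" by simp
        show "Pair t ` ?T \<subseteq> \<Omega>" using in\<Omega>[OF t] by (auto simp: box2_def)
      qed
      then have "smooth_on (\<phi> t) ?T" using smooth_on_cong[OF int3, of "\<phi> t" "\<lambda>z. \<Psi> (t, z)"] \<phi>\<Psi> by simp
      moreover have "z \<in> ?T" using True by (auto simp: box2_def)
      ultimately show ?thesis using int3 by blast
    next
      case False
      have "smooth_on (\<phi> t) (- box2 2)"
        using smooth_on_cong[OF open_out, of "\<phi> t" "\<lambda>z. 0"] smooth_on_const[OF open_out] by (simp add: \<phi>_def)
      then show ?thesis using False open_out by blast
    qed
  qed
  have slice: "(dir_deriv v ^^ s) (\<phi> t) z = (dp v ^^ s) \<Psi> (t, z)" if t: "\<bar>t\<bar> \<le> t0" and z: "\<bar>Re z\<bar> < 3" "\<bar>Im z\<bar> < 3" for v s t z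
    using z
  proof (induction s arbitrary: z)
    case 0
    then show ?case by (simp add: \<phi>\<Psi>)
  next
    case (Suc s)
    have pz: "(t, z) \<in> \<Omega>" using in\<Omega>[OF t] Suc.prems by (auto simp: box2_def)
    note D = smooth_on_imp_has_derivative[OF \<Omega> smdp[where v = v and s = s] pz]
    have "((\<lambda>z. (dp v ^^ s) \<Psi> (t, z)) has_derivative (\<lambda>w. frechet_derivative ((dp v ^^ s) \<Psi>) (at (t, z)) (0, w))) (at z)"
      by (rule has_derivative_compose[where f = "Pair t" and f' = "Pair 0" and g = "(dp v ^^ s) \<Psi>", OF _ D])
        (auto intro!: derivative_eq_intros)
    then have "((dir_deriv v ^^ s) (\<phi> t) has_derivative (\<lambda>w. frechet_derivative ((dp v ^^ s) \<Psi>) (at (t, z)) (0, w))) (at z)"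
      by (rule has_derivative_transform_within_open[OF _ int3]) (use Suc in auto)
    from fun_cong[OF frechet_derivative_at[OF this], of v] show ?case
      by (simp add: dir_deriv_def[of v "(dir_deriv v ^^ s) (\<phi> t)"] dp_def[of v "(dp v ^^ s) \<Psi>"])
  qed
  have zero: "(dp v ^^ s) \<Psi> (0, z) = 0" if "z \<in> box2 2" for v s z
  proof -
    have "(dir_deriv v ^^ s) (\<phi> 0) z = 0"
      by (rule dir_deriv_eq_0_outside[OF open_UNIV]) (auto simp: \<phi>\<Psi> \<Psi>_def A_def)
    moreover have "(dir_deriv v ^^ s) (\<phi> 0) z = (dp v ^^ s) \<Psi> (0, z)"
      by (rule slice) (use t0 that in \<open>auto simp: box2_def\<close>)
    ultimately show ?thesis by simp
  qed
  have small: "\<exists>d>0. \<forall>t. \<bar>t\<bar> < d \<longrightarrow> (\<forall>z. norm ((dir_deriv v ^^ s) (\<phi> t) z) \<le> e)" for v s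
  proof -
    let ?K = "cball 0 t0 \<times> box2 2"
    have sub: "?K \<subseteq> \<Omega>" using in\<Omega> by (force simp: box2_def)
    have "uniformly_continuous_on ?K ((dp v ^^ s) \<Psi>)"
      by (intro compact_uniformly_continuous continuous_on_subset[OF smooth_on_continuous[OF smdp] sub] compact_Times compact_cball compact_box2)
    then obtain d where d: "d > 0" "\<And>p q. p \<in> ?K \<Longrightarrow> q \<in> ?K \<Longrightarrow> dist q p < d \<Longrightarrow> dist ((dp v ^^ s) \<Psi> q) ((dp v ^^ s) \<Psi> p) < e"
      unfolding uniformly_continuous_on_def using assms(4) by metis
    have "norm ((dir_deriv v ^^ s) (\<phi> t) z) \<le> e" if t: "\<bar>t\<bar> < min d t0" for t z
    proof (cases "z \<in> box2 2")
      case True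
      have "dist ((dp v ^^ s) \<Psi> (t, z)) ((dp v ^^ s) \<Psi> (0, z)) < e"
        by (rule d(2)) (use True t t0 in \<open>auto simp: dist_Pair_Pair\<close>)
      moreover have "(dir_deriv v ^^ s) (\<phi> t) z = (dp v ^^ s) \<Psi> (t, z)"
        by (rule slice) (use t True in \<open>auto simp: box2_def\<close>)
      ultimately show ?thesis using zero[where z = z and v = v and s = s, OF True] by simp
    next
      case False
      have "(dir_deriv v ^^ s) (\<phi> t) z = 0"
        by (rule dir_deriv_eq_0_outside[OF open_out]) (use False in \<open>auto simp: \<phi>_def\<close>)
      then show ?thesis using assms(4) by simp
    qed
    then show ?thesis using d(1) t0 by (intro exI[of _ "min d t0"]) auto
  qed
  obtain d1 where d1: "d1 > 0" "\<And>t z. \<bar>t\<bar> < d1 \<Longrightarrow> norm ((dir_deriv 1 ^^ 0) (\<phi> t) z) \<le> e" using small[where v = 1 and s = 0] by blast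
  obtain d2 where d2: "d2 > 0" "\<And>t z. \<bar>t\<bar> < d2 \<Longrightarrow> norm ((dir_deriv 1 ^^ 4) (\<phi> t) z) \<le> e" using small[where v = 1 and s = 4] by blast
  obtain d3 where d3: "d3 > 0" "\<And>t z. \<bar>t\<bar> < d3 \<Longrightarrow> norm ((dir_deriv \<i> ^^ 4) (\<phi> t) z) \<le> e" using small[where v = \<i> and s = 4] by blast
  define t where "t = min (min d1 d2) (min d3 t0) / 2"
  have t: "t > 0" "\<bar>t\<bar> < d1" "\<bar>t\<bar> < d2" "\<bar>t\<bar> < d3" "\<bar>t\<bar> \<le> t0"
    using d1(1) d2(1) d3(1) t0 by (auto simp: t_def)
  have "cell_supported 2 (\<phi> t)" by (auto simp: cell_supported_def \<phi>_def box2_def)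
  moreover have "\<forall>z\<in>box2 1. z0 + t *\<^sub>R z \<in> U \<and> \<phi> t z = \<mu> (z0 + t *\<^sub>R z) - \<mu> z0"
  proof
    fix z assume z: "z \<in> box2 1"
    then have "z \<in> box2 3" by (auto simp: box2_def)
    then have "z0 + t *\<^sub>R z \<in> U" using in\<Omega>[OF t(5)] by (auto simp: \<Omega>_def A_def)
    then show "z0 + t *\<^sub>R z \<in> U \<and> \<phi> t z = \<mu> (z0 + t *\<^sub>R z) - \<mu> z0"
      using z cut_eq_1[of z] by (auto simp: \<phi>\<Psi> \<Psi>_def A_def box2_def)
  qed
  moreover have "\<forall>s\<in>{0,4}. \<forall>z. norm ((dir_deriv 1 ^^ s) (\<phi> t) z) \<le> e \<and> norm ((dir_deriv \<i> ^^ s) (\<phi> t) z) \<le> e"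
    using d1(2)[OF t(2)] d2(2)[OF t(3)] d3(2)[OF t(4)] by simp
  ultimately show ?thesis using t(1) sm\<phi>[OF t(5)] by blast
qed

lemma bounded_dir_deriv:
  assumes "smooth_on \<phi> UNIV" "cell_supported \<rho> \<phi>"
  shows "\<exists>B. \<forall>z. norm ((dir_deriv v ^^ s) \<phi> z) \<le> B"
proof -
  have "bounded ((dir_deriv v ^^ s) \<phi> ` box2 \<rho>)"
    by (intro compact_imp_bounded compact_continuous_image compact_box2
        continuous_on_subset[OF smooth_on_continuous[OF smooth_dir_deriv_funpow[OF assms(1)]]]) simp
  then obtain B where B: "\<And>z. z \<in> box2 \<rho> \<Longrightarrow> norm ((dir_deriv v ^^ s) \<phi> z) \<le> B"
    unfolding bounded_iff by blast
  have "norm ((dir_deriv v ^^ s) \<phi> z) \<le> max B 0" for z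
  proof (cases "z \<in> box2 \<rho>")
    case False
    have "(dir_deriv v ^^ s) \<phi> z = 0"
    proof (rule dir_deriv_eq_0_outside[of "- box2 \<rho>"])
      show "open (- box2 \<rho>)" using compact_imp_closed[OF compact_box2] by blast
      show "\<phi> z = 0" if "z \<in> - box2 \<rho>" for z
        using that assms(2) by (auto simp: cell_supported_def box2_def)
    qed (use False in auto)
    then show ?thesis by simp
  qed (use B in \<open>auto simp: le_max_iff_disj\<close>)
  then show ?thesis by blast
qed

text \<open>Inside \<open>box2 1\<close> the cutoff is 1 and the Fourier series represents the rescaled coefficient there, so the
  solution on the torus solves the original equation in the coordinate \<open>z0 + t z\<close>.\<close>

theorem beltrami_local:
  fixes \<mu> :: "complex \<Rightarrow> complex"
  assumes "open U" "smooth_on \<mu> U" "z0 \<in> U" "norm (\<mu> z0) < 1"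
  shows "\<exists>t>0. \<exists>w P. smooth_on w UNIV \<and> (\<forall>z\<in>box2 1. z0 + t *\<^sub>R z \<in> U \<and> P z \<noteq> 0 \<and>
    (w has_derivative (\<lambda>v. P z * (v + \<mu> (z0 + t *\<^sub>R z) * cnj v))) (at z))"
proof -
  define \<Sigma> where "\<Sigma> = (\<Sum>\<^sub>\<infinity>n. 1 / (1 + norm (frq n)) ^ 4)"
  have \<Sigma>: "\<Sigma> \<ge> 0" unfolding \<Sigma>_def by (intro infsum_nonneg) auto
  define c where "c = 2 ^ 4 * (1 + (2 * pi) ^ 4)"
  have c: "c > 0" by (simp add: c_def add_pos_pos)
  define e where "e = (1 - norm (\<mu> z0)) / (4 * c * (\<Sigma> + 1))"
  have e: "e > 0" using assms(4) c \<Sigma> by (simp add: e_def)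
  obtain t \<phi> where t: "t > 0" and sm: "smooth_on \<phi> UNIV" and supp: "cell_supported 2 \<phi>"
    and val: "\<And>z. z \<in> box2 1 \<Longrightarrow> z0 + t *\<^sub>R z \<in> U \<and> \<phi> z = \<mu> (z0 + t *\<^sub>R z) - \<mu> z0"
    and small: "\<And>s z. s \<in> {0,4} \<Longrightarrow> norm ((dir_deriv 1 ^^ s) \<phi> z) \<le> e \<and> norm ((dir_deriv \<i> ^^ s) \<phi> z) \<le> e"
    using rescaled_coefficient[OF assms(1-3) e] by blast
  have bdd: "\<exists>B. \<forall>z. norm ((dir_deriv 1 ^^ s) \<phi> z) \<le> B \<and> norm ((dir_deriv \<i> ^^ s) \<phi> z) \<le> B" for s
  proof -
    obtain B1 where B1: "\<And>z. norm ((dir_deriv 1 ^^ s) \<phi> z) \<le> B1" using bounded_dir_deriv[OF sm supp] by blast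
    obtain B2 where B2: "\<And>z. norm ((dir_deriv \<i> ^^ s) \<phi> z) \<le> B2" using bounded_dir_deriv[OF sm supp] by blast
    show ?thesis using B1 B2 by (intro exI[of _ "max B1 B2"]) (auto simp: le_max_iff_disj)
  qed
  obtain a where a: "rapid a" "\<And>z. in_cell z \<Longrightarrow> fourier_sum a z = \<phi> z"
    and dec: "\<And>s B n. (\<And>z. norm ((dir_deriv 1 ^^ s) \<phi> z) \<le> B \<and> norm ((dir_deriv \<i> ^^ s) \<phi> z) \<le> B) \<Longrightarrow>
       norm (frq n) ^ s * norm (a n) \<le> (2 * pi) ^ s * B"
  proof -
    have "2 < pi" using pi_gt3 by simp
    from fourier_expansion[OF sm supp this bdd] show ?thesis using that by blast
  qed
  have "norm (a n) \<le> (c * e) * (1 / (1 + norm (frq n)) ^ 4)" for n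
  proof -
    have pos: "0 < (1 + norm (frq n)) ^ 4" by (intro zero_less_power add_pos_nonneg) auto
    have "norm (frq n) ^ 0 * norm (a n) \<le> (2 * pi) ^ 0 * e" "norm (frq n) ^ 4 * norm (a n) \<le> (2 * pi) ^ 4 * e"
      by (rule dec, rule small, simp)+
    then have "2 ^ 4 * (norm (a n) + norm (frq n) ^ 4 * norm (a n)) \<le> 2 ^ 4 * (e + (2 * pi) ^ 4 * e)"
      by (intro mult_left_mono add_mono) auto
    moreover have "(1 + norm (frq n)) ^ 4 * norm (a n) \<le> (2 ^ 4 * (1 + norm (frq n) ^ 4)) * norm (a n)"
      by (intro mult_right_mono one_plus_power_le) auto
    ultimately have "(1 + norm (frq n)) ^ 4 * norm (a n) \<le> c * e"
      by (simp add: c_def algebra_simps)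
    then show ?thesis using pos by (simp add: pos_le_divide_eq mult.commute)
  qed
  then have "(\<Sum>\<^sub>\<infinity>n. norm (a n)) \<le> (\<Sum>\<^sub>\<infinity>n. (c * e) * (1 / (1 + norm (frq n)) ^ 4))"
    by (intro infsum_mono rapid_summable a summable_on_cmult_right summable_frq_weight)
  also have "\<dots> = c * e * \<Sigma>" unfolding infsum_cmult_right' \<Sigma>_def by simp
  also have "\<dots> < (1 - norm (\<mu> z0)) / 2"
  proof -
    have "c * e * \<Sigma> \<le> c * e * (\<Sigma> + 1)" using c e by (intro mult_left_mono) auto
    also have "\<dots> = (1 - norm (\<mu> z0)) / 4"
    proof -
      have "c * (x / (4 * c * S)) * S = x / 4" if "S \<noteq> 0" for x S :: real
        using c that by (simp add: field_simps)
      then show ?thesis unfolding e_def using \<Sigma> by simp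
    qed
    finally show ?thesis using assms(4) by simp
  qed
  finally obtain w P where w: "smooth_on w UNIV" "\<And>z. P z \<noteq> 0"
    "\<And>z. (w has_derivative (\<lambda>v. P z * (v + (\<mu> z0 + fourier_sum a z) * cnj v))) (at z)"
    using beltrami_torus[OF assms(4) a(1)] by blast
  have "(w has_derivative (\<lambda>v. P z * (v + \<mu> (z0 + t *\<^sub>R z) * cnj v))) (at z)" if z: "z \<in> box2 1" for z
  proof -
    have "in_cell z" using z pi_gt3 by (auto simp: in_cell_def box2_def)
    then have "\<mu> z0 + fourier_sum a z = \<mu> (z0 + t *\<^sub>R z)" using a(2) val[OF z] by simp
    then show ?thesis using w(3)[of z] by simp
  qed
  then show ?thesis using t w(1,2) val by blast
qed


section \<open>Smooth inverse functions in the plane\<close>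

definition jac :: "(complex \<Rightarrow> complex) \<Rightarrow> complex \<Rightarrow> real" where
  "jac w z = Im (cnj (frechet_derivative w (at z) 1) * frechet_derivative w (at z) \<i>)"

lemma linear_complex_expand:
  assumes "linear L"
  shows "L v = of_real (Re v) * L 1 + of_real (Im v) * (L \<i> :: complex)"
proof -
  have "L v = L (Re v *\<^sub>R 1 + Im v *\<^sub>R \<i>)"
    by (rule arg_cong[where f = L]) (simp add: complex_eq_iff)
  also have "\<dots> = Re v *\<^sub>R L 1 + Im v *\<^sub>R L \<i>"
    by (simp only: linear_add[OF assms] linear_cmul[OF assms])
  finally show ?thesis by (simp only: scaleR_conv_of_real)
qed

text \<open>Cramer's rule for the real linear map with values \<open>a\<close> at 1 and \<open>b\<close> at \<open>\<i>\<close>.\<close>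

definition cramer :: "complex \<Rightarrow> complex \<Rightarrow> complex \<Rightarrow> complex" where
  "cramer a b u = Complex (Im (cnj u * b) / Im (cnj a * b)) (Im (cnj a * u) / Im (cnj a * b))"

lemma cramer:
  assumes "Im (cnj a * b) \<noteq> 0"
  shows "of_real (Re (cramer a b u)) * a + of_real (Im (cramer a b u)) * b = u"
    "cramer a b (of_real x * a + of_real y * b) = Complex x y"
proof -
  let ?d = "Im (cnj a * b)"
  have "of_real ?d * (of_real (Re (cramer a b u)) * a + of_real (Im (cramer a b u)) * b) =
     of_real (Im (cnj u * b)) * a + of_real (Im (cnj a * u)) * b"
    using assms by (simp add: cramer_def distrib_left mult.assoc[symmetric] of_real_mult[symmetric] del: of_real_mult)
  also have "\<dots> = of_real ?d * u"
    by (simp add: complex_eq_iff algebra_simps)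
  finally show "of_real (Re (cramer a b u)) * a + of_real (Im (cramer a b u)) * b = u"
    using assms by (metis mult_left_cancel of_real_eq_0_iff)
  have 1: "Im (cnj (of_real x * a + of_real y * b) * b) = x * ?d" "Im (cnj a * (of_real x * a + of_real y * b)) = y * ?d"
    by (simp_all add: algebra_simps)
  show "cramer a b (of_real x * a + of_real y * b) = Complex x y"
    unfolding cramer_def 1 using assms by simp
qed

lemma bounded_linear_cramer: "bounded_linear (cramer a b)"
proof -
  have "linear (cramer a b)"
  proof
    show "cramer a b (x + y) = cramer a b x + cramer a b y" for x y
      by (simp add: cramer_def complex_eq_iff distrib_left distrib_right add_divide_distrib diff_divide_distrib)
    show "cramer a b (r *\<^sub>R x) = r *\<^sub>R cramer a b x" for r x
    proof -
      have "Im (cnj (r *\<^sub>R x) * b) = r * Im (cnj x * b)" "Im (cnj a * (r *\<^sub>R x)) = r * Im (cnj a * x)"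
        by (simp_all only: complex_cnj_scaleR mult_scaleR_left mult_scaleR_right scaleR_complex.sel real_scaleR_def)
      then show ?thesis unfolding cramer_def complex_eq_iff by simp
    qed
  qed
  then show ?thesis by (simp add: linear_conv_bounded_linear)
qed

lemma smooth_on_complexI:
  assumes "open S" "smooth_on f S" "smooth_on g S"
  shows "smooth_on (\<lambda>x. Complex (f x) (g x)) S"
proof -
  have "smooth_on (\<lambda>x. f x *\<^sub>R 1 + g x *\<^sub>R \<i>) S"
    by (intro smooth_on_add smooth_on_scaleR smooth_on_const assms)
  moreover have "Complex (f x) (g x) = f x *\<^sub>R 1 + g x *\<^sub>R \<i>" for x by (simp add: complex_eq_iff)
  ultimately show ?thesis by simp
qed

lemma smooth_on_Im_cnj_mult:
  assumes "open S" "smooth_on f S" "smooth_on g S"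
  shows "smooth_on (\<lambda>x. Im (cnj (f x) * g x)) S"
  by (intro smooth_on_bounded_linear_comp[OF assms(1) bounded_linear_Im] smooth_on_mult assms
      smooth_on_bounded_linear_comp[OF assms(1) bounded_linear_cnj])

lemma smooth_on_cramer:
  assumes "open S" "smooth_on a S" "smooth_on b S" "\<And>x. x \<in> S \<Longrightarrow> Im (cnj (a x) * b x) \<noteq> 0"
  shows "smooth_on (\<lambda>x. cramer (a x) (b x) u) S"
  unfolding cramer_def
  by (intro smooth_on_complexI smooth_on_divide smooth_on_Im_cnj_mult smooth_on_const assms)

text \<open>Cramer's rule expresses the derivative of the inverse by the inverse itself and smooth maps, so each order of
  differentiability yields the next.\<close>

theorem smooth_inverse_function:
  assumes "open U" "smooth_on w U" "z0 \<in> U" "jac w z0 \<noteq> 0"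
  shows "\<exists>U' V g. open U' \<and> U' \<subseteq> U \<and> z0 \<in> U' \<and> open V \<and> homeomorphism U' V w g \<and> smooth_on g V"
proof -
  define a where "a z = frechet_derivative w (at z) 1" for z
  define b where "b z = frechet_derivative w (at z) \<i>" for z
  have sma: "smooth_on a U" and smb: "smooth_on b U"
    unfolding a_def b_def by (rule smooth_on_frechet[OF assms(2)])+
  define U1 where "U1 = {z \<in> U. jac w z \<noteq> 0}"
  have "smooth_on (jac w) U" (is "smooth_on ?j U")
    unfolding jac_def[abs_def] a_def[symmetric] b_def[symmetric]
    by (rule smooth_on_Im_cnj_mult[OF assms(1) sma smb])
  then have "open U1"
    using continuous_open_preimage[OF smooth_on_continuous assms(1), of "jac w" "- {0}"]
    by (simp add: U1_def Int_def vimage_def open_Compl)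
  have jac: "Im (cnj (a z) * b z) \<noteq> 0" if "z \<in> U1" for z
    using that by (simp add: U1_def jac_def a_def b_def)
  have D: "(w has_derivative frechet_derivative w (at z)) (at z)" if "z \<in> U1" for z
    using smooth_on_imp_has_derivative[OF assms(1,2)] that by (simp add: U1_def)
  define f' where "f' z = Blinfun (frechet_derivative w (at z))" for z
  have f': "blinfun_apply (f' z) = frechet_derivative w (at z)" if "z \<in> U1" for z
    unfolding f'_def by (rule bounded_linear_Blinfun_apply[OF has_derivative_bounded_linear[OF D[OF that]]])
  have ab: "frechet_derivative w (at z) v = of_real (Re v) * a z + of_real (Im v) * b z" if "z \<in> U1" for z v
    unfolding a_def b_def by (rule linear_complex_expand[OF has_derivative_linear[OF D[OF that]]])
  have z0: "z0 \<in> U1" using assms by (simp add: U1_def)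
  have cont: "continuous_on U1 f'"
  proof (rule continuous_on_blinfun_componentwise)
    fix i :: complex
    have "continuous_on U1 (\<lambda>z. frechet_derivative w (at z) i)"
      by (rule continuous_on_subset[OF smooth_on_continuous[OF smooth_on_frechet[OF assms(2)]]]) (auto simp: U1_def)
    then show "continuous_on U1 (\<lambda>z. blinfun_apply (f' z) i)"
      by (rule continuous_on_eq) (simp add: f')
  qed
  have bl: "bounded_linear (cramer (a z0) (b z0))" by (rule bounded_linear_cramer)
  have "Blinfun (cramer (a z0) (b z0)) o\<^sub>L f' z0 = id_blinfun"
    by (rule blinfun_eqI)
       (simp add: bounded_linear_Blinfun_apply[OF bl] f'[OF z0] ab[OF z0] cramer(2)[OF jac[OF z0]])
  from inverse_function_theorem[OF \<open>open U1\<close> _ cont z0 this, of w] D f'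
  obtain U' V g g' where inv: "open U'" "U' \<subseteq> U1" "z0 \<in> U'" "open V" "homeomorphism U' V w g"
    "\<And>y. y \<in> V \<Longrightarrow> (g has_derivative (g' y)) (at y)"
    "\<And>y. y \<in> V \<Longrightarrow> g' y = inv (blinfun_apply (f' (g y)))"
    "\<And>y. y \<in> V \<Longrightarrow> bij (blinfun_apply (f' (g y)))"
    by (metis (no_types, lifting))
  have gU: "g y \<in> U1" if "y \<in> V" for y
    using inv(2,5) that by (auto simp: homeomorphism_def)
  have g': "g' y u = cramer (a (g y)) (b (g y)) u" if "y \<in> V" for y u
  proof -
    have "blinfun_apply (f' (g y)) (cramer (a (g y)) (b (g y)) u) = u"
      unfolding f'[OF gU[OF that]] ab[OF gU[OF that]] by (rule cramer(1)[OF jac[OF gU[OF that]]])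
    then show ?thesis unfolding inv(7)[OF that] using inv(8)[OF that] by (metis bij_inv_eq_iff)
  qed
  have "Ck_on k g V" for k
  proof (induction k)
    case 0
    show ?case using inv(5) by (simp add: homeomorphism_def)
  next
    case (Suc k)
    show ?case
    proof (rule Ck_on_SucI[OF inv(4) inv(6)])
      fix u
      have "smooth_on (\<lambda>z. cramer (a z) (b z) u) U1"
        by (rule smooth_on_cramer[OF \<open>open U1\<close> smooth_on_subset[OF sma] smooth_on_subset[OF smb] jac]) (auto simp: U1_def)
      then have "Ck_on k (\<lambda>y. cramer (a (g y)) (b (g y)) u) V"
        by (intro Ck_on_comp[OF inv(4) \<open>open U1\<close> _ smooth_on_imp_Ck_on Suc, of "\<lambda>z. cramer (a z) (b z) u"]) (use gU in auto)
      then show "Ck_on k (\<lambda>y. g' y u) V"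
        using Ck_on_cong[OF inv(4), of "\<lambda>y. g' y u" "\<lambda>y. cramer (a (g y)) (b (g y)) u"] g' by simp
    qed
  qed
  then have "smooth_on g V" by (simp add: smooth_on_def)
  then show ?thesis using inv(1-5) U1_def by (intro exI[of _ U'] exI[of _ V] exI[of _ g]) auto
qed

section \<open>Isothermal coordinates\<close>

text \<open>The quadratic form \<open>E a\<^sup>2 + 2 F a b + G b\<^sup>2\<close> is \<open>\<lambda> |v + \<mu> cnj v|\<^sup>2\<close> with \<open>v = a + \<i> b\<close>
  for the coefficient \<open>\<mu>\<close> defined here, so a solution of the Beltrami equation turns it into a
  multiple of the Euclidean one.\<close>

definition beltrami :: "real \<Rightarrow> real \<Rightarrow> real \<Rightarrow> complex" where
  "beltrami E F G = Complex ((E - G) / (E + G + 2 * sqrt (E * G - F\<^sup>2))) (2 * F / (E + G + 2 * sqrt (E * G - F\<^sup>2)))"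

lemma beltrami:
  assumes "E > 0" "E * G - F\<^sup>2 > 0"
  shows "norm (beltrami E F G) < 1"
    "E * (Re v)\<^sup>2 + 2 * F * Re v * Im v + G * (Im v)\<^sup>2 =
      (E + G + 2 * sqrt (E * G - F\<^sup>2)) / 4 * (norm (v + beltrami E F G * cnj v))\<^sup>2"
    "E + G + 2 * sqrt (E * G - F\<^sup>2) > 0"
proof -
  define r where "r = sqrt (E * G - F\<^sup>2)"
  have r: "r > 0" "r\<^sup>2 = E * G - F\<^sup>2" using assms by (auto simp: r_def)
  have "E * G > 0" using assms(2) zero_le_power2[of F] by linarith
  then have G: "G > 0" using assms(1) by (simp add: zero_less_mult_iff)
  define s where "s = E + G + 2 * r"
  have s: "s > 0" using assms(1) G r by (simp add: s_def)
  then show "E + G + 2 * sqrt (E * G - F\<^sup>2) > 0" by (simp add: s_def r_def)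
  have b: "beltrami E F G = Complex ((E - G) / s) (2 * F / s)" by (simp add: beltrami_def s_def r_def)
  have key: "(E - G)\<^sup>2 + (2 * F)\<^sup>2 = s * (E + G - 2 * r)"
    using r(2) by (simp add: s_def power2_eq_square algebra_simps)
  have n2: "(norm (beltrami E F G))\<^sup>2 = (E + G - 2 * r) / s"
  proof -
    have "(norm (beltrami E F G))\<^sup>2 = ((E - G)\<^sup>2 + (2 * F)\<^sup>2) / s\<^sup>2"
      unfolding b cmod_power2 by (simp add: power_divide add_divide_distrib)
    also have "\<dots> = (E + G - 2 * r) / s"
      unfolding key unfolding power2_eq_square[of s] using s by simp
    finally show ?thesis .
  qed
  also have "\<dots> < 1\<^sup>2" using s r(1) by (simp add: s_def)
  finally show "norm (beltrami E F G) < 1" by (rule power_less_imp_less_base) simp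
  have "4 * s * (E * (Re v)\<^sup>2 + 2 * F * Re v * Im v + G * (Im v)\<^sup>2) =
    (s * Re v + (E - G) * Re v + 2 * F * Im v)\<^sup>2 + (s * Im v + 2 * F * Re v - (E - G) * Im v)\<^sup>2"
  proof -
    have "(s + (E - G))\<^sup>2 + (2 * F)\<^sup>2 = s\<^sup>2 + 2 * s * (E - G) + ((E - G)\<^sup>2 + (2 * F)\<^sup>2)"
      by (simp add: power2_sum)
    also have "\<dots> = 4 * s * E" unfolding key by (simp add: s_def power2_eq_square algebra_simps)
    finally have c1: "(s + (E - G))\<^sup>2 + (2 * F)\<^sup>2 = 4 * s * E" .
    have "(s - (E - G))\<^sup>2 + (2 * F)\<^sup>2 = s\<^sup>2 - 2 * s * (E - G) + ((E - G)\<^sup>2 + (2 * F)\<^sup>2)"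
      by (simp add: power2_diff[of s])
    also have "\<dots> = 4 * s * G" unfolding key by (simp add: s_def power2_eq_square algebra_simps)
    finally have c2: "(s - (E - G))\<^sup>2 + (2 * F)\<^sup>2 = 4 * s * G" .
    have "(s * a + (E - G) * a + 2 * F * b)\<^sup>2 + (s * b + 2 * F * a - (E - G) * b)\<^sup>2 =
      ((s + (E - G))\<^sup>2 + (2 * F)\<^sup>2) * a\<^sup>2 + ((s - (E - G))\<^sup>2 + (2 * F)\<^sup>2) * b\<^sup>2 + 8 * s * F * a * b" for a b
      by (simp add: power2_eq_square algebra_simps)
    from this[of "Re v" "Im v"] show ?thesis unfolding c1 c2 by (simp add: algebra_simps)
  qed
  also have "\<dots> = s\<^sup>2 * (norm (v + beltrami E F G * cnj v))\<^sup>2"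
  proof -
    have "s * Re (v + beltrami E F G * cnj v) = s * Re v + (E - G) * Re v + 2 * F * Im v"
      "s * Im (v + beltrami E F G * cnj v) = s * Im v + 2 * F * Re v - (E - G) * Im v"
      using s by (simp_all add: b distrib_left right_diff_distrib)
    then show ?thesis unfolding cmod_power2 distrib_left power_mult_distrib[symmetric] by simp
  qed
  finally have "s * (4 * (E * (Re v)\<^sup>2 + 2 * F * Re v * Im v + G * (Im v)\<^sup>2)) = s * (s * (norm (v + beltrami E F G * cnj v))\<^sup>2)"
    by (simp add: power2_eq_square mult_ac)
  then show "E * (Re v)\<^sup>2 + 2 * F * Re v * Im v + G * (Im v)\<^sup>2 =
      (E + G + 2 * sqrt (E * G - F\<^sup>2)) / 4 * (norm (v + beltrami E F G * cnj v))\<^sup>2"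
    using s by (simp add: s_def r_def)
qed

text \<open>If \<open>w\<close> solves the Beltrami equation, \<open>|dw|\<^sup>2 = |w\<^sub>z|\<^sup>2 |dz + \<mu> d(cnj z)|\<^sup>2\<close> is a multiple of
  the given form, so the inverse of \<open>w\<close>, followed by the rescaling map, is conformal.\<close>

theorem isothermal_coordinates:
  fixes E F G :: "complex \<Rightarrow> real"
  assumes U: "open U" "z0 \<in> U" and sm: "smooth_on E U" "smooth_on F U" "smooth_on G U"
    and pos: "\<And>z. z \<in> U \<Longrightarrow> E z > 0" "\<And>z. z \<in> U \<Longrightarrow> E z * G z - (F z)\<^sup>2 > 0"
  shows "\<exists>W V (\<phi> :: complex \<Rightarrow> complex) \<psi>. open W \<and> open V \<and> V \<subseteq> U \<and> z0 \<in> V \<and> homeomorphism W V \<phi> \<psi> \<and>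
    smooth_on \<phi> W \<and> smooth_on \<psi> V \<and>
    (\<forall>\<zeta>\<in>W. \<exists>\<rho>>0. \<forall>v. let u = frechet_derivative \<phi> (at \<zeta>) v; z = \<phi> \<zeta> in
       E z * (Re u)\<^sup>2 + 2 * F z * Re u * Im u + G z * (Im u)\<^sup>2 = \<rho> * (norm v)\<^sup>2)"
proof -
  define \<mu> where "\<mu> z = beltrami (E z) (F z) (G z)" for z
  define s where "s z = E z + G z + 2 * sqrt (E z * G z - (F z)\<^sup>2)" for z
  have s0: "s z > 0" if "z \<in> U" for z unfolding s_def by (rule beltrami(3)[OF pos[OF that]])
  have "smooth_on (\<lambda>z. E z * G z - F z * F z) U"
    by (intro smooth_on_diff smooth_on_mult sm U)
  then have "smooth_on (\<lambda>z. sqrt (E z * G z - F z * F z)) U"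
    by (rule smooth_on_comp[OF U(1) _ _ smooth_on_sqrt, rotated 2]) (use pos in \<open>auto simp: power2_eq_square\<close>)
  then have sms: "smooth_on s U"
    unfolding s_def[abs_def] power2_eq_square
    by (intro smooth_on_add smooth_on_mult smooth_on_const sm U)
  have sm\<mu>: "smooth_on \<mu> U"
  proof -
    have ne: "s z \<noteq> 0" if "z \<in> U" for z using s0[OF that] by simp
    have "smooth_on (\<lambda>z. Complex ((E z - G z) / s z) (2 * F z / s z)) U"
      by (intro smooth_on_complexI smooth_on_divide smooth_on_diff smooth_on_mult smooth_on_const sm sms U ne)
    then show ?thesis by (simp add: \<mu>_def[abs_def] beltrami_def s_def)
  qed
  obtain t w P where t: "t > 0" and smw: "smooth_on w UNIV"
    and w: "\<And>z. z \<in> box2 1 \<Longrightarrow> z0 + t *\<^sub>R z \<in> U \<and> P z \<noteq> 0 \<and>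
      (w has_derivative (\<lambda>v. P z * (v + \<mu> (z0 + t *\<^sub>R z) * cnj v))) (at z)"
    using beltrami_local[OF U(1) sm\<mu> U(2)] beltrami(1)[OF pos[OF U(2)]] unfolding \<mu>_def by blast
  define B where "B = {z :: complex. \<bar>Re z\<bar> < 1 \<and> \<bar>Im z\<bar> < 1}"
  have B: "open B" unfolding B_def by (intro open_Collect_conj open_Collect_less continuous_intros)
  have B2: "B \<subseteq> box2 1" by (auto simp: B_def box2_def)
  have 0: "0 \<in> B" by (simp add: B_def)
  have fw: "frechet_derivative w (at z) v = P z * (v + \<mu> (z0 + t *\<^sub>R z) * cnj v)" if "z \<in> B" for z v
  proof -
    have "(w has_derivative (\<lambda>v. P z * (v + \<mu> (z0 + t *\<^sub>R z) * cnj v))) (at z)"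
      using w B2 that by blast
    from fun_cong[OF frechet_derivative_at[OF this], of v] show ?thesis by simp
  qed
  have jac: "jac w z \<noteq> 0" if "z \<in> B" for z
  proof -
    let ?m = "\<mu> (z0 + t *\<^sub>R z)"
    have "z0 + t *\<^sub>R z \<in> U" "P z \<noteq> 0" using w B2 that by blast+
    then have "norm ?m < 1" unfolding \<mu>_def by (intro beltrami(1) pos)
    then have "(norm ?m)\<^sup>2 < 1" by (simp add: power_less_one_iff)
    moreover have "jac w z = (norm (P z))\<^sup>2 * (1 - (norm ?m)\<^sup>2)"
      unfolding jac_def fw[OF that] cmod_power2 by (simp add: power2_eq_square algebra_simps)
    ultimately show ?thesis using \<open>P z \<noteq> 0\<close> by simp
  qed
  obtain U' V' g where inv: "open U'" "U' \<subseteq> B" "0 \<in> U'" "open V'" "homeomorphism U' V' w g" "smooth_on g V'"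
    using smooth_inverse_function[OF B smooth_on_subset[OF smw] 0 jac[OF 0]] by auto
  define A where "A z = z0 + t *\<^sub>R z" for z
  define A' where "A' z = (1 / t) *\<^sub>R (z - z0)" for z
  have AA: "A' (A z) = z" "A (A' z) = z" for z using t by (auto simp: A_def A'_def)
  have smA: "smooth_on A S" if "open S" for S
    unfolding A_def[abs_def]
    by (intro smooth_on_add smooth_on_const smooth_on_bounded_linear bounded_linear_scaleR_right that)
  have smA': "smooth_on A' S" if "open S" for S
    unfolding A'_def[abs_def]
    by (intro smooth_on_bounded_linear_comp[OF that bounded_linear_scaleR_right] smooth_on_diff smooth_on_const
        smooth_on_bounded_linear bounded_linear_ident that)
  define V where "V = A ` U'"
  have VA: "V = A' -` U'" unfolding V_def using AA by (auto simp: image_iff) metis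
  have V: "open V"
    unfolding VA using continuous_open_vimage[OF inv(1)] smooth_on_continuous[OF smA'[OF open_UNIV]]
    by (metis continuous_on_open_vimage open_UNIV Int_UNIV_left inv(1) inf_commute)
  define \<phi> where "\<phi> = A \<circ> g"
  define \<psi> where "\<psi> = w \<circ> A'"
  have hom: "homeomorphism V' V \<phi> \<psi>"
    unfolding \<phi>_def \<psi>_def
  proof (rule homeomorphism_compose)
    show "homeomorphism V' U' g w" using inv(5) by (rule homeomorphism_symD)
    show "homeomorphism U' V A A'"
      unfolding homeomorphism_def V_def
      using AA smooth_on_continuous[OF smA[OF open_UNIV]] smooth_on_continuous[OF smA'[OF open_UNIV]]
      by (auto simp: image_image intro: continuous_on_subset)
  qed
  have sm\<phi>: "smooth_on \<phi> V'"
    unfolding \<phi>_def o_def by (rule smooth_on_comp[OF inv(4) open_UNIV _ smA[OF open_UNIV] inv(6)]) simp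
  have sm\<psi>: "smooth_on \<psi> V"
    unfolding \<psi>_def o_def by (rule smooth_on_comp[OF V open_UNIV _ smw smA'[OF V]]) simp
  have VU: "V \<subseteq> U" using w B2 inv(2) by (auto simp: V_def A_def)
  have z0V: "z0 \<in> V" unfolding V_def using inv(3) by (force simp: A_def)
  have iso: "\<exists>\<rho>>0. \<forall>v. let u = frechet_derivative \<phi> (at \<zeta>) v; z = \<phi> \<zeta> in
       E z * (Re u)\<^sup>2 + 2 * F z * Re u * Im u + G z * (Im u)\<^sup>2 = \<rho> * (norm v)\<^sup>2" if \<zeta>: "\<zeta> \<in> V'" for \<zeta>
  proof -
    define y where "y = g \<zeta>"
    have yU: "y \<in> U'" using inv(5) \<zeta> by (auto simp: homeomorphism_def y_def)
    then have yB: "y \<in> B" using inv(2) by blast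
    have zU: "A y \<in> U" and P0: "P y \<noteq> 0" using w[of y] B2 yB by (auto simp: A_def)
    have \<phi>y: "\<phi> \<zeta> = A y" by (simp add: \<phi>_def y_def)
    define Dg where "Dg = frechet_derivative g (at \<zeta>)"
    have Dg: "(g has_derivative Dg) (at \<zeta>)"
      unfolding Dg_def by (rule smooth_on_imp_has_derivative[OF inv(4,6) \<zeta>])
    have "(\<phi> has_derivative (\<lambda>v. t *\<^sub>R Dg v)) (at \<zeta>)"
      unfolding \<phi>_def o_def A_def using Dg by (auto intro!: derivative_eq_intros)
    then have D\<phi>: "frechet_derivative \<phi> (at \<zeta>) v = t *\<^sub>R Dg v" for v
      by (metis frechet_derivative_at)
    have "(w has_derivative (\<lambda>v. P y * (v + \<mu> (A y) * cnj v))) (at (g \<zeta>))"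
      using w[of y] B2 yB by (auto simp: A_def y_def)
    from has_derivative_compose[OF Dg this]
    have "((\<lambda>x. w (g x)) has_derivative (\<lambda>v. P y * (Dg v + \<mu> (A y) * cnj (Dg v)))) (at \<zeta>)" .
    moreover have "((\<lambda>x. w (g x)) has_derivative (\<lambda>v. v)) (at \<zeta>)"
      by (rule has_derivative_transform_within_open[OF has_derivative_ident inv(4) \<zeta>])
         (use inv(5) in \<open>auto simp: homeomorphism_def\<close>)
    ultimately have "(\<lambda>v. P y * (Dg v + \<mu> (A y) * cnj (Dg v))) = (\<lambda>v. v)"
      by (rule has_derivative_unique)
    then have id: "P y * (Dg v + \<mu> (A y) * cnj (Dg v)) = v" for v by metis
    define \<rho> where "\<rho> = s (A y) / 4 * (t / norm (P y))\<^sup>2"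
    have "\<rho> > 0" using s0[OF zU] t P0 by (simp add: \<rho>_def)
    moreover have "E (A y) * (Re (t *\<^sub>R Dg v))\<^sup>2 + 2 * F (A y) * Re (t *\<^sub>R Dg v) * Im (t *\<^sub>R Dg v) + G (A y) * (Im (t *\<^sub>R Dg v))\<^sup>2 = \<rho> * (norm v)\<^sup>2" for v
    proof -
      have "t *\<^sub>R Dg v + \<mu> (A y) * cnj (t *\<^sub>R Dg v) = of_real t * (Dg v + \<mu> (A y) * cnj (Dg v))"
        by (simp add: scaleR_conv_of_real algebra_simps)
      also have "\<dots> = of_real t * (v / P y)" by (metis id P0 nonzero_mult_div_cancel_left)
      finally have "norm (t *\<^sub>R Dg v + \<mu> (A y) * cnj (t *\<^sub>R Dg v)) = t / norm (P y) * norm v"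
        using t by (simp add: norm_mult norm_divide)
      then show ?thesis
        unfolding beltrami(2)[OF pos[OF zU]] \<mu>_def[symmetric] s_def[symmetric] \<rho>_def
        by (simp only: power_mult_distrib mult.assoc)
    qed
    ultimately show ?thesis unfolding Let_def \<phi>y D\<phi> by blast
  qed
  show ?thesis
    by (rule exI[of _ V'], rule exI[of _ V], rule exI[of _ \<phi>], rule exI[of _ \<psi>], intro conjI ballI iso)
       (fact inv(4) V VU z0V hom sm\<phi> sm\<psi>)+
qed


section \<open>The map Gamma\<close>

definition wedge :: "real^4 \<Rightarrow> real^4 \<Rightarrow> real^4^4" where
  "wedge u p = (\<chi> i j. u $ i * p $ j - p $ i * u $ j)"

lemma bounded_bilinear_wedge: "bounded_bilinear wedge"
proof -
  have "bilinear wedge"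
    unfolding bilinear_def
    by (intro conjI allI linearI) (simp_all add: wedge_def vec_eq_iff algebra_simps)
  then show ?thesis by (simp add: bilinear_conv_bounded_bilinear)
qed

interpretation wedge: bounded_bilinear wedge
  by (rule bounded_bilinear_wedge)

lemma wedge_same [simp]: "wedge u u = 0"
  by (simp add: wedge_def vec_eq_iff)

lemma wedge_swap: "wedge u v = - wedge v u"
  by (simp add: wedge_def vec_eq_iff)

lemma lie_inner_eq_sum: "lie_inner u v = (\<Sum>i\<in>UNIV. \<Sum>j\<in>UNIV. u $ i $ j * v $ i $ j) / 2"
  by (simp add: lie_inner_def trace_def matrix_matrix_mult_def transpose_def)

lemma bounded_bilinear_lie_inner: "bounded_bilinear (lie_inner :: real^4^4 \<Rightarrow> _)"
proof -
  have "bilinear (lie_inner :: real^4^4 \<Rightarrow> _)"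
    unfolding bilinear_def lie_inner_eq_sum
    by (intro conjI allI linearI)
       (simp_all add: algebra_simps sum.distrib sum_distrib_left add_divide_distrib)
  then show ?thesis by (simp add: bilinear_conv_bounded_bilinear)
qed

interpretation lie_inner: bounded_bilinear "lie_inner :: real^4^4 \<Rightarrow> _"
  by (rule bounded_bilinear_lie_inner)

lemma lie_inner_wedge: "lie_inner (wedge a b) (wedge c d) = (a \<bullet> c) * (b \<bullet> d) - (a \<bullet> d) * (b \<bullet> c)"
  unfolding lie_inner_eq_sum by (simp add: wedge_def inner_vec_def sum_4 field_simps)

lemma lie_inner_wedge_left: "lie_inner (wedge a b) V = (a \<bullet> (V *v b) - b \<bullet> (V *v a)) / 2"
  unfolding lie_inner_eq_sum
  by (simp add: wedge_def inner_vec_def matrix_vector_mult_def sum_4 algebra_simps diff_divide_distrib add_divide_distrib)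

lemma matrix_mult_wedge: "x ** wedge u p ** transpose x = wedge (x *v u) (x *v p)"
  by (simp add: vec_eq_iff wedge_def matrix_matrix_mult_def matrix_vector_mult_def transpose_def sum_4 algebra_simps)

lemma wedge_mult_vec: "wedge a b *v v = (b \<bullet> v) *\<^sub>R a - (a \<bullet> v) *\<^sub>R b"
  by (simp add: vec_eq_iff wedge_def matrix_vector_mult_def inner_vec_def sum_4 algebra_simps)

lemma e1_inner [simp]: "e1 \<bullet> e1 = 1"
  by (simp add: e1_def inner_axis_axis)

lemma norm_e1 [simp]: "norm e1 = 1"
  by (simp add: e1_def)

lemma O4_inverse:
  assumes "x \<in> O4"
  shows "matrix_inv x = transpose x" "transpose x ** x = mat 1" "x ** transpose x = mat 1"
proof -
  show 1: "transpose x ** x = mat 1" "x ** transpose x = mat 1"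
    using assms by (simp_all add: O4_def orthogonal_matrix_def)
  have "invertible x" using 1 invertible_def by blast
  then have "matrix_inv x ** x = mat 1"
    using someI_ex[of "\<lambda>y. x ** y = mat 1 \<and> y ** x = mat 1"] by (auto simp: invertible_def matrix_inv_def)
  then have "matrix_inv x ** x ** transpose x = transpose x" by simp
  then show "matrix_inv x = transpose x" by (simp add: matrix_mul_assoc[symmetric] 1)
qed

lemma O4_mult: "x \<in> O4 \<Longrightarrow> y \<in> O4 \<Longrightarrow> x ** y \<in> O4"
  by (simp add: O4_def orthogonal_matrix_mul)

lemma O4_fibre_nonempty:
  assumes "norm p = 1"
  shows "\<exists>x. x \<in> O4 \<and> proj x = p"
proof -
  obtain f where f: "orthogonal_transformation f" "f e1 = p"
    using orthogonal_transformation_exists_1[OF norm_e1 assms] by blast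
  then have "matrix f \<in> O4" "matrix f *v e1 = p"
    by (auto simp: O4_def orthogonal_transformation_matrix matrix_works)
  then show ?thesis by (auto simp: proj_def)
qed

text \<open>The rotation by the angle \<open>t\<close> in the plane of the orthonormal vectors \<open>b\<close> and \<open>a\<close>.\<close>

definition rotation :: "real^4 \<Rightarrow> real^4 \<Rightarrow> real \<Rightarrow> real^4^4" where
  "rotation a b t = mat 1 + (cos t - 1) *\<^sub>R (\<chi> i j. a $ i * a $ j + b $ i * b $ j) + sin t *\<^sub>R wedge a b"

lemma rotation_mult_vec:
  "rotation a b t *v v = v + (cos t - 1) *\<^sub>R ((a \<bullet> v) *\<^sub>R a + (b \<bullet> v) *\<^sub>R b) + sin t *\<^sub>R ((b \<bullet> v) *\<^sub>R a - (a \<bullet> v) *\<^sub>R b)"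
proof -
  have "(\<chi> i j. a $ i * a $ j + b $ i * b $ j) *v v = (a \<bullet> v) *\<^sub>R a + (b \<bullet> v) *\<^sub>R b"
    by (simp add: vec_eq_iff matrix_vector_mult_def inner_vec_def sum_4 algebra_simps)
  then show ?thesis
    by (simp add: rotation_def matrix_vector_mult_add_rdistrib scaleR_matrix_vector_assoc[symmetric] wedge_mult_vec)
qed

lemma rotation_in_O4:
  assumes ab: "a \<bullet> a = 1" "b \<bullet> b = 1" "a \<bullet> b = 0"
  shows "rotation a b t \<in> O4"
proof -
  have ba: "b \<bullet> a = 0" using ab by (simp add: inner_commute)
  have "norm (rotation a b t *v v) = norm v" for v
  proof -
    define \<alpha> \<beta> c s where "\<alpha> = a \<bullet> v" "\<beta> = b \<bullet> v" "c = cos t" "s = sin t"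
    note d = this
    have cs: "c * c + s * s = 1" unfolding d by (metis power2_eq_square sin_cos_squared_add2)
    have v: "v \<bullet> a = \<alpha>" "v \<bullet> b = \<beta>" by (simp_all add: d inner_commute)
    have "(rotation a b t *v v) \<bullet> (rotation a b t *v v) =
      v \<bullet> v + (\<alpha> * \<alpha> + \<beta> * \<beta>) * (c * c + s * s - 1)"
      unfolding rotation_mult_vec d(1,2)[symmetric] d(3,4)[symmetric]
      by (simp add: inner_add_left inner_add_right inner_diff_left inner_diff_right v ab ba d(1,2)[symmetric])
         (simp add: algebra_simps)
    then show ?thesis by (simp add: cs norm_eq_sqrt_inner)
  qed
  then have "orthogonal_transformation ((*v) (rotation a b t))"
    by (simp add: orthogonal_transformation)
  then show ?thesis by (simp add: O4_def orthogonal_transformation_matrix)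
qed

lemma linear_matrix_mult_left: "linear (\<lambda>X. x ** (X :: real^4^4))"
  by (rule linearI) (simp_all add: vec_eq_iff matrix_matrix_mult_def sum_4 algebra_simps)

lemma linear_matrix_mult_right: "linear (\<lambda>X. (X :: real^4^4) ** x)"
  by (rule linearI) (simp_all add: vec_eq_iff matrix_matrix_mult_def sum_4 algebra_simps)

lemma linear_proj: "linear proj"
  unfolding proj_def by (rule linearI) (simp_all add: vec_eq_iff matrix_vector_mult_def sum_4 algebra_simps)

lemma bilinear_matrix_mult: "bounded_bilinear (\<lambda>X Y. (X :: real^4^4) ** (Y :: real^4^4))"
proof -
  have "bilinear (\<lambda>X Y. (X :: real^4^4) ** (Y :: real^4^4))"
    unfolding bilinear_def using linear_matrix_mult_left linear_matrix_mult_right by blast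
  then show ?thesis by (simp add: bilinear_conv_bounded_bilinear)
qed

lemma linear_transpose: "linear (transpose :: real^4^4 \<Rightarrow> real^4^4)"
  by (rule linearI) (simp_all add: vec_eq_iff transpose_def)

text \<open>These curves supply enough tangent vectors: the horizontal ones, and enough vertical ones to single them out.\<close>

lemma rotation_curve_tangent:
  assumes ab: "a \<bullet> a = 1" "b \<bullet> b = 1" "a \<bullet> b = 0" and S: "\<And>t. x ** rotation a b t \<in> S"
  shows "x ** (r *\<^sub>R wedge a b) \<in> tangent_space S x"
proof -
  let ?P = "\<chi> i j. a $ i * a $ j + b $ i * b $ j"
  have R: "((\<lambda>t. rotation a b (r * t)) has_vector_derivative (r *\<^sub>R wedge a b)) (at 0)"
    unfolding rotation_def by (auto intro!: derivative_eq_intros)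
  have "((\<lambda>t. x ** rotation a b (r * t)) has_vector_derivative x ** (r *\<^sub>R wedge a b)) (at 0)"
    by (rule bounded_linear.has_vector_derivative[OF _ R])
       (use linear_matrix_mult_left in \<open>simp add: linear_conv_bounded_linear\<close>)
  moreover have "x ** rotation a b (r * 0) = x" by (simp add: rotation_def)
  ultimately show ?thesis
    unfolding tangent_space_def using S by (intro CollectI exI[of _ "\<lambda>t. x ** rotation a b (r * t)"]) auto
qed

lemma tangent_O4_skew:
  assumes "x \<in> O4" "X \<in> tangent_space O4 x"
  shows "transpose (transpose x ** X) = - (transpose x ** X)"
proof -
  obtain \<gamma> where \<gamma>: "\<And>t. \<gamma> t \<in> O4" "\<gamma> 0 = x" "(\<gamma> has_vector_derivative X) (at (0::real))"
    using assms(2) by (auto simp: tangent_space_def)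
  have "((\<lambda>t. transpose (\<gamma> t)) has_vector_derivative transpose X) (at 0)"
    by (rule bounded_linear.has_vector_derivative[OF _ \<gamma>(3)])
       (use linear_transpose in \<open>simp add: linear_conv_bounded_linear\<close>)
  from bounded_bilinear.has_vector_derivative[OF bilinear_matrix_mult this \<gamma>(3)]
  have "((\<lambda>t. transpose (\<gamma> t) ** \<gamma> t) has_vector_derivative (transpose x ** X + transpose X ** x)) (at 0)"
    by (simp add: \<gamma>(2))
  moreover have "(\<lambda>t. transpose (\<gamma> t) ** \<gamma> t) = (\<lambda>t. mat 1)"
    using O4_inverse(2)[OF \<gamma>(1)] by simp
  ultimately have "((\<lambda>t::real. mat 1 :: real^4^4) has_vector_derivative (transpose x ** X + transpose X ** x)) (at 0)"
    by simp
  then have "transpose x ** X + transpose X ** x = 0"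
    using has_vector_derivative_const vector_derivative_unique_at by blast
  then have "transpose X ** x = - (transpose x ** X)" by (simp add: eq_neg_iff_add_eq_0 add.commute)
  then show ?thesis by (simp add: matrix_transpose_mul)
qed

lemma tangent_fibre:
  fixes Y :: "real^4^4"
  assumes "Y \<in> tangent_space ((\<lambda>y. x ** y) ` O3) x"
  shows "Y *v e1 = 0"
proof -
  obtain \<gamma> :: "real \<Rightarrow> real^4^4" where \<gamma>: "\<And>t. \<gamma> t \<in> (\<lambda>y. x ** y) ` O3" "\<gamma> 0 = x" "(\<gamma> has_vector_derivative Y) (at 0)"
    using assms by (auto simp: tangent_space_def)
  have "((\<lambda>t. proj (\<gamma> t)) has_vector_derivative proj Y) (at 0)"
    by (rule bounded_linear.has_vector_derivative[OF _ \<gamma>(3)])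
       (use linear_proj in \<open>simp add: linear_conv_bounded_linear\<close>)
  moreover have "(\<lambda>t. proj (\<gamma> t)) = (\<lambda>t. x *v e1)"
  proof
    fix t
    obtain y where "\<gamma> t = x ** y" "y \<in> O3" using \<gamma>(1)[of t] by blast
    then show "proj (\<gamma> t) = x *v e1" by (simp add: proj_def O3_def matrix_vector_mul_assoc[symmetric])
  qed
  ultimately have "((\<lambda>t::real. x *v e1) has_vector_derivative proj Y) (at 0)" by simp
  then have "proj Y = 0"
    by (rule vector_derivative_unique_at[OF _ has_vector_derivative_const])
  then show ?thesis by (simp add: proj_def)
qed

lemma tangent_space_mono: "S \<subseteq> T \<Longrightarrow> tangent_space S x \<subseteq> tangent_space T x"
proof
  fix v assume ST: "S \<subseteq> T" and "v \<in> tangent_space S x"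
  then obtain \<gamma> :: "real \<Rightarrow> 'a" where \<gamma>: "\<And>t. \<gamma> t \<in> S" "\<gamma> 0 = x" "(\<gamma> has_vector_derivative v) (at 0)"
    by (auto simp: tangent_space_def)
  then have "\<forall>t. \<gamma> t \<in> T" using ST by auto
  then show "v \<in> tangent_space T x" using \<gamma>(2,3) unfolding tangent_space_def by (intro CollectI exI[of _ \<gamma>]) simp
qed

lemma horizontal_wedge:
  assumes x: "x \<in> O4" and a: "a \<bullet> e1 = 0"
  shows "x ** wedge a e1 \<in> horizontal x"
  unfolding horizontal_def
proof (intro CollectI conjI ballI)
  show "x ** wedge a e1 \<in> tangent_space O4 x"
  proof (cases "a = 0")
    case True
    have "x \<in> O4 \<longrightarrow> (0::real^4^4) \<in> tangent_space O4 x"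
      unfolding tangent_space_def by (auto intro!: exI[of _ "\<lambda>t. x"])
    moreover have "x ** wedge a e1 = 0" using True linear_0[OF linear_matrix_mult_left] by (simp add: wedge.zero_left)
    ultimately show ?thesis using x by simp
  next
    case False
    let ?b = "a /\<^sub>R norm a"
    have "?b \<bullet> ?b = 1" using False by (simp add: dot_square_norm power2_eq_square)
    then have "x ** (norm a *\<^sub>R wedge ?b e1) \<in> tangent_space O4 x"
      using a x by (intro rotation_curve_tangent O4_mult rotation_in_O4) auto
    then show ?thesis using False by (simp add: wedge.scaleR_left)
  qed
next
  fix Y assume Y: "Y \<in> tangent_space ((\<lambda>y. x ** y) ` O3) x"
  let ?B = "transpose x ** Y"
  have "(\<lambda>y. x ** y) ` O3 \<subseteq> O4" using x by (auto simp: O3_def intro: O4_mult)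
  then have "Y \<in> tangent_space O4 x" using Y tangent_space_mono by blast
  then have skew: "transpose ?B = - ?B" by (rule tangent_O4_skew[OF x])
  have B1: "?B *v e1 = 0" using tangent_fibre[OF Y] by (simp add: matrix_vector_mul_assoc[symmetric])
  have "e1 \<bullet> (?B *v a) = (transpose ?B *v e1) \<bullet> a"
    by (metis dot_lmul_matrix vector_transpose_matrix transpose_transpose inner_commute)
  also have "\<dots> = 0" unfolding skew using B1
    by (simp add: vec_eq_iff matrix_vector_mult_def sum_negf inner_vec_def)
  finally have "lie_inner (wedge a e1) ?B = 0" by (simp add: lie_inner_wedge_left B1)
  moreover have "matrix_inv x ** (x ** wedge a e1) = wedge a e1"
    by (simp add: O4_inverse[OF x] matrix_mul_assoc)
  ultimately show "bi_invariant x (x ** wedge a e1) Y = 0"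
    unfolding bi_invariant_def by (simp add: O4_inverse(1)[OF x])
qed

text \<open>Being orthogonal to the rotations of the coordinate planes perpendicular to \<open>e1\<close> leaves a skew matrix with only
  its first row and column, and the first column is the image under the differential of the projection.\<close>

lemma horizontal_unique:
  assumes x: "x \<in> O4" and X: "X \<in> horizontal x"
  shows "X = x ** wedge (transpose x *v (X *v e1)) e1"
proof -
  let ?A = "transpose x ** X"
  have skew: "transpose ?A = - ?A"
    by (rule tangent_O4_skew[OF x]) (use X in \<open>simp add: horizontal_def\<close>)
  have sk: "?A $ i $ j = - ?A $ j $ i" for i j
  proof -
    have "transpose ?A $ j $ i = (- ?A) $ j $ i" unfolding skew ..
    then show ?thesis by (simp add: transpose_def)
  qed
  have zero: "?A $ i $ j = 0" if "i \<noteq> 1" "j \<noteq> 1" for i j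
  proof (cases "i = j")
    case True
    then show ?thesis using sk[of i j] by simp
  next
    case False
    let ?a = "axis i 1 :: real^4" and ?b = "axis j 1 :: real^4"
    have ab: "?a \<bullet> ?a = 1" "?b \<bullet> ?b = 1" "?a \<bullet> ?b = 0"
      using False by (auto simp: inner_axis_axis)
    have "rotation ?a ?b t \<in> O3" for t
      using that rotation_in_O4[OF ab] by (auto simp: O3_def rotation_mult_vec e1_def inner_axis_axis)
    then have "x ** (1 *\<^sub>R wedge ?a ?b) \<in> tangent_space ((\<lambda>y. x ** y) ` O3) x"
      by (intro rotation_curve_tangent ab) auto
    then have "bi_invariant x X (x ** wedge ?a ?b) = 0"
      using X by (auto simp: horizontal_def)
    then have "lie_inner ?A (wedge ?a ?b) = 0"
      by (simp add: bi_invariant_def O4_inverse[OF x] matrix_mul_assoc)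
    then have "lie_inner (wedge ?a ?b) ?A = 0"
      by (simp add: lie_inner_eq_sum mult.commute)
    then have "?a \<bullet> (?A *v ?b) = ?b \<bullet> (?A *v ?a)"
      by (simp add: lie_inner_wedge_left)
    then have "?A $ i $ j = ?A $ j $ i"
      by (simp add: inner_axis' matrix_vector_mult_basis column_def)
    then show ?thesis using sk[of i j] by simp
  qed
  have col: "transpose x *v (X *v e1) = ?A *v e1" by (simp add: matrix_vector_mul_assoc)
  have "?A = wedge (?A *v e1) e1"
  proof (subst vec_eq_iff, intro allI, subst vec_eq_iff, intro allI)
    fix i j :: 4
    have c: "(?A *v e1) $ k = ?A $ k $ 1" for k by (simp add: e1_def matrix_vector_mult_basis column_def)
    have e: "e1 $ k = (if k = 1 then 1 else 0)" for k by (simp add: e1_def axis_def)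
    show "?A $ i $ j = wedge (?A *v e1) e1 $ i $ j"
      using zero[of i j] sk[of i j] sk[of 1 1] unfolding wedge_def c e by auto
  qed
  then have "x ** ?A = x ** wedge (transpose x *v (X *v e1)) e1" unfolding col by simp
  then show ?thesis by (simp add: matrix_mul_assoc O4_inverse(3)[OF x])
qed

theorem Gamma_eq_wedge:
  assumes p: "norm p = 1" and u: "u \<bullet> p = 0"
  shows "Gamma p u = wedge u p"
proof -
  define x where "x = (SOME x. x \<in> O4 \<and> proj x = p)"
  have x: "x \<in> O4" "proj x = p"
    using someI_ex[OF O4_fibre_nonempty[OF p]] unfolding x_def by auto
  have bl: "bounded_linear proj" using linear_proj by (simp add: linear_conv_bounded_linear)
  have Dproj: "frechet_derivative proj (at x) = proj"
    using frechet_derivative_at[OF bounded_linear_imp_has_derivative[OF bl]] by metis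
  have bm: "bounded_linear (\<lambda>z::real^4^4. z ** matrix_inv x)"
    using linear_matrix_mult_right by (simp add: linear_conv_bounded_linear)
  have Dm: "frechet_derivative (\<lambda>z. z ** matrix_inv x) (at x) = (\<lambda>z. z ** matrix_inv x)"
    using frechet_derivative_at[OF bounded_linear_imp_has_derivative[OF bm]] by metis
  define a where "a = transpose x *v u"
  have xa: "x *v a = u" unfolding a_def matrix_vector_mul_assoc O4_inverse(3)[OF x(1)] by simp
  have a1: "a \<bullet> e1 = 0"
  proof -
    have "a \<bullet> e1 = u \<bullet> (x *v e1)"
      unfolding a_def by (metis dot_lmul_matrix vector_transpose_matrix transpose_transpose)
    then show ?thesis using u x(2) by (simp add: proj_def)
  qed
  have pr: "proj (x ** wedge a e1) = u"
    unfolding proj_def matrix_vector_mul_assoc[symmetric] wedge_mult_vec by (simp add: a1 xa)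
  have "lift x u = x ** wedge a e1"
    unfolding lift_def Dproj
  proof (rule inv_into_f_eq)
    show "inj_on proj (horizontal x)"
      using horizontal_unique[OF x(1)] unfolding inj_on_def proj_def by metis
  qed (use horizontal_wedge[OF x(1) a1] pr in auto)
  then have "Gamma_at x u = x ** wedge a e1 ** transpose x"
    unfolding Gamma_at_def Dm by (simp add: O4_inverse(1)[OF x(1)])
  also have "\<dots> = wedge u p"
    unfolding matrix_mult_wedge using x(2) by (simp add: xa proj_def)
  finally show ?thesis unfolding Gamma_def x_def[symmetric] .
qed


section \<open>Calculus of partial derivatives\<close>

lemma smooth_on_pd: "smooth_on a U \<Longrightarrow> smooth_on (pd i a) U"
  unfolding pd_def[abs_def] by (rule smooth_on_frechet)

lemma pd_eqI: "(a has_derivative D) (at z) \<Longrightarrow> pd i a z = D (coord i)"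
  unfolding pd_def by (metis frechet_derivative_at)

lemma pd_cong:
  assumes "open U" "z \<in> U" "\<And>w. w \<in> U \<Longrightarrow> a w = b w" "smooth_on a U"
  shows "pd i a z = pd i b z"
  unfolding pd_def
  using frechet_derivative_transform_within_open[OF _ assms(1,2), of a b] assms(3)
    smooth_on_imp_has_derivative[OF assms(1,4,2)] by (metis differentiable_def)

lemma pd_const [simp]: "pd i (\<lambda>w. c) z = 0"
  using pd_eqI[OF has_derivative_const[of c "at z"], of i] by simp

lemma pd_bilinear:
  assumes "bounded_bilinear B" "open U" "smooth_on a U" "smooth_on b U" "z \<in> U"
  shows "pd i (\<lambda>w. B (a w) (b w)) z = B (a z) (pd i b z) + B (pd i a z) (b z)"
  using pd_eqI[OF bounded_bilinear.FDERIV[OF assms(1) smooth_on_imp_has_derivative[OF assms(2,3,5)]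
      smooth_on_imp_has_derivative[OF assms(2,4,5)]], of i]
  by (simp add: pd_def)

lemmas pd_inner = pd_bilinear[OF bounded_bilinear_inner]
lemmas pd_mult = pd_bilinear[OF bounded_bilinear_mult]

lemma pd_add:
  assumes "open U" "smooth_on a U" "smooth_on b U" "z \<in> U"
  shows "pd i (\<lambda>w. a w + b w) z = pd i a z + pd i b z"
  using pd_eqI[OF has_derivative_add[OF smooth_on_imp_has_derivative[OF assms(1,2,4)]
      smooth_on_imp_has_derivative[OF assms(1,3,4)]], of i]
  by (simp add: pd_def)

lemma pd_diff:
  assumes "open U" "smooth_on a U" "smooth_on b U" "z \<in> U"
  shows "pd i (\<lambda>w. a w - b w) z = pd i a z - pd i b z"
  using pd_eqI[OF has_derivative_diff[OF smooth_on_imp_has_derivative[OF assms(1,2,4)]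
      smooth_on_imp_has_derivative[OF assms(1,3,4)]], of i]
  by (simp add: pd_def)

lemma pd_commute:
  assumes "open U" "smooth_on a U" "z \<in> U"
  shows "pd i (pd j a) z = pd j (pd i a) z"
  unfolding pd_def[abs_def]
  by (rule frechet_derivative_commute[OF assms(1) smooth_on_imp_Ck_on[OF assms(2)] assms(3)])

lemma coord_simps [simp]: "coord 1 = 1" "coord 2 = \<i>"
  by (auto simp: coord_def)

lemma frechet_eq_pd:
  assumes "open U" "smooth_on a U" "z \<in> U"
  shows "frechet_derivative a (at z) v = Re v *\<^sub>R pd 1 a z + Im v *\<^sub>R pd 2 a z"
proof -
  have lin: "linear (frechet_derivative a (at z))"
    using has_derivative_linear[OF smooth_on_imp_has_derivative[OF assms]] .
  have "frechet_derivative a (at z) v = frechet_derivative a (at z) (Re v *\<^sub>R 1 + Im v *\<^sub>R \<i>)"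
    by (rule arg_cong[where f = "frechet_derivative a (at z)"]) (simp add: complex_eq_iff)
  then show ?thesis
    by (simp only: linear_add[OF lin] linear_cmul[OF lin] pd_def coord_simps)
qed

lemma matrix_inv_eqI:
  fixes A B :: "real^'n^'n"
  assumes "A ** B = mat 1" "B ** A = mat 1"
  shows "matrix_inv A = B"
proof -
  have "A ** matrix_inv A = mat 1 \<and> matrix_inv A ** A = mat 1"
  proof -
    have "\<exists>A'. A ** A' = mat 1 \<and> A' ** A = mat 1" using assms by (intro exI[of _ B] conjI)
    from someI_ex[OF this] show ?thesis by (simp add: matrix_inv_def)
  qed
  then have "B ** (A ** matrix_inv A) = B" by simp
  then show ?thesis by (simp add: matrix_mul_assoc assms(2))
qed

section \<open>Local geometry of a surface in the 3-sphere\<close>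

text \<open>The polynomial identity behind the traced Codazzi equation. The letters \<open>aijk\<close>, \<open>bij\<close>, \<open>tijk\<close>, \<open>sijk\<close> stand for
  the inner products of \<open>X\<^sub>i\<^sub>j\<close> and \<open>X\<^sub>k\<close>, of \<open>N\<^sub>i\<close> and \<open>X\<^sub>j\<close>, of \<open>N\<^sub>i\<^sub>j\<close> and \<open>X\<^sub>k\<close>,
  and of \<open>N\<^sub>i\<close> and \<open>X\<^sub>j\<^sub>k\<close>; the hypotheses on \<open>s\<close> are the Weingarten equations, the last two
  hypotheses are the definition of the mean curvature and its derivative.\<close>

lemma traced_codazzi_algebra:
  fixes E F G D :: real
  assumes D: "D = E * G - F * F" "D \<noteq> 0"
    and s: "D * s111 = (G * b11 - F * b12) * a111 + (E * b12 - F * b11) * a112"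
      "D * s112 = (G * b11 - F * b12) * a121 + (E * b12 - F * b11) * a122"
      "D * s122 = (G * b11 - F * b12) * a221 + (E * b12 - F * b11) * a222"
      "D * s211 = (G * b12 - F * b22) * a111 + (E * b22 - F * b12) * a112"
      "D * s212 = (G * b12 - F * b22) * a121 + (E * b22 - F * b12) * a122"
    and c: "t121 - t112 = s112 - s211" "t221 - t122 = s122 - s212"
    and H: "2 * D * H = - (G * b11 - 2 * F * b12 + E * b22)"
    and H1: "2 * (2 * a111 * G + 2 * E * a122 - 2 * F * (a112 + a121)) * H + 2 * D * H1 =
      - (2 * a122 * b11 + G * (t111 + s111) - 2 * (a112 + a121) * b12 - 2 * F * (t112 + s112)
         + 2 * a111 * b22 + E * (t122 + s212))"
    and \<Gamma>: "D * c111 = G * a111 - F * a112" "D * c211 = E * a112 - F * a111"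
      "D * c112 = G * a121 - F * a122" "D * c212 = E * a122 - F * a121"
      "D * c122 = G * a221 - F * a222" "D * c222 = E * a222 - F * a221"
  shows "G * (t111 - (c111 * b11 + c211 * b12)) - 2 * F * (t121 - (c112 * b11 + c212 * b12))
     + E * (t221 - (c122 * b11 + c222 * b12)) = - 2 * D * H1"
proof -
  have t: "t121 = t112 + s112 - s211" "t221 = t122 + s122 - s212" using c by auto
  let ?L = "G * (t111 - (c111 * b11 + c211 * b12)) - 2 * F * (t121 - (c112 * b11 + c212 * b12))
     + E * (t221 - (c122 * b11 + c222 * b12))"
  let ?D1 = "2 * a111 * G + 2 * E * a122 - 2 * F * (a112 + a121)"
  have "D * (?L + 2 * D * H1) =
     D * G * t111 - G * ((D * c111) * b11 + (D * c211) * b12)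
     - 2 * F * (D * t112 + D * s112 - D * s211 - ((D * c112) * b11 + (D * c212) * b12))
     + E * (D * t122 + D * s122 - D * s212 - ((D * c122) * b11 + (D * c222) * b12))
     - D * (2 * a122 * b11 - 2 * (a112 + a121) * b12 + 2 * a111 * b22)
     - G * (D * t111 + D * s111) + 2 * F * (D * t112 + D * s112) - E * (D * t122 + D * s212)
     - ?D1 * (2 * D * H)"
    unfolding t using arg_cong[OF H1, of "\<lambda>x. D * x"] by (simp add: algebra_simps)
  also have "\<dots> = 0"
    unfolding s \<Gamma> H unfolding D(1) by (simp add: algebra_simps)
  finally show ?thesis using D(2) by simp
qed

text \<open>One parametrization of an oriented immersed surface. Inside, \<open>X\<close> and \<open>N\<close> are position and normal as
  functions of the coordinates. The second fundamental form is minus the inner product of \<open>N\<^sub>i\<close> and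
  \<open>X\<^sub>j\<close>; writing it so avoids third derivatives of \<open>X\<close>.\<close>

locale sphere_patch =
  fixes f \<eta> :: "'a \<Rightarrow> real^4" and F :: "complex \<Rightarrow> 'a" and U :: "complex set"
  assumes U: "open U"
    and smX: "smooth_on (f \<circ> F) U" and smN: "smooth_on (\<eta> \<circ> F) U"
    and unit: "\<And>z. z \<in> U \<Longrightarrow> norm (f (F z)) = 1 \<and> norm (\<eta> (F z)) = 1 \<and> \<eta> (F z) \<bullet> f (F z) = 0"
    and inj: "\<And>z. z \<in> U \<Longrightarrow> inj (frechet_derivative (f \<circ> F) (at z))"
    and normal: "\<And>z v. z \<in> U \<Longrightarrow> \<eta> (F z) \<bullet> frechet_derivative (f \<circ> F) (at z) v = 0"
begin

definition X where "X = f \<circ> F"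
definition N where "N = \<eta> \<circ> F"

lemma smooth_X: "smooth_on X U" and smooth_N: "smooth_on N U"
  using smX smN by (simp_all add: X_def N_def)

lemma smooth_pd: "smooth_on (pd i X) U" "smooth_on (pd i N) U"
  by (simp_all add: smooth_on_pd smooth_X smooth_N)

lemma pd_sym: "z \<in> U \<Longrightarrow> pd i (pd j X) z = pd j (pd i X) z" "z \<in> U \<Longrightarrow> pd i (pd j N) z = pd j (pd i N) z"
  by (rule pd_commute[OF U smooth_X], assumption, rule pd_commute[OF U smooth_N], assumption)

lemma pd_zero:
  assumes "z \<in> U" "\<And>w. w \<in> U \<Longrightarrow> a w \<bullet> b w = c" "smooth_on a U" "smooth_on b U"
  shows "a z \<bullet> pd i b z + pd i a z \<bullet> b z = 0"
  using pd_cong[OF U assms(1) assms(2) smooth_on_inner[OF U assms(3,4)], of i]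
    pd_inner[OF U assms(3,4,1), of i] by simp

lemma frame_products:
  assumes z: "z \<in> U"
  shows "X z \<bullet> X z = 1" "N z \<bullet> N z = 1" "N z \<bullet> X z = 0" "X z \<bullet> N z = 0"
    "N z \<bullet> pd i X z = 0" "pd i X z \<bullet> N z = 0" "X z \<bullet> pd i X z = 0" "pd i X z \<bullet> X z = 0"
    "N z \<bullet> pd i N z = 0" "pd i N z \<bullet> N z = 0" "pd i N z \<bullet> X z = 0" "X z \<bullet> pd i N z = 0"
proof -
  have a: "X w \<bullet> X w = 1" "N w \<bullet> N w = 1" "N w \<bullet> X w = 0" "N w \<bullet> pd i X w = 0" if "w \<in> U" for w
    using unit[OF that] normal[OF that] by (auto simp: X_def N_def pd_def norm_eq_1)
  show "X z \<bullet> X z = 1" "N z \<bullet> N z = 1" "N z \<bullet> X z = 0" "N z \<bullet> pd i X z = 0" using a[OF z] by auto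
  then show "X z \<bullet> N z = 0" "pd i X z \<bullet> N z = 0" by (simp_all add: inner_commute)
  show 1: "X z \<bullet> pd i X z = 0"
    using pd_zero[OF z a(1) smooth_X smooth_X, of i] by (simp add: inner_commute)
  show 2: "N z \<bullet> pd i N z = 0"
    using pd_zero[OF z a(2) smooth_N smooth_N, of i] by (simp add: inner_commute)
  show 3: "pd i N z \<bullet> X z = 0"
    using pd_zero[OF z a(3) smooth_N smooth_X, of i] a(4)[OF z] by simp
  show "pd i X z \<bullet> X z = 0" "pd i N z \<bullet> N z = 0" "X z \<bullet> pd i N z = 0"
    using 1 2 3 by (simp_all add: inner_commute)
qed

lemma second_products:
  assumes z: "z \<in> U"
  shows "pd i (pd j X) z \<bullet> N z = - (pd i N z \<bullet> pd j X z)" "pd i (pd j X) z \<bullet> X z = - (pd i X z \<bullet> pd j X z)"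
    "pd i N z \<bullet> pd j X z = pd j N z \<bullet> pd i X z"
proof -
  show 1: "pd i (pd j X) z \<bullet> N z = - (pd i N z \<bullet> pd j X z)" for i j
    using pd_zero[OF z frame_products(5) smooth_N smooth_pd(1), of i j] by (simp add: inner_commute)
  show "pd i (pd j X) z \<bullet> X z = - (pd i X z \<bullet> pd j X z)"
    using pd_zero[OF z frame_products(7) smooth_X smooth_pd(1), of i j] by (simp add: inner_commute)
  show "pd i N z \<bullet> pd j X z = pd j N z \<bullet> pd i X z"
    using 1[of i j] 1[of j i] pd_sym(1)[OF z, of i j] by simp
qed

definition g where "g i j z = pd i X z \<bullet> pd j X z"
definition gdet where "gdet z = g 1 1 z * g 2 2 z - g 1 2 z * g 1 2 z"

lemma g_sym: "g i j z = g j i z"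
  by (simp add: g_def inner_commute)

lemma smooth_g: "smooth_on (g i j) U"
  unfolding g_def[abs_def] by (rule smooth_on_inner[OF U smooth_pd(1) smooth_pd(1)])

lemma g_pos:
  assumes z: "z \<in> U"
  shows "g 1 1 z > 0" "gdet z > 0"
proof -
  have indep: "a = 0 \<and> b = 0" if "a *\<^sub>R pd 1 X z + b *\<^sub>R pd 2 X z = 0" for a b
  proof -
    have "frechet_derivative X (at z) (Complex a b) = frechet_derivative X (at z) 0"
      unfolding frechet_eq_pd[OF U smooth_X z] using that by simp
    then have "Complex a b = 0"
      using inj[OF z] unfolding X_def by (meson injD)
    then show ?thesis by (simp add: complex_eq_iff)
  qed
  have "pd 1 X z \<noteq> 0" using indep[of 1 0] by auto
  then show E: "g 1 1 z > 0" by (simp add: g_def)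
  define v where "v = g 1 1 z *\<^sub>R pd 2 X z - g 1 2 z *\<^sub>R pd 1 X z"
  have "v \<noteq> 0"
    using indep[of "- g 1 2 z" "g 1 1 z"] E by (auto simp: v_def)
  then have "v \<bullet> v > 0" by simp
  moreover have "v \<bullet> v = g 1 1 z * gdet z"
    unfolding v_def gdet_def g_def by (simp add: inner_diff_left inner_diff_right inner_commute algebra_simps)
  ultimately show "gdet z > 0" using E by (simp add: zero_less_mult_iff)
qed

text \<open>Gram-Schmidt turns position, normal and the two coordinate vectors into an orthogonal basis.\<close>

lemma frame_zero:
  assumes z: "z \<in> U" and v: "v \<bullet> X z = 0" "v \<bullet> N z = 0" "\<And>i. v \<bullet> pd i X z = 0"
  shows "v = 0"
proof (rule ccontr)
  assume "v \<noteq> 0"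
  define y where "y = g 1 1 z *\<^sub>R pd 2 X z - g 1 2 z *\<^sub>R pd 1 X z"
  note fp = frame_products[OF z]
  have "y \<bullet> y = g 1 1 z * gdet z"
    unfolding y_def gdet_def g_def by (simp add: inner_diff_left inner_diff_right inner_commute algebra_simps)
  then have "y \<noteq> 0" using g_pos[OF z] by auto
  have x1: "pd 1 X z \<noteq> 0" using g_pos(1)[OF z] by (auto simp: g_def)
  have xn: "X z \<noteq> 0" "N z \<noteq> 0" using fp(1,2) by auto
  have orth: "v \<bullet> y = 0" "X z \<bullet> y = 0" "N z \<bullet> y = 0" "pd 1 X z \<bullet> y = 0"
    by (simp_all add: y_def inner_diff_right v fp g_def)
  let ?S = "{v, X z, N z, pd 1 X z, y}"
  have ne: "a \<noteq> b" if "a \<bullet> b = 0" "a \<noteq> 0" for a b :: "real^4" using that by auto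
  have "v \<noteq> X z" "v \<noteq> N z" "v \<noteq> pd 1 X z" "v \<noteq> y" "X z \<noteq> N z" "X z \<noteq> pd 1 X z" "X z \<noteq> y"
    "N z \<noteq> pd 1 X z" "N z \<noteq> y" "pd 1 X z \<noteq> y"
    by (rule ne; simp add: v fp orth xn x1 \<open>v \<noteq> 0\<close>)+
  then have "card ?S = 5" by simp
  moreover have "independent ?S"
  proof (rule pairwise_orthogonal_independent)
    show "pairwise orthogonal ?S"
      using orth v fp by (auto simp: pairwise_insert orthogonal_def inner_commute)
  qed (use \<open>v \<noteq> 0\<close> \<open>y \<noteq> 0\<close> x1 xn in auto)
  ultimately show False using independent_bound[of ?S] by simp
qed

text \<open>The inverse metric, the Christoffel symbols (below, \<open>ch k i j\<close> with upper index \<open>k\<close>) and the coefficients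
  of \<open>dN\<close> (\<open>wg\<close>) as functions of the coordinates.\<close>

definition gi where "gi i j z = inv_metric f F z $ i $ j"

lemma gi:
  assumes z: "z \<in> U"
  shows "gi 1 1 z = g 2 2 z / gdet z" "gi 1 2 z = - g 1 2 z / gdet z"
    "gi 2 1 z = - g 1 2 z / gdet z" "gi 2 2 z = g 1 1 z / gdet z"
proof -
  define B :: "real^2^2" where "B = vector [vector [g 2 2 z / gdet z, - g 1 2 z / gdet z], vector [- g 1 2 z / gdet z, g 1 1 z / gdet z]]"
  have D: "gdet z \<noteq> 0" using g_pos(2)[OF z] by simp
  have m: "metric f F z $ i $ j = g i j z" for i j by (simp add: metric_def g_def X_def)
  have 21: "g 2 1 z = g 1 2 z" by (rule g_sym)
  have eq: "g 1 1 z * g 2 2 z = gdet z + g 1 2 z * g 1 2 z" by (simp add: gdet_def)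
  have "metric f F z ** B = mat 1" "B ** metric f F z = mat 1"
    using D by (simp_all add: vec_eq_iff forall_2 matrix_matrix_mult_def sum_2 m 21 B_def vector_2 mat_def
        divide_simps eq mult.commute[of "g 2 2 z" "g 1 1 z"])
  then have "inv_metric f F z = B" unfolding inv_metric_def by (rule matrix_inv_eqI)
  then show "gi 1 1 z = g 2 2 z / gdet z" "gi 1 2 z = - g 1 2 z / gdet z"
    "gi 2 1 z = - g 1 2 z / gdet z" "gi 2 2 z = g 1 1 z / gdet z"
    by (simp_all add: gi_def B_def vector_2)
qed

lemma gi_solve:
  assumes z: "z \<in> U"
  shows "(gi 1 1 z * a + gi 1 2 z * b) * g 1 1 z + (gi 2 1 z * a + gi 2 2 z * b) * g 1 2 z = a"
    "(gi 1 1 z * a + gi 1 2 z * b) * g 1 2 z + (gi 2 1 z * a + gi 2 2 z * b) * g 2 2 z = b"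
proof -
  have D: "gdet z \<noteq> 0" using g_pos(2)[OF z] by simp
  show "(gi 1 1 z * a + gi 1 2 z * b) * g 1 1 z + (gi 2 1 z * a + gi 2 2 z * b) * g 1 2 z = a"
    "(gi 1 1 z * a + gi 1 2 z * b) * g 1 2 z + (gi 2 1 z * a + gi 2 2 z * b) * g 2 2 z = b"
    unfolding gi[OF z] using D by (simp_all add: divide_simps) (simp_all add: gdet_def algebra_simps)
qed

definition ch where "ch k i j z = christoffel f F z k i j"

lemma ch_eq:
  assumes z: "z \<in> U"
  shows "ch k i j z = gi k 1 z * (pd i (pd j X) z \<bullet> pd 1 X z) + gi k 2 z * (pd i (pd j X) z \<bullet> pd 2 X z)"
proof -
  have m: "(\<lambda>w. metric f F w $ a $ b) = (\<lambda>w. pd a X w \<bullet> pd b X w)" for a b by (simp add: metric_def X_def)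
  have "pd i (\<lambda>w. metric f F w $ j $ l) z + pd j (\<lambda>w. metric f F w $ i $ l) z - pd l (\<lambda>w. metric f F w $ i $ j) z
    = 2 * (pd i (pd j X) z \<bullet> pd l X z)" for l
    unfolding m pd_inner[OF U smooth_pd(1) smooth_pd(1) z]
    using pd_sym(1)[OF z, of j i] pd_sym(1)[OF z, of l i] pd_sym(1)[OF z, of l j] by (simp add: inner_commute)
  then show ?thesis unfolding ch_def christoffel_def by (simp add: sum_2 gi_def)
qed

lemma gauss_formula:
  assumes z: "z \<in> U"
  shows "pd i (pd j X) z = ch 1 i j z *\<^sub>R pd 1 X z + ch 2 i j z *\<^sub>R pd 2 X z
     - (pd i N z \<bullet> pd j X z) *\<^sub>R N z - g i j z *\<^sub>R X z"
proof -
  let ?v = "pd i (pd j X) z - (ch 1 i j z *\<^sub>R pd 1 X z + ch 2 i j z *\<^sub>R pd 2 X z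
     - (pd i N z \<bullet> pd j X z) *\<^sub>R N z - g i j z *\<^sub>R X z)"
  note fp = frame_products[OF z]
  have "?v \<bullet> pd 1 X z = 0 \<and> ?v \<bullet> pd 2 X z = 0"
    using gi_solve[OF z, of "pd i (pd j X) z \<bullet> pd 1 X z" "pd i (pd j X) z \<bullet> pd 2 X z"]
    unfolding ch_eq[OF z, symmetric]
    by (simp add: inner_diff_left inner_add_left fp g_def inner_commute[of "pd 2 X z" "pd 1 X z"])
  then have "?v \<bullet> pd l X z = 0" for l using exhaust_2[of l] by auto
  then have "?v = 0"
    by (intro frame_zero[OF z])
       (auto simp: inner_diff_left inner_add_left fp second_products[OF z] g_def)
  then show ?thesis by simp
qed

definition wg where "wg k i z = gi k 1 z * (pd i N z \<bullet> pd 1 X z) + gi k 2 z * (pd i N z \<bullet> pd 2 X z)"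

lemma weingarten:
  assumes z: "z \<in> U"
  shows "pd i N z = wg 1 i z *\<^sub>R pd 1 X z + wg 2 i z *\<^sub>R pd 2 X z"
proof -
  let ?v = "pd i N z - (wg 1 i z *\<^sub>R pd 1 X z + wg 2 i z *\<^sub>R pd 2 X z)"
  note fp = frame_products[OF z]
  have "?v \<bullet> pd 1 X z = 0 \<and> ?v \<bullet> pd 2 X z = 0"
    using gi_solve[OF z, of "pd i N z \<bullet> pd 1 X z" "pd i N z \<bullet> pd 2 X z"]
    unfolding wg_def[symmetric]
    by (simp add: inner_diff_left inner_add_left fp g_def inner_commute[of "pd 2 X z" "pd 1 X z"])
  then have "?v \<bullet> pd l X z = 0" for l using exhaust_2[of l] by auto
  then have "?v = 0"
    by (intro frame_zero[OF z]) (auto simp: inner_diff_left inner_add_left fp)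
  then show ?thesis by simp
qed

abbreviation H where "H \<equiv> mean_curvature f \<eta> F"

lemma mean_curvature_eq:
  assumes z: "z \<in> U"
  shows "H z = - (g 2 2 z * (pd 1 N z \<bullet> pd 1 X z) - 2 * g 1 2 z * (pd 1 N z \<bullet> pd 2 X z) + g 1 1 z * (pd 2 N z \<bullet> pd 2 X z)) / (2 * gdet z)"
proof -
  have h: "second_ff f \<eta> F z $ i $ j = - (pd i N z \<bullet> pd j X z)" for i j
    using second_products(1)[OF z, of i j] by (simp add: second_ff_def X_def N_def)
  have "H z = (gi 1 1 z * - (pd 1 N z \<bullet> pd 1 X z) + gi 1 2 z * - (pd 2 N z \<bullet> pd 1 X z)
     + gi 2 1 z * - (pd 1 N z \<bullet> pd 2 X z) + gi 2 2 z * - (pd 2 N z \<bullet> pd 2 X z)) / 2"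
    unfolding mean_curvature_def trace_def matrix_matrix_mult_def by (simp add: sum_2 h gi_def)
  also have "\<dots> = - (g 2 2 z * (pd 1 N z \<bullet> pd 1 X z) - 2 * g 1 2 z * (pd 1 N z \<bullet> pd 2 X z) + g 1 1 z * (pd 2 N z \<bullet> pd 2 X z)) / (2 * gdet z)"
    unfolding gi[OF z] second_products(3)[OF z, of 2 1] using g_pos(2)[OF z]
    by (simp add: divide_simps)
  finally show ?thesis .
qed

lemma smooth_b: "smooth_on (\<lambda>w. pd i N w \<bullet> pd j X w) U"
  by (rule smooth_on_inner[OF U smooth_pd(2) smooth_pd(1)])

lemma smooth_gdet: "smooth_on gdet U"
  unfolding gdet_def[abs_def] by (intro smooth_on_diff smooth_on_mult smooth_g U)

lemma smooth_H: "smooth_on H U"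
proof -
  let ?K = "\<lambda>z. (g 2 2 z * (pd 1 N z \<bullet> pd 1 X z) - 2 * (g 1 2 z * (pd 1 N z \<bullet> pd 2 X z)) + g 1 1 z * (pd 2 N z \<bullet> pd 2 X z))"
  have "smooth_on (\<lambda>z. - ?K z / (2 * gdet z)) U"
  proof (rule smooth_on_divide[OF U])
    show "smooth_on (\<lambda>z. - ?K z) U"
      by (intro smooth_on_uminus smooth_on_add smooth_on_diff smooth_on_mult smooth_on_const smooth_g smooth_b U)
    show "smooth_on (\<lambda>z. 2 * gdet z) U"
      by (intro smooth_on_mult smooth_on_const smooth_gdet U)
  qed (use g_pos(2) in force)
  then show ?thesis
    using smooth_on_cong[OF U, of H "\<lambda>z. - ?K z / (2 * gdet z)"] mean_curvature_eq by (simp add: mult.assoc)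
qed

lemma twice_gdet_H:
  assumes z: "z \<in> U"
  shows "2 * gdet z * H z = - (g 2 2 z * (pd 1 N z \<bullet> pd 1 X z) - 2 * g 1 2 z * (pd 1 N z \<bullet> pd 2 X z) + g 1 1 z * (pd 2 N z \<bullet> pd 2 X z))"
  using mean_curvature_eq[OF z] g_pos(2)[OF z] by (simp add: field_simps)

lemma twice_gdet_H_deriv:
  assumes z: "z \<in> U" and mk: "(m, k) = (1, 2) \<or> (m, k) = (2, 1)"
  shows "2 * pd l gdet z * H z + 2 * gdet z * pd l H z =
    - (pd l (g 2 2) z * (pd 1 N z \<bullet> pd 1 X z) + g 2 2 z * (pd l (pd 1 N) z \<bullet> pd 1 X z + pd 1 N z \<bullet> pd l (pd 1 X) z)
     - 2 * pd l (g 1 2) z * (pd m N z \<bullet> pd k X z) - 2 * g 1 2 z * (pd l (pd m N) z \<bullet> pd k X z + pd m N z \<bullet> pd l (pd k X) z)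
     + pd l (g 1 1) z * (pd 2 N z \<bullet> pd 2 X z) + g 1 1 z * (pd l (pd 2 N) z \<bullet> pd 2 X z + pd 2 N z \<bullet> pd l (pd 2 X) z))"
proof -
  let ?b = "\<lambda>i j w. pd i N w \<bullet> pd j X w"
  have eq: "gdet w * H w + gdet w * H w + (g 2 2 w * ?b 1 1 w - (g 1 2 w * ?b m k w + g 1 2 w * ?b m k w) + g 1 1 w * ?b 2 2 w) = 0"
    if "w \<in> U" for w
    using twice_gdet_H[OF that] mk second_products(3)[OF that, of 1 2] by auto
  have sm: "smooth_on (\<lambda>w. gdet w * H w + gdet w * H w + (g 2 2 w * ?b 1 1 w - (g 1 2 w * ?b m k w + g 1 2 w * ?b m k w) + g 1 1 w * ?b 2 2 w)) U"
    by (intro smooth_on_add smooth_on_diff smooth_on_mult smooth_g smooth_b smooth_gdet smooth_H U)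
  have db: "pd l (?b i j) z = pd i N z \<bullet> pd l (pd j X) z + pd l (pd i N) z \<bullet> pd j X z" for i j
    by (rule pd_inner[OF U smooth_pd(2) smooth_pd(1) z])
  have "pd l (\<lambda>w. gdet w * H w + gdet w * H w + (g 2 2 w * ?b 1 1 w - (g 1 2 w * ?b m k w + g 1 2 w * ?b m k w) + g 1 1 w * ?b 2 2 w)) z = 0"
    using pd_cong[OF U z eq sm, of l] by simp
  moreover have "pd l (\<lambda>w. gdet w * H w + gdet w * H w + (g 2 2 w * ?b 1 1 w - (g 1 2 w * ?b m k w + g 1 2 w * ?b m k w) + g 1 1 w * ?b 2 2 w)) z
    = 2 * (gdet z * pd l H z + pd l gdet z * H z) + (g 2 2 z * pd l (?b 1 1) z + pd l (g 2 2) z * ?b 1 1 z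
      - 2 * (g 1 2 z * pd l (?b m k) z + pd l (g 1 2) z * ?b m k z) + (g 1 1 z * pd l (?b 2 2) z + pd l (g 1 1) z * ?b 2 2 z))"
    by (simp only: pd_add[OF U _ _ z] pd_diff[OF U _ _ z] pd_mult[OF U _ _ z] smooth_on_add[OF U] smooth_on_diff[OF U]
        smooth_on_mult[OF U] smooth_g smooth_b smooth_gdet smooth_H) simp
  ultimately show ?thesis unfolding db by (simp add: algebra_simps)
qed

lemma pd_g: "z \<in> U \<Longrightarrow> pd l (g i j) z = pd l (pd i X) z \<bullet> pd j X z + pd l (pd j X) z \<bullet> pd i X z"
  unfolding g_def[abs_def] using pd_inner[OF U smooth_pd(1) smooth_pd(1), of z l i j] by (simp add: inner_commute)

lemma pd_gdet:
  assumes z: "z \<in> U"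
  shows "pd l gdet z = pd l (g 1 1) z * g 2 2 z + g 1 1 z * pd l (g 2 2) z - 2 * g 1 2 z * pd l (g 1 2) z"
proof -
  have "pd l gdet z = pd l (\<lambda>z. g 1 1 z * g 2 2 z - g 1 2 z * g 1 2 z) z" by (simp add: gdet_def[abs_def])
  also have "\<dots> = (g 1 1 z * pd l (g 2 2) z + pd l (g 1 1) z * g 2 2 z) - (g 1 2 z * pd l (g 1 2) z + pd l (g 1 2) z * g 1 2 z)"
    by (simp add: pd_diff[OF U _ _ z] pd_mult[OF U _ _ z] smooth_on_mult smooth_g U)
  finally show ?thesis by (simp add: algebra_simps)
qed

text \<open>Differentiating the symmetry of the second fundamental form.\<close>

lemma codazzi:
  assumes z: "z \<in> U"
  shows "pd l (pd j N) z \<bullet> pd i X z - pd l (pd i N) z \<bullet> pd j X z = pd i N z \<bullet> pd l (pd j X) z - pd j N z \<bullet> pd l (pd i X) z"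
proof -
  have "pd l (\<lambda>w. pd j N w \<bullet> pd i X w) z = pd l (\<lambda>w. pd i N w \<bullet> pd j X w) z"
    by (rule pd_cong[OF U z second_products(3) smooth_b])
  then show ?thesis unfolding pd_inner[OF U smooth_pd(2) smooth_pd(1) z] by simp
qed

text \<open>Covariant Hessian of the normal.\<close>

definition hessN where
  "hessN i j z = pd i (pd j N) z - (ch 1 i j z *\<^sub>R pd 1 N z + ch 2 i j z *\<^sub>R pd 2 N z)"

lemma gdet_weingarten:
  assumes z: "z \<in> U"
  shows "gdet z * (pd i N z \<bullet> v) =
    (g 2 2 z * (pd i N z \<bullet> pd 1 X z) - g 1 2 z * (pd i N z \<bullet> pd 2 X z)) * (v \<bullet> pd 1 X z)
    + (g 1 1 z * (pd i N z \<bullet> pd 2 X z) - g 1 2 z * (pd i N z \<bullet> pd 1 X z)) * (v \<bullet> pd 2 X z)"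
proof -
  have D: "gdet z \<noteq> 0" using g_pos(2)[OF z] by simp
  have "pd i N z \<bullet> v = wg 1 i z * (v \<bullet> pd 1 X z) + wg 2 i z * (v \<bullet> pd 2 X z)"
    by (subst weingarten[OF z]) (simp add: inner_add_left inner_commute[of v])
  moreover have "gdet z * wg 1 i z = g 2 2 z * (pd i N z \<bullet> pd 1 X z) - g 1 2 z * (pd i N z \<bullet> pd 2 X z)"
    "gdet z * wg 2 i z = g 1 1 z * (pd i N z \<bullet> pd 2 X z) - g 1 2 z * (pd i N z \<bullet> pd 1 X z)"
    unfolding wg_def gi[OF z] using D by (simp_all add: field_simps)
  ultimately show ?thesis by (metis (no_types, opaque_lifting) distrib_left mult.assoc)
qed

lemma gdet_ch:
  assumes z: "z \<in> U"
  shows "gdet z * ch 1 i j z = g 2 2 z * (pd i (pd j X) z \<bullet> pd 1 X z) - g 1 2 z * (pd i (pd j X) z \<bullet> pd 2 X z)"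
    "gdet z * ch 2 i j z = g 1 1 z * (pd i (pd j X) z \<bullet> pd 2 X z) - g 1 2 z * (pd i (pd j X) z \<bullet> pd 1 X z)"
  unfolding ch_eq[OF z] gi[OF z] using g_pos(2)[OF z] by (simp_all add: field_simps)

text \<open>The trace of the Hessian of the normal has tangential part \<open>- 2 grad H\<close>, here multiplied by the determinant of
  the metric.\<close>

lemma traced_codazzi:
  assumes z: "z \<in> U"
  shows "g 2 2 z * (hessN 1 1 z \<bullet> pd l X z) - 2 * g 1 2 z * (hessN 1 2 z \<bullet> pd l X z) + g 1 1 z * (hessN 2 2 z \<bullet> pd l X z)
    = - 2 * gdet z * pd l H z"
proof -
  have D: "gdet z \<noteq> 0" using g_pos(2)[OF z] by simp
  have D': "gdet z = g 2 2 z * g 1 1 z - g 1 2 z * g 1 2 z" by (simp add: gdet_def mult.commute)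
  note w = gdet_weingarten[OF z]
  note b = second_products(3)[OF z, of 2 1]
  note s21 = pd_sym[OF z, of 2 1]
  have 1: ?thesis if l: "l = 1"
    unfolding l
    using traced_codazzi_algebra[OF gdet_def D w[of 1 "pd 1 (pd 1 X) z", unfolded b] w[of 1 "pd 1 (pd 2 X) z", unfolded b]
        w[of 1 "pd 2 (pd 2 X) z", unfolded b] w[of 2 "pd 1 (pd 1 X) z", unfolded b] w[of 2 "pd 1 (pd 2 X) z", unfolded b]
        codazzi[OF z, of 1 2 1] codazzi[OF z, of 2 2 1, unfolded s21]
        twice_gdet_H[OF z] _ gdet_ch[OF z, of 1 1] gdet_ch[OF z, of 1 2] gdet_ch[OF z, of 2 2], of "pd 1 H z" "pd 1 (pd 1 N) z \<bullet> pd 1 X z"]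
      twice_gdet_H_deriv[OF z, of 1 2, unfolded pd_gdet[OF z] pd_g[OF z]]
    unfolding hessN_def by (simp add: inner_diff_left inner_add_left algebra_simps b)
  have 2: ?thesis if l: "l = 2"
  proof -
    have "g 1 1 z * (pd 2 (pd 2 N) z \<bullet> pd 2 X z - (ch 2 2 2 z * (pd 2 N z \<bullet> pd 2 X z) + ch 1 2 2 z * (pd 1 N z \<bullet> pd 2 X z)))
      - 2 * g 1 2 z * (pd 1 (pd 2 N) z \<bullet> pd 2 X z - (ch 2 1 2 z * (pd 2 N z \<bullet> pd 2 X z) + ch 1 1 2 z * (pd 1 N z \<bullet> pd 2 X z)))
      + g 2 2 z * (pd 1 (pd 1 N) z \<bullet> pd 2 X z - (ch 2 1 1 z * (pd 2 N z \<bullet> pd 2 X z) + ch 1 1 1 z * (pd 1 N z \<bullet> pd 2 X z)))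
      = - 2 * gdet z * pd 2 H z"
    proof (rule traced_codazzi_algebra[OF D' D, where ?b22.0 = "pd 1 N z \<bullet> pd 1 X z" and H = "H z"
          and ?a111.0 = "pd 2 (pd 2 X) z \<bullet> pd 2 X z" and ?a112.0 = "pd 2 (pd 2 X) z \<bullet> pd 1 X z"
          and ?a121.0 = "pd 1 (pd 2 X) z \<bullet> pd 2 X z" and ?a122.0 = "pd 1 (pd 2 X) z \<bullet> pd 1 X z"
          and ?a221.0 = "pd 1 (pd 1 X) z \<bullet> pd 2 X z" and ?a222.0 = "pd 1 (pd 1 X) z \<bullet> pd 1 X z"
          and ?s111.0 = "pd 2 N z \<bullet> pd 2 (pd 2 X) z" and ?s112.0 = "pd 2 N z \<bullet> pd 1 (pd 2 X) z"
          and ?s122.0 = "pd 2 N z \<bullet> pd 1 (pd 1 X) z" and ?s211.0 = "pd 1 N z \<bullet> pd 2 (pd 2 X) z"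
          and ?s212.0 = "pd 1 N z \<bullet> pd 1 (pd 2 X) z"
          and ?t112.0 = "pd 2 (pd 2 N) z \<bullet> pd 1 X z" and ?t122.0 = "pd 1 (pd 2 N) z \<bullet> pd 1 X z"])
      show "2 * (2 * (pd 2 (pd 2 X) z \<bullet> pd 2 X z) * g 1 1 z + 2 * g 2 2 z * (pd 1 (pd 2 X) z \<bullet> pd 1 X z)
          - 2 * g 1 2 z * (pd 2 (pd 2 X) z \<bullet> pd 1 X z + pd 1 (pd 2 X) z \<bullet> pd 2 X z)) * H z + 2 * gdet z * pd 2 H z =
        - (2 * (pd 1 (pd 2 X) z \<bullet> pd 1 X z) * (pd 2 N z \<bullet> pd 2 X z)
          + g 1 1 z * (pd 2 (pd 2 N) z \<bullet> pd 2 X z + pd 2 N z \<bullet> pd 2 (pd 2 X) z)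
          - 2 * (pd 2 (pd 2 X) z \<bullet> pd 1 X z + pd 1 (pd 2 X) z \<bullet> pd 2 X z) * (pd 1 N z \<bullet> pd 2 X z)
          - 2 * g 1 2 z * (pd 2 (pd 2 N) z \<bullet> pd 1 X z + pd 2 N z \<bullet> pd 1 (pd 2 X) z)
          + 2 * (pd 2 (pd 2 X) z \<bullet> pd 2 X z) * (pd 1 N z \<bullet> pd 1 X z)
          + g 2 2 z * (pd 1 (pd 2 N) z \<bullet> pd 1 X z + pd 1 N z \<bullet> pd 1 (pd 2 X) z))"
        using twice_gdet_H_deriv[OF z, of 2 1 2, unfolded pd_gdet[OF z] pd_g[OF z] s21 b]
        by (simp add: algebra_simps)
    qed (use w[of 2 "pd 2 (pd 2 X) z", unfolded b] w[of 2 "pd 1 (pd 2 X) z", unfolded b]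
        w[of 2 "pd 1 (pd 1 X) z", unfolded b] w[of 1 "pd 2 (pd 2 X) z", unfolded b] w[of 1 "pd 1 (pd 2 X) z", unfolded b]
        b twice_gdet_H[OF z] codazzi[OF z, of 2 1 2, unfolded s21] codazzi[OF z, of 1 1 2] gdet_ch[OF z]
        in \<open>simp_all add: algebra_simps\<close>)
    then show ?thesis unfolding l hessN_def
      by (simp add: inner_diff_left inner_add_left algebra_simps b)
  qed
  show ?thesis using 1 2 exhaust_2[of l] by blast
qed

subsection \<open>The tension field of the Gauss map\<close>

definition gm where "gm w = wedge (N w) (X w)"

lemma gauss_map_eq: "w \<in> U \<Longrightarrow> gauss_map f \<eta> (F w) = gm w"
  using unit[of w] unfolding gauss_map_def gm_def N_def X_def o_def by (intro Gamma_eq_wedge) auto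

lemma smooth_gm: "smooth_on gm U"
  unfolding gm_def[abs_def] by (rule smooth_on_bilinear[OF U bounded_bilinear_wedge smooth_N smooth_X])

lemma pd_gm: "w \<in> U \<Longrightarrow> pd j gm w = wedge (N w) (pd j X w) + wedge (pd j N w) (X w)"
  unfolding gm_def[abs_def] by (rule pd_bilinear[OF bounded_bilinear_wedge U smooth_N smooth_X])

lemma pd_pd_gm:
  assumes z: "z \<in> U"
  shows "pd i (pd j gm) z = wedge (N z) (pd i (pd j X) z) + wedge (pd i N z) (pd j X z)
    + (wedge (pd j N z) (pd i X z) + wedge (pd i (pd j N) z) (X z))"
proof -
  note bl = smooth_on_bilinear[OF U bounded_bilinear_wedge] pd_bilinear[OF bounded_bilinear_wedge U _ _ z]
  have "pd i (pd j gm) z = pd i (\<lambda>w. wedge (N w) (pd j X w) + wedge (pd j N w) (X w)) z"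
    by (rule pd_cong[OF U z pd_gm smooth_on_pd[OF smooth_gm]])
  also have "\<dots> = pd i (\<lambda>w. wedge (N w) (pd j X w)) z + pd i (\<lambda>w. wedge (pd j N w) (X w)) z"
    by (rule pd_add[OF U bl(1)[OF smooth_N smooth_pd(1)] bl(1)[OF smooth_pd(2) smooth_X] z])
  finally show ?thesis
    unfolding bl(2)[OF smooth_N smooth_pd(1)] bl(2)[OF smooth_pd(2) smooth_X] by simp
qed

lemma gauss_map_comp:
  assumes z: "z \<in> U"
  shows "pd j (gauss_map f \<eta> \<circ> F) z = pd j gm z" "pd i (pd j (gauss_map f \<eta> \<circ> F)) z = pd i (pd j gm) z"
proof -
  have sm: "smooth_on (gauss_map f \<eta> \<circ> F) U"
    using smooth_on_cong[OF U, of "gauss_map f \<eta> \<circ> F" gm] gauss_map_eq smooth_gm by simp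
  have 1: "pd j (gauss_map f \<eta> \<circ> F) w = pd j gm w" if "w \<in> U" for w
    by (rule pd_cong[OF U that _ sm]) (simp add: gauss_map_eq)
  then show "pd j (gauss_map f \<eta> \<circ> F) z = pd j gm z" using z .
  show "pd i (pd j (gauss_map f \<eta> \<circ> F)) z = pd i (pd j gm) z"
    by (rule pd_cong[OF U z 1 smooth_on_pd[OF sm]])
qed

text \<open>The multiples of \<open>N\<close> collect the terms of the Hessian of \<open>N \<and> X\<close> that are proportional to \<open>N \<and> X\<close>.\<close>

definition tvec where
  "tvec z = (\<Sum>i\<in>UNIV. \<Sum>j\<in>UNIV. gi i j z *\<^sub>R
     (hessN i j z - (g i j z + lie_inner (pd i (pd j gm) z) (gm z)) *\<^sub>R N z))"

text \<open>By the Weingarten formula this is the product of a symmetric matrix (the second fundamental form with both indices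
  raised) and the antisymmetric matrix of the \<open>X\<^sub>i \<and> X\<^sub>j\<close>.\<close>

lemma cross_terms_vanish:
  assumes z: "z \<in> U"
  shows "(\<Sum>i\<in>UNIV. \<Sum>j\<in>UNIV. gi i j z *\<^sub>R (wedge (pd i N z) (pd j X z) + wedge (pd j N z) (pd i X z))) = 0"
proof -
  have sw: "wedge (pd 2 X z) (pd 1 X z) = - wedge (pd 1 X z) (pd 2 X z)" by (rule wedge_swap)
  have W: "wedge (pd i N z) (pd 1 X z) = - wg 2 i z *\<^sub>R wedge (pd 1 X z) (pd 2 X z)"
    "wedge (pd i N z) (pd 2 X z) = wg 1 i z *\<^sub>R wedge (pd 1 X z) (pd 2 X z)" for i
    by (subst weingarten[OF z], simp add: wedge.add_left wedge.scaleR_left sw)+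
  have b: "pd 2 N z \<bullet> pd 1 X z = pd 1 N z \<bullet> pd 2 X z" by (rule second_products(3)[OF z])
  have g21: "gi 2 1 z = gi 1 2 z" unfolding gi[OF z] ..
  have "- (gi 1 1 z * wg 2 1 z) + gi 1 2 z * (wg 1 1 z - wg 2 2 z) + gi 2 2 z * wg 1 2 z = 0"
    unfolding wg_def b g21 by (simp add: algebra_simps)
  then have "(2 * (- (gi 1 1 z * wg 2 1 z) + gi 1 2 z * (wg 1 1 z - wg 2 2 z) + gi 2 2 z * wg 1 2 z)) *\<^sub>R wedge (pd 1 X z) (pd 2 X z) = 0"
    by simp
  moreover have "(\<Sum>i\<in>UNIV. \<Sum>j\<in>UNIV. gi i j z *\<^sub>R (wedge (pd i N z) (pd j X z) + wedge (pd j N z) (pd i X z))) =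
    (2 * (- (gi 1 1 z * wg 2 1 z) + gi 1 2 z * (wg 1 1 z - wg 2 2 z) + gi 2 2 z * wg 1 2 z)) *\<^sub>R wedge (pd 1 X z) (pd 2 X z)"
    unfolding sum_2 W g21 scaleR_left_distrib[symmetric] scaleR_scaleR
    by (rule arg_cong[where f = "\<lambda>t. t *\<^sub>R wedge (pd 1 X z) (pd 2 X z)"]) (simp add: algebra_simps)
  ultimately show ?thesis by simp
qed

lemma tension_eq_wedge:
  assumes z: "z \<in> U"
  shows "tension f (gauss_map f \<eta>) F z = wedge (tvec z) (X z)"
proof -
  have tm: "sphere_tangential (gm z) (pd i (pd j gm) z) - (\<Sum>k\<in>UNIV. ch k i j z *\<^sub>R pd k gm z)
     = wedge (hessN i j z - (g i j z + lie_inner (pd i (pd j gm) z) (gm z)) *\<^sub>R N z) (X z)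
       + (wedge (pd i N z) (pd j X z) + wedge (pd j N z) (pd i X z))" for i j
  proof -
    have "wedge (N z) (pd i (pd j X) z) = ch 1 i j z *\<^sub>R wedge (N z) (pd 1 X z) + ch 2 i j z *\<^sub>R wedge (N z) (pd 2 X z) - g i j z *\<^sub>R wedge (N z) (X z)"
      by (subst gauss_formula[OF z]) (simp add: wedge.diff_right wedge.add_right wedge.scaleR_right)
    then show ?thesis
      unfolding sphere_tangential_def sum_2 pd_gm[OF z] gm_def[of z] hessN_def
      by (subst (1) pd_pd_gm[OF z])
         (simp add: wedge.diff_left wedge.add_left wedge.scaleR_left algebra_simps)
  qed
  have "tension f (gauss_map f \<eta>) F z = (\<Sum>i\<in>UNIV. \<Sum>j\<in>UNIV. gi i j z *\<^sub>R
     (sphere_tangential (gm z) (pd i (pd j gm) z) - (\<Sum>k\<in>UNIV. ch k i j z *\<^sub>R pd k gm z)))"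
    unfolding tension_def gauss_map_comp[OF z] gauss_map_eq[OF z] gi_def ch_def ..
  also have "\<dots> = wedge (tvec z) (X z) + (\<Sum>i\<in>UNIV. \<Sum>j\<in>UNIV. gi i j z *\<^sub>R (wedge (pd i N z) (pd j X z) + wedge (pd j N z) (pd i X z)))"
    unfolding tm tvec_def by (simp only: wedge.sum_left wedge.scaleR_left scaleR_right_distrib sum.distrib)
  finally show ?thesis unfolding cross_terms_vanish[OF z] by simp
qed

text \<open>The tension field of a map into the sphere is orthogonal to the map; this determines the normal part of
  \<^const>\<open>tvec\<close> without a computation of second derivatives.\<close>

lemma tvec_normal:
  assumes z: "z \<in> U"
  shows "tvec z \<bullet> N z = 0"
proof -
  note fp = frame_products[OF z]
  have gg: "lie_inner (gm z) (gm z) = 1" by (simp add: gm_def lie_inner_wedge fp)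
  have gk: "lie_inner (pd k gm z) (gm z) = 0" for k
    by (simp add: pd_gm[OF z] gm_def lie_inner.add_left lie_inner_wedge fp)
  have "lie_inner (tension f (gauss_map f \<eta>) F z) (gm z) = 0"
    unfolding tension_def gauss_map_comp[OF z] gauss_map_eq[OF z] sphere_tangential_def
    by (simp add: lie_inner.sum_left lie_inner.scaleR_left lie_inner.diff_left gg gk)
  moreover have "lie_inner (wedge (tvec z) (X z)) (gm z) = tvec z \<bullet> N z"
    by (simp add: gm_def lie_inner_wedge fp)
  ultimately show ?thesis unfolding tension_eq_wedge[OF z] by simp
qed

lemma tvec_tangent:
  assumes z: "z \<in> U"
  shows "tvec z \<bullet> pd l X z = - 2 * pd l H z"
proof -
  note fp = frame_products[OF z]
  have D: "gdet z \<noteq> 0" using g_pos(2)[OF z] by simp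
  have h21: "hessN 2 1 z = hessN 1 2 z"
    unfolding hessN_def ch_eq[OF z] using pd_sym[OF z, of 2 1] by simp
  have "tvec z \<bullet> pd l X z = (\<Sum>i\<in>UNIV. \<Sum>j\<in>UNIV. gi i j z * (hessN i j z \<bullet> pd l X z))"
    unfolding tvec_def by (simp add: inner_sum_left inner_diff_left fp)
  also have "\<dots> = (g 2 2 z * (hessN 1 1 z \<bullet> pd l X z) - 2 * g 1 2 z * (hessN 1 2 z \<bullet> pd l X z) + g 1 1 z * (hessN 2 2 z \<bullet> pd l X z)) / gdet z"
    unfolding sum_2 h21 gi[OF z] using D by (simp add: field_simps)
  also have "\<dots> = - 2 * pd l H z"
    unfolding traced_codazzi[OF z] using D by simp
  finally show ?thesis .
qed

text \<open>\<open>V \<and> X = 0\<close> means that \<open>V\<close> is parallel to \<open>X\<close>; the remaining components of \<open>V\<close> are 0 and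
  \<open>- 2 dH\<close>.\<close>

theorem tension_zero_iff:
  assumes z: "z \<in> U"
  shows "tension f (gauss_map f \<eta>) F z = 0 \<longleftrightarrow> (\<forall>l. pd l H z = 0)"
proof
  note fp = frame_products[OF z]
  assume T: "tension f (gauss_map f \<eta>) F z = 0"
  show "\<forall>l. pd l H z = 0"
  proof
    fix l
    have "lie_inner (wedge (tvec z) (X z)) (wedge (pd l X z) (X z)) = 0"
      using T unfolding tension_eq_wedge[OF z] by (simp add: lie_inner.zero_left)
    then have "tvec z \<bullet> pd l X z = 0" by (simp add: lie_inner_wedge fp)
    then show "pd l H z = 0" unfolding tvec_tangent[OF z] by simp
  qed
next
  note fp = frame_products[OF z]
  assume H0: "\<forall>l. pd l H z = 0"
  have "tvec z - (tvec z \<bullet> X z) *\<^sub>R X z = 0"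
    by (rule frame_zero[OF z]) (use H0 in \<open>simp_all add: inner_diff_left fp tvec_normal[OF z] tvec_tangent[OF z]\<close>)
  then have "tvec z = (tvec z \<bullet> X z) *\<^sub>R X z" by simp
  then have "wedge (tvec z) (X z) = wedge ((tvec z \<bullet> X z) *\<^sub>R X z) (X z)" by metis
  then show "tension f (gauss_map f \<eta>) F z = 0"
    unfolding tension_eq_wedge[OF z] by (simp add: wedge.scaleR_left)
qed

subsection \<open>The quadratic form in a conformal parametrization\<close>

lemma lie_inner_gauss_pd:
  assumes z: "z \<in> U"
  shows "lie_inner (pd k gm z) (wedge (pd l X z) (X z)) = pd k N z \<bullet> pd l X z"
  by (simp add: pd_gm[OF z] lie_inner.add_left lie_inner_wedge frame_products[OF z])

lemma quadratic_form_eq: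
  assumes z: "z \<in> U"
  shows "quadratic_form f (gauss_map f \<eta>) F z =
    Complex ((pd 1 N z \<bullet> pd 1 X z - pd 2 N z \<bullet> pd 2 X z) / 4) (- (pd 1 N z \<bullet> pd 2 X z) / 2)"
proof -
  define P where "P k = pd k gm z" for k
  define w where "w k = wedge (pd k X z) (X z)" for k
  define W where "W = wirtinger_vec (f \<circ> F) z"
  have re: "(\<chi> k. Re (W $ k)) = (1/2) *\<^sub>R pd 1 X z" and im: "(\<chi> k. Im (W $ k)) = (-1/2) *\<^sub>R pd 2 X z"
    by (simp_all add: W_def wirtinger_vec_def vec_eq_iff X_def)
  have un: "norm (f (F z)) = 1" "f (F z) = X z" using unit[OF z] by (auto simp: X_def)
  have "Gamma (f (F z)) (c *\<^sub>R pd k X z) = c *\<^sub>R w k" for c k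
    by (subst Gamma_eq_wedge[OF un(1)]) (simp_all add: frame_products(8)[OF z] w_def wedge.scaleR_left un(2))
  note G = this[of "1/2" 1] this[of "-1/2" 2]
  have cG: "complex_Gamma (f (F z)) W $ i $ j = (complex_of_real (w 1 $ i $ j) - \<i> * complex_of_real (w 2 $ i $ j)) / 2" for i j
    unfolding complex_Gamma_def re im G by (simp add: complex_eq_iff)
  have wm: "wirtinger_mat (gauss_map f \<eta> \<circ> F) z $ i $ j = (complex_of_real (P 1 $ i $ j) - \<i> * complex_of_real (P 2 $ i $ j)) / 2" for i j
    unfolding wirtinger_mat_def P_def gauss_map_comp(1)[OF z] by simp
  define L where "L k l = lie_inner (P k) (w l)" for k l
  have L: "L k l = (\<Sum>i\<in>UNIV. \<Sum>j\<in>UNIV. P k $ i $ j * w l $ i $ j) / 2" for k l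
    unfolding L_def lie_inner_eq_sum ..
  have "quadratic_form f (gauss_map f \<eta>) F z =
    (\<Sum>i\<in>UNIV. \<Sum>j\<in>UNIV. (complex_of_real (P 1 $ i $ j) - \<i> * complex_of_real (P 2 $ i $ j)) / 2 *
       ((complex_of_real (w 1 $ i $ j) - \<i> * complex_of_real (w 2 $ i $ j)) / 2)) / 2"
    unfolding quadratic_form_def W_def[symmetric]
    by (simp add: lie_inner_def trace_def matrix_matrix_mult_def transpose_def wm cG)
  also have "\<dots> = Complex ((L 1 1 - L 2 2) / 4) (- (L 1 2 + L 2 1) / 4)"
    unfolding L complex_eq_iff
    by (simp add: Re_sum Im_sum sum_divide_distrib[symmetric] sum_subtractf sum.distrib sum_negf algebra_simps add_divide_distrib diff_divide_distrib)
  also have "\<dots> = Complex ((pd 1 N z \<bullet> pd 1 X z - pd 2 N z \<bullet> pd 2 X z) / 4) (- (pd 1 N z \<bullet> pd 2 X z) / 2)"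
    unfolding L_def P_def w_def lie_inner_gauss_pd[OF z] second_products(3)[OF z, of 2 1] by simp
  finally show ?thesis .
qed

text \<open>The real and imaginary part of the \<open>\<partial>\<close>-bar derivative of \<open>8 \<langle>N\<^sub>z, X\<^sub>z\<rangle>\<close>. The derivatives of
  the second fundamental form cancel against those of \<open>- 2 E H\<close>, its trace, where \<open>E\<close> is the conformal factor.\<close>

lemma conformal_hopf_derivatives:
  assumes conf: "\<And>w. w \<in> U \<Longrightarrow> g 1 1 w = g 2 2 w" "\<And>w. w \<in> U \<Longrightarrow> g 1 2 w = 0" and z: "z \<in> U"
  defines "b \<equiv> \<lambda>i j w. pd i N w \<bullet> pd j X w"
  shows "pd 1 (b 1 1) z - pd 1 (b 2 2) z + 2 * pd 2 (b 1 2) z = - 2 * g 1 1 z * pd 1 H z"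
    "pd 2 (b 1 1) z - pd 2 (b 2 2) z - 2 * pd 1 (b 1 2) z = 2 * g 1 1 z * pd 2 H z"
proof -
  define E where "E = g 1 1"
  have E0: "E z > 0" using g_pos(1)[OF z] by (simp add: E_def)
  have smE: "smooth_on E U" unfolding E_def by (rule smooth_g)
  have smb: "smooth_on (b i j) U" for i j unfolding b_def by (rule smooth_b)
  have bsym: "b 2 1 w = b 1 2 w" if "w \<in> U" for w unfolding b_def by (rule second_products(3)[OF that])
  have EH: "E w * H w + E w * H w + (b 1 1 w + b 2 2 w) = 0" if "w \<in> U" for w
  proof -
    have "E w > 0" using g_pos(1)[OF that] by (simp add: E_def)
    moreover have "2 * (E w * E w) * H w = - (E w * (b 1 1 w + b 2 2 w))"
      using twice_gdet_H[OF that] conf[OF that] by (simp add: gdet_def E_def b_def algebra_simps)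
    then have "E w * (E w * H w + E w * H w + (b 1 1 w + b 2 2 w)) = 0" by (simp add: algebra_simps)
    ultimately show ?thesis by simp
  qed
  have dEH: "2 * (E z * pd l H z + pd l E z * H z) + (pd l (b 1 1) z + pd l (b 2 2) z) = 0" for l
  proof -
    have "pd l (\<lambda>w. E w * H w + E w * H w + (b 1 1 w + b 2 2 w)) z = 0"
    proof (subst pd_cong[OF U z EH])
      show "smooth_on (\<lambda>w. E w * H w + E w * H w + (b 1 1 w + b 2 2 w)) U"
        by (intro smooth_on_add smooth_on_mult smE smooth_H smb U)
    qed simp_all
    then show ?thesis
      by (simp only: pd_add[OF U _ _ z] pd_mult[OF U _ _ z] smooth_on_add[OF U] smooth_on_mult[OF U] smE smooth_H smb) simp
  qed
  have db: "pd l (b i j) z = pd i N z \<bullet> pd l (pd j X) z + pd l (pd i N) z \<bullet> pd j X z" for l i j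
    unfolding b_def by (rule pd_inner[OF U smooth_pd(2) smooth_pd(1) z])
  have d22: "pd l E z = 2 * (pd l (pd 2 X) z \<bullet> pd 2 X z)" for l
    using pd_cong[OF U z conf(1) smooth_g, of l] pd_g[OF z, of l 2 2] by (simp add: E_def)
  have d11: "pd l E z = 2 * (pd l (pd 1 X) z \<bullet> pd 1 X z)" for l
    using pd_g[OF z, of l 1 1] by (simp add: E_def)
  have d12: "pd l (pd 1 X) z \<bullet> pd 2 X z = - (pd l (pd 2 X) z \<bullet> pd 1 X z)" for l
    using pd_cong[OF U z conf(2) smooth_g, of l] pd_g[OF z, of l 1 2] by simp
  note s21 = pd_sym[OF z, of 2 1]
  have X: "pd 2 (pd 2 X) z \<bullet> pd 2 X z = pd 2 E z / 2" "pd 1 (pd 2 X) z \<bullet> pd 2 X z = pd 1 E z / 2"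
    "pd 1 (pd 1 X) z \<bullet> pd 1 X z = pd 1 E z / 2" "pd 1 (pd 2 X) z \<bullet> pd 1 X z = pd 2 E z / 2"
    "pd 2 (pd 2 X) z \<bullet> pd 1 X z = - pd 1 E z / 2" "pd 1 (pd 1 X) z \<bullet> pd 2 X z = - pd 2 E z / 2"
    using d22[of 2] d22[of 1] d11[of 1] d11[of 2] d12[of 2] d12[of 1] unfolding s21 by simp_all
  have wein: "E z * (pd i N z \<bullet> v) = b i 1 z * (v \<bullet> pd 1 X z) + b i 2 z * (v \<bullet> pd 2 X z)" for i v
  proof -
    have "E z * (E z * (pd i N z \<bullet> v)) = E z * (b i 1 z * (v \<bullet> pd 1 X z) + b i 2 z * (v \<bullet> pd 2 X z))"
      using gdet_weingarten[OF z, of i v] conf[OF z] by (simp add: gdet_def E_def b_def algebra_simps)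
    then show ?thesis using E0 by simp
  qed
  have sum_b: "b 1 1 z + b 2 2 z = - 2 * (E z * H z)" using EH[OF z] by simp
  have k1: "pd 1 N z \<bullet> pd 2 (pd 2 X) z - pd 2 N z \<bullet> pd 1 (pd 2 X) z = pd 1 E z * H z"
  proof -
    have "E z * (pd 1 N z \<bullet> pd 2 (pd 2 X) z - pd 2 N z \<bullet> pd 1 (pd 2 X) z) = - (pd 1 E z / 2) * (b 1 1 z + b 2 2 z)"
      unfolding right_diff_distrib wein X bsym[OF z] by (simp add: algebra_simps)
    also have "\<dots> = E z * (pd 1 E z * H z)" unfolding sum_b by simp
    finally show ?thesis using E0 by simp
  qed
  have k2: "pd 1 N z \<bullet> pd 1 (pd 2 X) z - pd 2 N z \<bullet> pd 1 (pd 1 X) z = - (pd 2 E z * H z)"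
  proof -
    have "E z * (pd 1 N z \<bullet> pd 1 (pd 2 X) z - pd 2 N z \<bullet> pd 1 (pd 1 X) z) = (pd 2 E z / 2) * (b 1 1 z + b 2 2 z)"
      unfolding right_diff_distrib wein X bsym[OF z] by (simp add: algebra_simps)
    also have "\<dots> = E z * - (pd 2 E z * H z)" unfolding sum_b by simp
    finally show ?thesis by (rule mult_left_cancel[THEN iffD1, rotated]) (use E0 in simp)
  qed
  have b12: "pd 1 (b 1 2) z = pd 1 (b 2 1) z"
    by (rule pd_cong[OF U z _ smb]) (simp add: bsym)
  show "pd 1 (b 1 1) z - pd 1 (b 2 2) z + 2 * pd 2 (b 1 2) z = - 2 * g 1 1 z * pd 1 H z"
    using dEH[of 1] k1 unfolding db s21 E_def[symmetric] by simp
  show "pd 2 (b 1 1) z - pd 2 (b 2 2) z - 2 * pd 1 (b 1 2) z = 2 * g 1 1 z * pd 2 H z"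
    using dEH[of 2] k2 unfolding b12 unfolding db s21 E_def[symmetric] by simp
qed

end

lemma holomorphic_on_iff_pd:
  fixes Q :: "complex \<Rightarrow> complex"
  assumes "open U" "smooth_on Q U"
  shows "Q holomorphic_on U \<longleftrightarrow> (\<forall>z\<in>U. pd 2 Q z = \<i> * pd 1 Q z)"
proof -
  have "Q field_differentiable (at z) \<longleftrightarrow> pd 2 Q z = \<i> * pd 1 Q z" if z: "z \<in> U" for z
  proof
    assume "Q field_differentiable (at z)"
    then obtain d where "(Q has_derivative (*) d) (at z)"
      by (auto simp: field_differentiable_def has_field_derivative_def)
    from pd_eqI[OF this] show "pd 2 Q z = \<i> * pd 1 Q z" by simp
  next
    assume e: "pd 2 Q z = \<i> * pd 1 Q z"
    have "frechet_derivative Q (at z) = (*) (pd 1 Q z)"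
    proof
      fix v
      show "frechet_derivative Q (at z) v = pd 1 Q z * v"
        unfolding frechet_eq_pd[OF assms z] e by (simp add: complex_eq_iff algebra_simps)
    qed
    then have "(Q has_field_derivative pd 1 Q z) (at z)"
      using smooth_on_imp_has_derivative[OF assms z] by (simp add: has_field_derivative_def)
    then show "Q field_differentiable (at z)" by (auto simp: field_differentiable_def)
  qed
  then show ?thesis
    by (simp add: holomorphic_on_def at_within_open[OF _ assms(1)])
qed

context sphere_patch
begin

theorem quadratic_form_holomorphic_iff:
  assumes conf: "\<And>w. w \<in> U \<Longrightarrow> norm (pd 1 (f \<circ> F) w) = norm (pd 2 (f \<circ> F) w) \<and> pd 1 (f \<circ> F) w \<bullet> pd 2 (f \<circ> F) w = 0"
  shows "quadratic_form f (gauss_map f \<eta>) F holomorphic_on U \<longleftrightarrow> (\<forall>z\<in>U. \<forall>l. pd l H z = 0)"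
proof -
  define b where "b i j w = pd i N w \<bullet> pd j X w" for i j w
  have c: "g 1 1 w = g 2 2 w" "g 1 2 w = 0" if "w \<in> U" for w
    using conf[OF that] by (auto simp: g_def X_def norm_eq)
  define Q where "Q w = (b 1 1 w - b 2 2 w) *\<^sub>R (1/4 :: complex) + b 1 2 w *\<^sub>R (- \<i> / 2)" for w
  have smb: "smooth_on (b i j) U" for i j unfolding b_def by (rule smooth_b)
  have smQ: "smooth_on Q U"
    unfolding Q_def[abs_def] by (intro smooth_on_add smooth_on_scaleR smooth_on_diff smooth_on_const smb U)
  have "quadratic_form f (gauss_map f \<eta>) F w = Q w" if "w \<in> U" for w
    unfolding quadratic_form_eq[OF that] Q_def b_def by (simp add: complex_eq_iff)
  then have "quadratic_form f (gauss_map f \<eta>) F holomorphic_on U \<longleftrightarrow> Q holomorphic_on U"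
    by (intro holomorphic_cong) auto
  also have "\<dots> \<longleftrightarrow> (\<forall>z\<in>U. pd 2 Q z = \<i> * pd 1 Q z)"
    by (rule holomorphic_on_iff_pd[OF U smQ])
  also have "\<dots> \<longleftrightarrow> (\<forall>z\<in>U. \<forall>l. pd l H z = 0)"
  proof (rule ball_cong[OF refl])
    fix z assume z: "z \<in> U"
    have dQ: "pd l Q z = (pd l (b 1 1) z - pd l (b 2 2) z) *\<^sub>R (1/4) + pd l (b 1 2) z *\<^sub>R (- \<i> / 2)" for l
      unfolding Q_def[abs_def]
      by (simp add: pd_add[OF U _ _ z] pd_diff[OF U _ _ z] pd_bilinear[OF bounded_bilinear_scaleR U _ _ z]
          smooth_on_scaleR[OF U] smooth_on_diff[OF U] smooth_on_const[OF U] smb)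
    note k = conformal_hopf_derivatives[OF c z, folded b_def]
    have E0: "g 1 1 z > 0" by (rule g_pos(1)[OF z])
    have "pd 2 Q z = \<i> * pd 1 Q z \<longleftrightarrow> pd 1 (b 1 1) z - pd 1 (b 2 2) z + 2 * pd 2 (b 1 2) z = 0 \<and>
        pd 2 (b 1 1) z - pd 2 (b 2 2) z - 2 * pd 1 (b 1 2) z = 0"
      unfolding dQ complex_eq_iff by (simp add: field_simps) linarith
    also have "\<dots> \<longleftrightarrow> pd 1 H z = 0 \<and> pd 2 H z = 0"
      using k E0 by auto
    finally show "pd 2 Q z = \<i> * pd 1 Q z \<longleftrightarrow> (\<forall>l. pd l H z = 0)" by (simp add: forall_2)
  qed
  finally show ?thesis .
qed

end

text \<open>Both the metric determinant and the trace numerator pick up the square of the Jacobian.\<close>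

lemma mean_curvature_reparametrization:
  assumes "sphere_patch f \<eta> F U" "sphere_patch f \<eta> G V"
    and W: "open W" "W \<subseteq> U" "\<tau> ` W \<subseteq> V" "smooth_on \<tau> W" "\<And>w. w \<in> W \<Longrightarrow> F w = G (\<tau> w)" and z: "z \<in> W"
  shows "mean_curvature f \<eta> F z = mean_curvature f \<eta> G (\<tau> z)"
proof -
  interpret P: sphere_patch f \<eta> F U by fact
  interpret Q: sphere_patch f \<eta> G V by fact
  have zU: "z \<in> U" and zV: "\<tau> z \<in> V" using W z by auto
  define c d where "c i = Re (pd i \<tau> z)" and "d i = Im (pd i \<tau> z)" for i
  have chain: "pd i (k \<circ> F) z = c i *\<^sub>R pd 1 (k \<circ> G) (\<tau> z) + d i *\<^sub>R pd 2 (k \<circ> G) (\<tau> z)"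
    if sm: "smooth_on (k \<circ> G) V" for k :: "'a \<Rightarrow> real^4" and i
  proof -
    have "((\<lambda>w. (k \<circ> G) (\<tau> w)) has_derivative (\<lambda>v. frechet_derivative (k \<circ> G) (at (\<tau> z)) (frechet_derivative \<tau> (at z) v))) (at z)"
      by (rule has_derivative_compose[OF smooth_on_imp_has_derivative[OF W(1,4) z] smooth_on_imp_has_derivative[OF Q.U sm zV]])
    then have "((k \<circ> F) has_derivative (\<lambda>v. frechet_derivative (k \<circ> G) (at (\<tau> z)) (frechet_derivative \<tau> (at z) v))) (at z)"
      by (rule has_derivative_transform_within_open[OF _ W(1) z]) (simp add: W(5))
    from pd_eqI[OF this] show ?thesis
      unfolding frechet_eq_pd[OF Q.U sm zV] by (simp add: pd_def c_def d_def)
  qed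
  have X: "pd i P.X z = c i *\<^sub>R pd 1 Q.X (\<tau> z) + d i *\<^sub>R pd 2 Q.X (\<tau> z)"
    and N: "pd i P.N z = c i *\<^sub>R pd 1 Q.N (\<tau> z) + d i *\<^sub>R pd 2 Q.N (\<tau> z)" for i
    unfolding P.X_def Q.X_def P.N_def Q.N_def by (rule chain[OF Q.smX], rule chain[OF Q.smN])
  define J where "J = c 1 * d 2 - c 2 * d 1"
  have b: "pd 2 Q.N (\<tau> z) \<bullet> pd 1 Q.X (\<tau> z) = pd 1 Q.N (\<tau> z) \<bullet> pd 2 Q.X (\<tau> z)"
    by (rule Q.second_products(3)[OF zV])
  have x: "pd 2 Q.X (\<tau> z) \<bullet> pd 1 Q.X (\<tau> z) = pd 1 Q.X (\<tau> z) \<bullet> pd 2 Q.X (\<tau> z)" by (rule inner_commute)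
  have det: "P.gdet z = J\<^sup>2 * Q.gdet (\<tau> z)"
    unfolding P.gdet_def Q.gdet_def P.g_def Q.g_def X J_def
    by (simp add: inner_add_left inner_add_right x power2_eq_square algebra_simps)
  have num: "P.g 2 2 z * (pd 1 P.N z \<bullet> pd 1 P.X z) - 2 * P.g 1 2 z * (pd 1 P.N z \<bullet> pd 2 P.X z) + P.g 1 1 z * (pd 2 P.N z \<bullet> pd 2 P.X z)
    = J\<^sup>2 * (Q.g 2 2 (\<tau> z) * (pd 1 Q.N (\<tau> z) \<bullet> pd 1 Q.X (\<tau> z)) - 2 * Q.g 1 2 (\<tau> z) * (pd 1 Q.N (\<tau> z) \<bullet> pd 2 Q.X (\<tau> z)) + Q.g 1 1 (\<tau> z) * (pd 2 Q.N (\<tau> z) \<bullet> pd 2 Q.X (\<tau> z)))"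
    unfolding P.g_def Q.g_def X N J_def
    by (simp add: inner_add_left inner_add_right x b power2_eq_square algebra_simps)
  have "J\<^sup>2 \<noteq> 0" using P.g_pos(2)[OF zU] det by auto
  moreover have "- (j * a) / (2 * (j * d)) = - a / (2 * d)" if "j \<noteq> 0" for j a d :: real
    using that by simp
  ultimately show ?thesis
    unfolding P.mean_curvature_eq[OF zU] Q.mean_curvature_eq[OF zV] num det by blast
qed


section \<open>Charts and coordinate changes\<close>

lemma is_paramD:
  assumes "is_param M (U, F)"
  shows "open U" "openin M (F ` U)" "inj_on F U" "continuous_map (top_of_set U) (subtopology M (F ` U)) F"
    "open_map (top_of_set U) (subtopology M (F ` U)) F"
  using assms unfolding is_param_def
  by (auto simp: homeomorphic_eq_everything_map)

lemma is_param_image_open: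
  assumes "is_param M (U, F)" "open S" "S \<subseteq> U"
  shows "openin M (F ` S)"
proof -
  have "openin (top_of_set U) S" using assms(2,3) by (simp add: open_subset)
  then have "openin (subtopology M (F ` U)) (F ` S)"
    using is_paramD(5)[OF assms(1)] by (auto simp: open_map_def)
  then show ?thesis using is_paramD(2)[OF assms(1)] by (simp add: openin_open_subtopology)
qed

lemma is_param_preimage_open:
  assumes "is_param M (U, F)" "openin M S"
  shows "open {z \<in> U. F z \<in> S}"
proof -
  have "openin (subtopology M (F ` U)) (S \<inter> F ` U)"
    using assms(2) by (auto simp: openin_subtopology)
  then have "openin (top_of_set U) {z \<in> topspace (top_of_set U). F z \<in> S \<inter> F ` U}"
    using is_paramD(4)[OF assms(1)] openin_continuous_map_preimage by blast
  moreover have "{z \<in> topspace (top_of_set U). F z \<in> S \<inter> F ` U} = {z \<in> U. F z \<in> S}" by auto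
  ultimately show ?thesis using is_paramD(1)[OF assms(1)] by (simp add: openin_open_eq)
qed

locale immersed =
  fixes M :: "'a topology" and A :: "'a param set" and f \<eta> :: "'a \<Rightarrow> real^4"
  assumes surf: "oriented_immersed_surface M A f \<eta>"
begin

lemma atlas:
  "connected_space M" "\<And>P. P \<in> A \<Longrightarrow> is_param M P" "topspace M = (\<Union>(U, F)\<in>A. F ` U)"
  "\<And>P Q. P \<in> A \<Longrightarrow> Q \<in> A \<Longrightarrow> smooth_transition P Q"
  using surf by (auto simp: oriented_immersed_surface_def smooth_surface_def)

lemma smooth_param_atlas: "P \<in> A \<Longrightarrow> smooth_param M A P"
  using atlas by (simp add: smooth_param_def)

lemma patch_atlas:
  assumes "(U, F) \<in> A"
  shows "sphere_patch f \<eta> F U"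
proof
  show "open U" using is_paramD(1)[OF atlas(2)[OF assms]] .
  have *: "smooth_on (f \<circ> F) U \<and> smooth_on (\<eta> \<circ> F) U \<and>
        (\<forall>z\<in>U. inj (frechet_derivative (f \<circ> F) (at z)) \<and>
               (\<forall>v. \<eta> (F z) \<bullet> frechet_derivative (f \<circ> F) (at z) v = 0))"
    using surf assms by (auto simp: oriented_immersed_surface_def)
  then show "smooth_on (f \<circ> F) U" "smooth_on (\<eta> \<circ> F) U"
    "\<And>z. z \<in> U \<Longrightarrow> inj (frechet_derivative (f \<circ> F) (at z))"
    "\<And>z v. z \<in> U \<Longrightarrow> \<eta> (F z) \<bullet> frechet_derivative (f \<circ> F) (at z) v = 0" by auto
  fix z assume "z \<in> U"
  then have "F z \<in> topspace M" using atlas(3) assms by auto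
  then show "norm (f (F z)) = 1 \<and> norm (\<eta> (F z)) = 1 \<and> \<eta> (F z) \<bullet> f (F z) = 0"
    using surf by (auto simp: oriented_immersed_surface_def)
qed

definition overlap where "overlap U F V G = {z \<in> U. F z \<in> G ` V}"

lemma transition:
  assumes P: "smooth_param M A (U, F)" and Q: "(V, G) \<in> A"
  shows "open (overlap U F V G)" "smooth_on (inv_into V G \<circ> F) (overlap U F V G)"
    "\<And>z. z \<in> overlap U F V G \<Longrightarrow> (inv_into V G \<circ> F) z \<in> V \<and> G ((inv_into V G \<circ> F) z) = F z"
    "open (overlap V G U F)" "smooth_on (inv_into U F \<circ> G) (overlap V G U F)"
    "\<And>z. z \<in> overlap U F V G \<Longrightarrow> (inv_into V G \<circ> F) z \<in> overlap V G U F \<and>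
       (inv_into U F \<circ> G) ((inv_into V G \<circ> F) z) = z"
proof -
  have iP: "is_param M (U, F)" using P by (simp add: smooth_param_def)
  have iQ: "is_param M (V, G)" using atlas(2)[OF Q] .
  show "open (overlap U F V G)" "open (overlap V G U F)"
    unfolding overlap_def by (rule is_param_preimage_open[OF iP is_paramD(2)[OF iQ]],
      rule is_param_preimage_open[OF iQ is_paramD(2)[OF iP]])
  show "smooth_on (inv_into V G \<circ> F) (overlap U F V G)" "smooth_on (inv_into U F \<circ> G) (overlap V G U F)"
    using P Q unfolding smooth_param_def smooth_transition_def overlap_def by auto
  show 3: "(inv_into V G \<circ> F) z \<in> V \<and> G ((inv_into V G \<circ> F) z) = F z" if "z \<in> overlap U F V G" for z
    using that by (auto simp: overlap_def inv_into_into f_inv_into_f)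
  show "(inv_into V G \<circ> F) z \<in> overlap V G U F \<and> (inv_into U F \<circ> G) ((inv_into V G \<circ> F) z) = z" if z: "z \<in> overlap U F V G" for z
    using 3[OF z] z is_paramD(3)[OF iP] by (auto simp: overlap_def)
qed

lemma chart_at:
  assumes P: "smooth_param M A (U, F)" and z: "z \<in> U"
  obtains V G where "(V, G) \<in> A" "z \<in> overlap U F V G"
proof -
  have "openin M (F ` U)" using P is_paramD(2) unfolding smooth_param_def by blast
  then have "F z \<in> topspace M" using openin_subset z by blast
  then show ?thesis using that z unfolding atlas(3) overlap_def by blast
qed

text \<open>Every parametrization of the maximal atlas inherits the properties required of the given charts, because locally it
  differs from one of them by a diffeomorphism.\<close>

lemma patch_smooth_param:
  assumes P: "smooth_param M A (U, F)"
  shows "sphere_patch f \<eta> F U"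
proof
  have iP: "is_param M (U, F)" using P by (simp add: smooth_param_def)
  show "open U" using is_paramD(1)[OF iP] .
  have smooth: "smooth_on (k \<circ> F) U" if k: "\<And>V G. (V, G) \<in> A \<Longrightarrow> smooth_on (k \<circ> G) V" for k :: "'a \<Rightarrow> real^4"
  proof (rule smooth_on_local)
    fix z assume "z \<in> U"
    then obtain V G where VG: "(V, G) \<in> A" "z \<in> overlap U F V G" using chart_at[OF P] by metis
    note t = transition[OF P VG(1)]
    have "open V" using is_paramD(1)[OF atlas(2)[OF VG(1)]] .
    then have "smooth_on (\<lambda>z. (k \<circ> G) ((inv_into V G \<circ> F) z)) (overlap U F V G)"
      by (intro smooth_on_comp[OF t(1) _ _ k[OF VG(1)] t(2)]) (use t(3) in auto)
    then have "smooth_on (k \<circ> F) (overlap U F V G)"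
      using smooth_on_cong[OF t(1), of "k \<circ> F" "\<lambda>z. (k \<circ> G) ((inv_into V G \<circ> F) z)"] t(3) by simp
    then show "\<exists>T. open T \<and> z \<in> T \<and> smooth_on (k \<circ> F) T" using t(1) VG(2) by blast
  qed
  show smX: "smooth_on (f \<circ> F) U" and "smooth_on (\<eta> \<circ> F) U"
    using patch_atlas by (auto intro!: smooth simp: sphere_patch_def)
  fix z assume z: "z \<in> U"
  obtain V G where VG: "(V, G) \<in> A" "z \<in> overlap U F V G" using chart_at[OF P z] by metis
  note t = transition[OF P VG(1)]
  interpret Q: sphere_patch f \<eta> G V by (rule patch_atlas[OF VG(1)])
  define \<tau> where "\<tau> = inv_into V G \<circ> F"
  define \<sigma> where "\<sigma> = inv_into U F \<circ> G"
  have tz: "\<tau> z \<in> V" "G (\<tau> z) = F z" "\<tau> z \<in> overlap V G U F"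
    using t(3)[OF VG(2)] t(6)[OF VG(2)] by (auto simp: \<tau>_def)
  show "norm (f (F z)) = 1 \<and> norm (\<eta> (F z)) = 1 \<and> \<eta> (F z) \<bullet> f (F z) = 0"
    using Q.unit[OF tz(1)] by (simp add: tz(2))
  let ?D = "frechet_derivative (f \<circ> G) (at (\<tau> z))" and ?T = "frechet_derivative \<tau> (at z)"
  have D\<tau>: "(\<tau> has_derivative ?T) (at z)"
    using smooth_on_imp_has_derivative[OF t(1,2) VG(2)] by (simp add: \<tau>_def)
  have "((\<lambda>w. (f \<circ> G) (\<tau> w)) has_derivative (\<lambda>v. ?D (?T v))) (at z)"
    by (rule has_derivative_compose[OF D\<tau> smooth_on_imp_has_derivative[OF Q.U Q.smX tz(1)]])
  then have "((f \<circ> F) has_derivative (\<lambda>v. ?D (?T v))) (at z)"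
    by (rule has_derivative_transform_within_open[OF _ t(1) VG(2)]) (use t(3) in \<open>simp add: \<tau>_def\<close>)
  then have DF: "frechet_derivative (f \<circ> F) (at z) = (\<lambda>v. ?D (?T v))"
    by (metis frechet_derivative_at)
  show "\<eta> (F z) \<bullet> frechet_derivative (f \<circ> F) (at z) v = 0" for v
    unfolding DF using Q.normal[OF tz(1)] by (simp add: tz(2))
  have "((\<lambda>w. \<sigma> (\<tau> w)) has_derivative (\<lambda>v. frechet_derivative \<sigma> (at (\<tau> z)) (?T v))) (at z)"
    by (rule has_derivative_compose[OF D\<tau> smooth_on_imp_has_derivative[OF t(4) t(5)[folded \<sigma>_def] tz(3)]])
  moreover have "((\<lambda>w. \<sigma> (\<tau> w)) has_derivative (\<lambda>v. v)) (at z)"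
    by (rule has_derivative_transform_within_open[OF has_derivative_ident t(1) VG(2)])
       (use t(6) in \<open>simp add: \<sigma>_def \<tau>_def\<close>)
  ultimately have "(\<lambda>v. frechet_derivative \<sigma> (at (\<tau> z)) (?T v)) = (\<lambda>v. v)"
    by (rule has_derivative_unique)
  then have "inj ?T" by (metis injI)
  then show "inj (frechet_derivative (f \<circ> F) (at z))"
    unfolding DF using inj_compose[OF Q.inj[OF tz(1)]] by (simp add: o_def)
qed

lemma mean_curvature_consistent:
  assumes P: "smooth_param M A (U, F)" and Q: "(V, G) \<in> A" and zw: "z \<in> U" "w \<in> V" "F z = G w"
  shows "mean_curvature f \<eta> F z = mean_curvature f \<eta> G w"
proof -
  note t = transition[OF P Q]
  have z: "z \<in> overlap U F V G" using zw by (auto simp: overlap_def)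
  have "mean_curvature f \<eta> F z = mean_curvature f \<eta> G ((inv_into V G \<circ> F) z)"
    by (rule mean_curvature_reparametrization[OF patch_smooth_param[OF P] patch_atlas[OF Q] t(1) _ _ t(2) _ z])
       (use t(3) in \<open>auto simp: overlap_def\<close>)
  moreover have "(inv_into V G \<circ> F) z = w"
    using zw is_paramD(3)[OF atlas(2)[OF Q]] by simp
  ultimately show ?thesis by simp
qed

lemma locally_constant:
  assumes "sphere_patch f \<eta> F U" "\<And>z l. z \<in> U \<Longrightarrow> pd l (mean_curvature f \<eta> F) z = 0" "z \<in> U"
  obtains r where "r > 0" "ball z r \<subseteq> U" "\<And>w. w \<in> ball z r \<Longrightarrow> mean_curvature f \<eta> F w = mean_curvature f \<eta> F z"
proof -
  interpret P: sphere_patch f \<eta> F U by fact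
  obtain r where r: "r > 0" "ball z r \<subseteq> U" using P.U assms(3) open_contains_ball by blast
  have "(P.H has_derivative (\<lambda>h. 0)) (at w within ball z r)" if "w \<in> ball z r" for w
  proof -
    have w: "w \<in> U" using that r by blast
    have "frechet_derivative P.H (at w) = (\<lambda>h. 0)"
      unfolding fun_eq_iff frechet_eq_pd[OF P.U P.smooth_H w] assms(2)[OF w] by simp
    then show ?thesis
      using smooth_on_imp_has_derivative[OF P.U P.smooth_H w] by (simp add: has_derivative_at_withinI)
  qed
  then have "\<exists>c. \<forall>w\<in>ball z r. P.H w = c"
    by (rule has_derivative_zero_constant[OF convex_ball])
  then have "P.H w = P.H z" if "w \<in> ball z r" for w
    using that r(1) centre_in_ball by metis
  then show ?thesis using that r by blast
qed

theorem constant_iff_derivative_zero: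
  "constant_mean_curvature A f \<eta> \<longleftrightarrow> (\<forall>(U, F)\<in>A. \<forall>z\<in>U. \<forall>l. pd l (mean_curvature f \<eta> F) z = 0)"
proof
  assume "constant_mean_curvature A f \<eta>"
  then obtain H0 where H0: "\<And>U F z. (U, F) \<in> A \<Longrightarrow> z \<in> U \<Longrightarrow> mean_curvature f \<eta> F z = H0"
    unfolding constant_mean_curvature_def by blast
  show "\<forall>(U, F)\<in>A. \<forall>z\<in>U. \<forall>l. pd l (mean_curvature f \<eta> F) z = 0"
  proof (clarify)
    fix U F z l assume UF: "(U, F) \<in> A" "z \<in> U"
    interpret P: sphere_patch f \<eta> F U by (rule patch_atlas[OF UF(1)])
    show "pd l P.H z = 0"
      using pd_cong[OF P.U UF(2) _ P.smooth_H, of "\<lambda>w. H0" l] H0[OF UF(1)] by simp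
  qed
next
  assume D: "\<forall>(U, F)\<in>A. \<forall>z\<in>U. \<forall>l. pd l (mean_curvature f \<eta> F) z = 0"
  define Hm where "Hm p = (SOME h. \<exists>U F z. (U, F) \<in> A \<and> z \<in> U \<and> F z = p \<and> mean_curvature f \<eta> F z = h)" for p
  have Hm: "Hm (F z) = mean_curvature f \<eta> F z" if "(U, F) \<in> A" "z \<in> U" for U F z
  proof -
    have "\<exists>h U' F' z'. (U', F') \<in> A \<and> z' \<in> U' \<and> F' z' = F z \<and> mean_curvature f \<eta> F' z' = h" using that by blast
    from someI_ex[OF this] obtain U' F' z' where "(U', F') \<in> A" "z' \<in> U'" "F' z' = F z" "mean_curvature f \<eta> F' z' = Hm (F z)"
      unfolding Hm_def by blast
    then show ?thesis
      using mean_curvature_consistent[OF smooth_param_atlas _ _ _ , of U' F' U F z' z] that by simp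
  qed
  have op: "openin M {p \<in> topspace M. Hm p \<in> B}" for B
  proof (subst openin_subopen, intro ballI)
    fix p assume "p \<in> {p \<in> topspace M. Hm p \<in> B}"
    then obtain U F z where UF: "(U, F) \<in> A" "z \<in> U" "p = F z" and B: "Hm p \<in> B"
      unfolding atlas(3) by blast
    obtain r where r: "r > 0" "ball z r \<subseteq> U" "\<And>w. w \<in> ball z r \<Longrightarrow> mean_curvature f \<eta> F w = mean_curvature f \<eta> F z"
      using locally_constant[OF patch_atlas[OF UF(1)] _ UF(2)] D UF(1) by blast
    have "openin M (F ` ball z r)" by (rule is_param_image_open[OF atlas(2)[OF UF(1)] open_ball r(2)])
    moreover have "Hm (F w) \<in> B" if "w \<in> ball z r" for w
      using Hm[OF UF(1)] r(2,3) that UF(2) B UF(3) by (metis subsetD)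
    moreover have "p \<in> F ` ball z r" using UF(3) r(1) by auto
    ultimately show "\<exists>T. openin M T \<and> p \<in> T \<and> T \<subseteq> {p \<in> topspace M. Hm p \<in> B}"
      using openin_subset by (intro exI[of _ "F ` ball z r"]) blast
  qed
  show "constant_mean_curvature A f \<eta>"
  proof (cases "topspace M = {}")
    case True
    then have "U = {}" if "(U, F) \<in> A" for U F using that unfolding atlas(3) by blast
    then show ?thesis unfolding constant_mean_curvature_def by blast
  next
    case False
    then obtain p0 where p0: "p0 \<in> topspace M" by blast
    let ?S = "{p \<in> topspace M. Hm p \<in> {Hm p0}}"
    have "topspace M - ?S = {p \<in> topspace M. Hm p \<in> - {Hm p0}}" by auto
    then have "closedin M ?S" using op[of "- {Hm p0}"] by (auto simp: closedin_def)
    then have "?S = {} \<or> ?S = topspace M"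
      using atlas(1) op[of "{Hm p0}"] unfolding connected_space_clopen_in by blast
    then have "?S = topspace M" using p0 by blast
    then have all: "Hm p = Hm p0" if "p \<in> topspace M" for p using that by blast
    have "mean_curvature f \<eta> F z = Hm p0" if "(U, F) \<in> A" "z \<in> U" for U F z
    proof -
      have "F z \<in> topspace M" unfolding atlas(3) using that by blast
      then show ?thesis using Hm[OF that] all by simp
    qed
    then show ?thesis unfolding constant_mean_curvature_def by blast
  qed
qed

section \<open>Conformal parametrizations exist\<close>

text \<open>For the maximal atlas this includes isothermal coordinates as well as restrictions and orientation reversal.\<close>

lemma smooth_param_reparam:
  assumes P: "(V, G) \<in> A" and W: "open W" "open V0" "V0 \<subseteq> V" "homeomorphism W V0 \<phi> \<psi>"
    and sm: "smooth_on \<phi> W" "smooth_on \<psi> V0"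
  shows "smooth_param M A (W, G \<circ> \<phi>)"
proof -
  note iP = atlas(2)[OF P]
  have \<phi>: "\<And>z. z \<in> W \<Longrightarrow> \<phi> z \<in> V0 \<and> \<psi> (\<phi> z) = z" and \<psi>: "\<And>y. y \<in> V0 \<Longrightarrow> \<psi> y \<in> W \<and> \<phi> (\<psi> y) = y"
    using W(4) by (auto simp: homeomorphism_def)
  have im: "\<phi> ` W = V0" using W(4) by (simp add: homeomorphism_def)
  have opG: "openin M (G ` S)" if "open S" "S \<subseteq> V0" for S
    using is_param_image_open[OF iP that(1)] that(2) W(3) by blast
  have inj: "inj_on (G \<circ> \<phi>) W"
    using is_paramD(3)[OF iP] \<phi> W(3) by (auto simp: inj_on_def) (metis subsetD)
  have img: "(G \<circ> \<phi>) ` W = G ` V0" using im by (auto simp: image_comp[symmetric])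
  have par: "is_param M (W, G \<circ> \<phi>)"
    unfolding is_param_def prod.case
  proof (intro conjI)
    show "openin M ((G \<circ> \<phi>) ` W)" unfolding img by (rule opG[OF W(2) order_refl])
    have "homeomorphic_map (top_of_set W) (top_of_set V0) \<phi>"
      using W(4) by (simp add: homeomorphic_map_maps homeomorphic_maps_def homeomorphism_def) (metis image_subset_iff_funcset order_refl)
    moreover have "homeomorphic_map (subtopology (top_of_set V) V0) (subtopology (subtopology M (G ` V)) (G ` V0)) G"
    proof (rule homeomorphic_map_subtopologies)
      show "homeomorphic_map (top_of_set V) (subtopology M (G ` V)) G" using iP by (simp add: is_param_def)
      have "G ` V \<subseteq> topspace M" using openin_subset[OF is_paramD(2)[OF iP]] .
      then show "G ` (topspace (top_of_set V) \<inter> V0) = topspace (subtopology M (G ` V)) \<inter> G ` V0"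
        using W(3) by auto
    qed
    moreover have "subtopology (top_of_set V) V0 = top_of_set V0" "subtopology (subtopology M (G ` V)) (G ` V0) = subtopology M (G ` V0)"
      using W(3) by (simp_all add: subtopology_subtopology Int_absorb1 image_mono)
    ultimately show "homeomorphic_map (top_of_set W) (subtopology M ((G \<circ> \<phi>) ` W)) (G \<circ> \<phi>)"
      unfolding img by (metis homeomorphic_map_compose)
  qed (rule W(1))
  have "smooth_transition (W, G \<circ> \<phi>) (V', G') \<and> smooth_transition (V', G') (W, G \<circ> \<phi>)" if Q: "(V', G') \<in> A" for V' G'
  proof
    note iQ = atlas(2)[OF Q]
    note t = transition[OF smooth_param_atlas[OF Q] P]
    note t' = transition[OF smooth_param_atlas[OF P] Q]
    have op1: "open {z \<in> V'. G' z \<in> (G \<circ> \<phi>) ` W}"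
      unfolding img by (rule is_param_preimage_open[OF iQ opG[OF W(2) order_refl]])
    have inv: "inv_into V G (G' z) \<in> V0 \<and> inv_into W (G \<circ> \<phi>) (G' z) = \<psi> (inv_into V G (G' z))"
      if z: "G' z \<in> (G \<circ> \<phi>) ` W" for z
    proof -
      obtain u where u: "u \<in> W" "G' z = G (\<phi> u)" using z by auto
      have "inv_into V G (G' z) = \<phi> u"
        unfolding u(2) using is_paramD(3)[OF iP] \<phi>[OF u(1)] W(3) by (intro inv_into_f_f) auto
      moreover have "inv_into W (G \<circ> \<phi>) (G' z) = u"
        using inv_into_f_f[OF inj u(1)] u(2) by simp
      ultimately show ?thesis using \<phi>[OF u(1)] by simp
    qed
    have "smooth_on (\<lambda>z. \<psi> ((inv_into V G \<circ> G') z)) {z \<in> V'. G' z \<in> (G \<circ> \<phi>) ` W}"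
    proof (rule smooth_on_comp[OF op1 W(2) _ sm(2) smooth_on_subset[OF t(2)]])
      show "{z \<in> V'. G' z \<in> (G \<circ> \<phi>) ` W} \<subseteq> overlap V' G' V G"
        unfolding img overlap_def using W(3) by blast
    qed (use inv in auto)
    then show "smooth_transition (W, G \<circ> \<phi>) (V', G')"
      unfolding smooth_transition_def prod.case
      by (subst smooth_on_cong[OF op1, of _ "\<lambda>z. \<psi> ((inv_into V G \<circ> G') z)"]) (use inv in auto)
    have op2: "open {z \<in> W. (G \<circ> \<phi>) z \<in> G' ` V'}"
      by (rule is_param_preimage_open[OF par is_paramD(2)[OF iQ]])
    have "smooth_on (\<lambda>z. (inv_into V' G' \<circ> G) (\<phi> z)) {z \<in> W. (G \<circ> \<phi>) z \<in> G' ` V'}"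
      by (rule smooth_on_comp[OF op2 t'(1) _ t'(2) smooth_on_subset[OF sm(1)]])
         (use \<phi> W(3) in \<open>auto simp: overlap_def\<close>)
    then show "smooth_transition (V', G') (W, G \<circ> \<phi>)"
      unfolding smooth_transition_def prod.case by (simp add: o_def)
  qed
  then show ?thesis unfolding smooth_param_def using par by auto
qed

end

lemma vector_4:
  "(vector [x,y,z,w] :: ('b::zero)^4) $ 1 = x" "(vector [x,y,z,w] :: ('b::zero)^4) $ 2 = y"
  "(vector [x,y,z,w] :: ('b::zero)^4) $ 3 = z" "(vector [x,y,z,w] :: ('b::zero)^4) $ 4 = w"
  unfolding vector_def by simp_all

context sphere_patch
begin

text \<open>Positive on positively oriented parametrizations.\<close>

definition orient where
  "orient z = det (vector [f (F z), pd 1 (f \<circ> F) z, pd 2 (f \<circ> F) z, \<eta> (F z)] :: real^4^4)"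

lemma orient_nonzero:
  assumes z: "z \<in> U"
  shows "orient z \<noteq> 0"
proof
  let ?A = "vector [f (F z), pd 1 (f \<circ> F) z, pd 2 (f \<circ> F) z, \<eta> (F z)] :: real^4^4"
  assume "orient z = 0"
  then have "\<not> invertible ?A" by (simp add: orient_def invertible_det_nz)
  then obtain v where v: "v \<noteq> 0" "?A *v v = 0"
    using matrix_left_invertible_ker[of ?A] invertible_left_inverse[of ?A] by blast
  have "?A $ i \<bullet> v = 0" for i using v(2) by (simp add: matrix_mult_dot vec_eq_iff)
  from this[of 1] this[of 2] this[of 3] this[of 4]
  have "f (F z) \<bullet> v = 0" "pd 1 X z \<bullet> v = 0" "pd 2 X z \<bullet> v = 0" "\<eta> (F z) \<bullet> v = 0"
    by (simp_all add: vector_4 X_def)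
  moreover from this have "v \<bullet> pd i X z = 0" for i using exhaust_2[of i] by (auto simp: inner_commute)
  ultimately have "v = 0" by (intro frame_zero[OF z]) (simp_all add: X_def N_def inner_commute)
  then show False using v(1) by simp
qed

lemma continuous_on_orient: "continuous_on U orient"
proof -
  let ?A = "\<lambda>z. vector [f (F z), pd 1 (f \<circ> F) z, pd 2 (f \<circ> F) z, \<eta> (F z)] :: real^4^4"
  have c: "continuous_on U (f \<circ> F)" "continuous_on U (\<eta> \<circ> F)" "continuous_on U (pd i (f \<circ> F))" for i
    by (rule smooth_on_continuous[OF smX], rule smooth_on_continuous[OF smN],
        rule smooth_on_continuous[OF smooth_on_pd[OF smX]])
  have "continuous_on U (\<lambda>z. ?A z $ i $ j)" for i j
  proof -
    have "continuous_on U (\<lambda>z. f (F z) $ j)" "continuous_on U (\<lambda>z. \<eta> (F z) $ j)" "continuous_on U (\<lambda>z. pd k (f \<circ> F) z $ j)" for k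
      using c[THEN bounded_linear.continuous_on[OF bounded_linear_vec_nth[of j]]] by simp_all
    then show ?thesis using exhaust_4[of i] by (elim disjE) (simp_all only: vector_4)
  qed
  then show ?thesis unfolding orient_def[abs_def] det_def
    by (intro continuous_on_sum continuous_on_mult continuous_on_prod continuous_on_const)
qed

end

context immersed
begin

lemma conformal_param_exists:
  assumes P: "(V, G) \<in> A" and w: "w \<in> V"
  obtains W V0 \<phi> \<psi> where "open W" "open V0" "V0 \<subseteq> V" "w \<in> V0" "homeomorphism W V0 \<phi> \<psi>"
    "conformal_param M A f \<eta> (W, G \<circ> \<phi>)"
proof -
  interpret P: sphere_patch f \<eta> G V by (rule patch_atlas[OF P])
  have "P.g 1 1 z * P.g 2 2 z - (P.g 1 2 z)\<^sup>2 > 0" if "z \<in> V" for z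
    using P.g_pos(2)[OF that] by (simp add: P.gdet_def power2_eq_square)
  from isothermal_coordinates[OF P.U w P.smooth_g P.smooth_g P.smooth_g P.g_pos(1) this]
  obtain W V0 and \<phi> \<psi> :: "complex \<Rightarrow> complex" where W: "open W" "open V0" "V0 \<subseteq> V" "w \<in> V0" "homeomorphism W V0 \<phi> \<psi>" and sm: "smooth_on \<phi> W" "smooth_on \<psi> V0"
    and iso: "\<And>\<zeta>. \<zeta> \<in> W \<Longrightarrow> \<exists>\<rho>>0. \<forall>v. let u = frechet_derivative \<phi> (at \<zeta>) v; z = \<phi> \<zeta> in
       P.g 1 1 z * (Re u)\<^sup>2 + 2 * P.g 1 2 z * Re u * Im u + P.g 2 2 z * (Im u)\<^sup>2 = \<rho> * (norm v)\<^sup>2"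
    by blast
  have \<phi>: "\<And>z. z \<in> W \<Longrightarrow> \<phi> z \<in> V0 \<and> \<psi> (\<phi> z) = z" and \<psi>: "\<And>y. y \<in> V0 \<Longrightarrow> \<psi> y \<in> W \<and> \<phi> (\<psi> y) = y"
    using W(5) by (auto simp: homeomorphism_def)
  define z0 where "z0 = \<psi> w"
  have z0: "z0 \<in> W" "\<phi> z0 = w" using \<psi>[OF W(4)] by (auto simp: z0_def)
  have spP: "smooth_param M A (W, G \<circ> \<phi>)" by (rule smooth_param_reparam[OF P W(1-3,5) sm])
  interpret Q: sphere_patch f \<eta> "G \<circ> \<phi>" W by (rule patch_smooth_param[OF spP])
  have conf: "norm (pd 1 Q.X z) = norm (pd 2 Q.X z) \<and> pd 1 Q.X z \<bullet> pd 2 Q.X z = 0" if z: "z \<in> W" for z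
  proof -
    obtain \<rho> where \<rho>: "\<rho> > 0" "\<And>v. P.g 1 1 (\<phi> z) * (Re (frechet_derivative \<phi> (at z) v))\<^sup>2
        + 2 * P.g 1 2 (\<phi> z) * Re (frechet_derivative \<phi> (at z) v) * Im (frechet_derivative \<phi> (at z) v)
        + P.g 2 2 (\<phi> z) * (Im (frechet_derivative \<phi> (at z) v))\<^sup>2 = \<rho> * (norm v)\<^sup>2"
      using iso[OF z] unfolding Let_def by blast
    have \<phi>V: "\<phi> z \<in> V" using \<phi>[OF z] W(3) by blast
    have "((\<lambda>w. (f \<circ> G) (\<phi> w)) has_derivative (\<lambda>v. frechet_derivative (f \<circ> G) (at (\<phi> z)) (frechet_derivative \<phi> (at z) v))) (at z)"
      by (rule has_derivative_compose[OF smooth_on_imp_has_derivative[OF W(1) sm(1) z] smooth_on_imp_has_derivative[OF P.U P.smX \<phi>V]])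
    moreover have "(\<lambda>w. (f \<circ> G) (\<phi> w)) = Q.X" unfolding Q.X_def by (simp add: fun_eq_iff)
    ultimately have "frechet_derivative Q.X (at z) v = frechet_derivative P.X (at (\<phi> z)) (frechet_derivative \<phi> (at z) v)" for v
      by (metis frechet_derivative_at P.X_def)
    then have D: "frechet_derivative Q.X (at z) v = Re (frechet_derivative \<phi> (at z) v) *\<^sub>R pd 1 P.X (\<phi> z) + Im (frechet_derivative \<phi> (at z) v) *\<^sub>R pd 2 P.X (\<phi> z)" for v
      unfolding frechet_eq_pd[OF P.U P.smooth_X \<phi>V] .
    have "frechet_derivative Q.X (at z) v \<bullet> frechet_derivative Q.X (at z) v = \<rho> * (norm v)\<^sup>2" for v
      unfolding \<rho>(2)[symmetric] D P.g_def
      by (simp add: inner_add_left inner_add_right power2_eq_square inner_commute algebra_simps)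
    then have q: "(Re v *\<^sub>R pd 1 Q.X z + Im v *\<^sub>R pd 2 Q.X z) \<bullet> (Re v *\<^sub>R pd 1 Q.X z + Im v *\<^sub>R pd 2 Q.X z) = \<rho> * (norm v)\<^sup>2" for v
      unfolding frechet_eq_pd[OF Q.U Q.smooth_X z] .
    have q1: "pd 1 Q.X z \<bullet> pd 1 Q.X z = \<rho>" "pd 2 Q.X z \<bullet> pd 2 Q.X z = \<rho>" using q[of 1] q[of \<i>] by simp_all
    have "(norm (Complex 1 1))\<^sup>2 = 2" by (simp add: cmod_power2)
    then have "pd 1 Q.X z \<bullet> pd 2 Q.X z = 0"
      using q[of "Complex 1 1"] q1 by (simp add: inner_add_left inner_add_right inner_commute)
    then show ?thesis using q1 by (simp add: norm_eq)
  qed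
  show ?thesis
  proof (cases "Q.orient z0 > 0")
    case True
    define W1 where "W1 = {z \<in> W. Q.orient z > 0}"
    have W1: "open W1"
      using continuous_open_preimage[OF Q.continuous_on_orient W(1), of "{0<..}"] by (simp add: W1_def Int_def vimage_def)
    have hom: "homeomorphism W1 (\<phi> ` W1) \<phi> \<psi>"
      by (rule homeomorphism_of_subsets[OF W(5)]) (auto simp: W1_def)
    have opV: "open (\<phi> ` W1)"
      using homeomorphism_imp_open_map[OF W(5), of W1] W1 W(1,2)
      by (metis (no_types, lifting) W1_def mem_Collect_eq open_subset openin_open_eq subsetI)
    have sub: "\<phi> ` W1 \<subseteq> V0" using \<phi> by (auto simp: W1_def)
    have "smooth_param M A (W1, G \<circ> \<phi>)"
      by (rule smooth_param_reparam[OF P W1 opV _ hom smooth_on_subset[OF sm(1)] smooth_on_subset[OF sm(2)]])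
         (use sub W(3) in \<open>auto simp: W1_def\<close>)
    then have "conformal_param M A f \<eta> (W1, G \<circ> \<phi>)"
      unfolding conformal_param_def prod.case using conf by (simp add: Q.X_def W1_def Q.orient_def)
    moreover have "w \<in> \<phi> ` W1" using z0 True by (auto simp: W1_def)
    ultimately show ?thesis using that[OF W1 opV _ _ hom] sub W(3) by blast
  next
    case False
    then have neg: "Q.orient z0 < 0" using Q.orient_nonzero[OF z0(1)] by linarith
    \<comment> \<open>Complex conjugation of the coordinate reverses the orientation.\<close>
    define W1 where "W1 = {z. cnj z \<in> W \<and> Q.orient (cnj z) < 0}"
    have oW: "open {z \<in> W. Q.orient z < 0}"
      using continuous_open_preimage[OF Q.continuous_on_orient W(1), of "{..<0}"] by (simp add: Int_def vimage_def)
    have W1c: "W1 = cnj -` {z \<in> W. Q.orient z < 0}" by (auto simp: W1_def)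
    have W1: "open W1" unfolding W1c by (rule open_vimage[OF oW]) (intro continuous_intros)
    define \<phi>' where "\<phi>' = \<phi> \<circ> cnj"
    define \<psi>' where "\<psi>' = cnj \<circ> \<psi>"
    have im: "\<phi>' ` W1 = \<phi> ` {z \<in> W. Q.orient z < 0}"
    proof -
      have "W1 = cnj ` {z \<in> W. Q.orient z < 0}"
        unfolding W1_def by (auto simp: image_iff) (metis complex_cnj_cnj)
      then show ?thesis by (simp add: \<phi>'_def image_image)
    qed
    have smc: "smooth_on cnj S" if "open S" for S by (rule smooth_on_bounded_linear[OF that bounded_linear_cnj])
    have opV: "open (\<phi>' ` W1)"
      unfolding im using homeomorphism_imp_open_map[OF W(5), of "{z \<in> W. Q.orient z < 0}"] oW W(1,2)
      by (metis (no_types, lifting) mem_Collect_eq open_subset openin_open_eq subsetI)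
    have sub: "\<phi>' ` W1 \<subseteq> V0" unfolding im using \<phi> by auto
    have sm\<phi>': "smooth_on \<phi>' W1"
      unfolding \<phi>'_def o_def by (rule smooth_on_comp[OF W1 W(1) _ sm(1) smc[OF W1]]) (auto simp: W1_def)
    have sm\<psi>': "smooth_on \<psi>' (\<phi>' ` W1)"
      unfolding \<psi>'_def o_def by (rule smooth_on_comp[OF opV open_UNIV _ smc[OF open_UNIV] smooth_on_subset[OF sm(2) sub]]) simp
    have hom: "homeomorphism W1 (\<phi>' ` W1) \<phi>' \<psi>'"
      unfolding homeomorphism_def
      using smooth_on_continuous[OF sm\<phi>'] smooth_on_continuous[OF sm\<psi>'] \<phi>
      by (auto simp: \<phi>'_def \<psi>'_def W1_def image_iff)
    have spR: "smooth_param M A (W1, G \<circ> \<phi>')"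
      by (rule smooth_param_reparam[OF P W1 opV _ hom sm\<phi>' sm\<psi>']) (use sub W(3) in auto)
    have pdR: "pd 1 (f \<circ> (G \<circ> \<phi>')) z = pd 1 Q.X (cnj z)" "pd 2 (f \<circ> (G \<circ> \<phi>')) z = - pd 2 Q.X (cnj z)" if "z \<in> W1" for z
    proof -
      have cz: "cnj z \<in> W" using that by (simp add: W1_def)
      have "((\<lambda>w. Q.X (cnj w)) has_derivative (\<lambda>v. frechet_derivative Q.X (at (cnj z)) (cnj v))) (at z)"
        by (rule has_derivative_compose[OF has_derivative_cnj[OF has_derivative_ident] smooth_on_imp_has_derivative[OF W(1) Q.smooth_X cz]])
      moreover have "(\<lambda>w. Q.X (cnj w)) = f \<circ> (G \<circ> \<phi>')"
        unfolding Q.X_def \<phi>'_def by (simp add: fun_eq_iff)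
      ultimately have d: "((f \<circ> (G \<circ> \<phi>')) has_derivative (\<lambda>v. frechet_derivative Q.X (at (cnj z)) (cnj v))) (at z)" by simp
      show "pd 1 (f \<circ> (G \<circ> \<phi>')) z = pd 1 Q.X (cnj z)" "pd 2 (f \<circ> (G \<circ> \<phi>')) z = - pd 2 Q.X (cnj z)"
        unfolding pd_eqI[OF d] frechet_eq_pd[OF W(1) Q.smooth_X cz] by simp_all
    qed
    have "conformal_param M A f \<eta> (W1, G \<circ> \<phi>')"
      unfolding conformal_param_def prod.case
    proof (intro conjI ballI spR)
      fix z assume z: "z \<in> W1"
      then have cz: "cnj z \<in> W" "Q.orient (cnj z) < 0" by (auto simp: W1_def)
      show "norm (pd 1 (f \<circ> (G \<circ> \<phi>')) z) = norm (pd 2 (f \<circ> (G \<circ> \<phi>')) z)" "pd 1 (f \<circ> (G \<circ> \<phi>')) z \<bullet> pd 2 (f \<circ> (G \<circ> \<phi>')) z = 0"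
        using conf[OF cz(1)] by (simp_all add: pdR[OF z])
      let ?a = "f (G (\<phi> (cnj z)))" and ?b = "pd 1 Q.X (cnj z)" and ?c = "pd 2 Q.X (cnj z)" and ?d = "\<eta> (G (\<phi> (cnj z)))"
      have "(vector [?a, ?b, - ?c, ?d] :: real^4^4) = (\<chi> i. if i = 3 then (-1) *s ?c else (vector [?a, ?b, ?c, ?d] :: real^4^4) $ i)"
        "(vector [?a, ?b, ?c, ?d] :: real^4^4) = (\<chi> i. if i = 3 then ?c else (vector [?a, ?b, ?c, ?d] :: real^4^4) $ i)"
        unfolding vec_eq_iff[where x = "vector _"] forall_4 by (simp_all add: vector_4 vector_scalar_mult_def vec_eq_iff)
      then have "det (vector [?a, ?b, - ?c, ?d] :: real^4^4) = - det (vector [?a, ?b, ?c, ?d] :: real^4^4)"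
        using det_row_mul[of "3::4" "-1" "\<lambda>i. ?c" "\<lambda>i. (vector [?a, ?b, ?c, ?d] :: real^4^4) $ i"] by simp
      also have "\<dots> > 0" using cz(2) by (simp add: Q.orient_def Q.X_def)
      finally show "0 < det (vector [f ((G \<circ> \<phi>') z), pd 1 (f \<circ> (G \<circ> \<phi>')) z, pd 2 (f \<circ> (G \<circ> \<phi>')) z, \<eta> ((G \<circ> \<phi>') z)] :: real^4^4)"
        unfolding pdR[OF z] by (simp add: \<phi>'_def)
    qed
    moreover have "w \<in> \<phi>' ` W1" unfolding im using z0 neg by auto
    ultimately show ?thesis using that[OF W1 opV _ _ hom] sub W(3) by blast
  qed
qed

section \<open>Equivalence of the three conditions\<close>

text \<open>Conformal parametrizations cover the surface, and \<open>dH\<close> vanishes in one of them where it does in the given charts.\<close>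

theorem holomorphic_iff_constant:
  "holomorphic_quadratic_form M A f \<eta> (gauss_map f \<eta>) \<longleftrightarrow> constant_mean_curvature A f \<eta>"
proof
  assume hol: "holomorphic_quadratic_form M A f \<eta> (gauss_map f \<eta>)"
  show "constant_mean_curvature A f \<eta>"
    unfolding constant_iff_derivative_zero
  proof clarify
    fix V G w l assume P: "(V, G) \<in> A" and w: "w \<in> V"
    interpret P: sphere_patch f \<eta> G V by (rule patch_atlas[OF P])
    obtain W V0 \<phi> \<psi> where W: "open W" "open V0" "V0 \<subseteq> V" "w \<in> V0" "homeomorphism W V0 \<phi> \<psi>"
      and conf: "conformal_param M A f \<eta> (W, G \<circ> \<phi>)"
      by (rule conformal_param_exists[OF P w])
    have sp: "smooth_param M A (W, G \<circ> \<phi>)" using conf by (simp add: conformal_param_def)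
    interpret Q: sphere_patch f \<eta> "G \<circ> \<phi>" W by (rule patch_smooth_param[OF sp])
    have "\<forall>z\<in>W. \<forall>l. pd l Q.H z = 0"
      using Q.quadratic_form_holomorphic_iff hol conf
      unfolding holomorphic_quadratic_form_def conformal_param_def by auto
    moreover have \<psi>w: "\<psi> w \<in> W" using W(4,5) by (auto simp: homeomorphism_def)
    ultimately obtain r where r: "r > 0" "ball (\<psi> w) r \<subseteq> W" "\<And>y. y \<in> ball (\<psi> w) r \<Longrightarrow> Q.H y = Q.H (\<psi> w)"
      using locally_constant[OF Q.sphere_patch_axioms] by metis
    define S where "S = V0 \<inter> \<psi> -` ball (\<psi> w) r"
    have "open S" unfolding S_def
      by (rule continuous_open_preimage[OF _ W(2) open_ball]) (use W(5) in \<open>simp add: homeomorphism_def\<close>)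
    have "P.H u = Q.H (\<psi> w)" if u: "u \<in> S" for u
    proof -
      have "\<psi> u \<in> W" "\<phi> (\<psi> u) = u" "u \<in> V" using u W(3,5) by (auto simp: S_def homeomorphism_def)
      then have "Q.H (\<psi> u) = P.H u" by (intro mean_curvature_consistent[OF sp P]) auto
      then show ?thesis using r(3)[of "\<psi> u"] u by (simp add: S_def)
    qed
    moreover have "w \<in> S" "S \<subseteq> V" using W(3,4) r(1) by (auto simp: S_def)
    ultimately show "pd l P.H w = 0"
      using pd_cong[OF \<open>open S\<close> _ _ smooth_on_subset[OF P.smooth_H], of w "\<lambda>u. Q.H (\<psi> w)" l] by simp
  qed
next
  assume "constant_mean_curvature A f \<eta>"
  then obtain H0 where H0: "\<And>U F z. (U, F) \<in> A \<Longrightarrow> z \<in> U \<Longrightarrow> mean_curvature f \<eta> F z = H0"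
    unfolding constant_mean_curvature_def by blast
  show "holomorphic_quadratic_form M A f \<eta> (gauss_map f \<eta>)"
    unfolding holomorphic_quadratic_form_def
  proof (intro allI impI)
    fix U F assume conf: "conformal_param M A f \<eta> (U, F)"
    then have sp: "smooth_param M A (U, F)" by (simp add: conformal_param_def)
    interpret P: sphere_patch f \<eta> F U by (rule patch_smooth_param[OF sp])
    have const: "P.H z = H0" if "z \<in> U" for z
    proof -
      obtain V G where VG: "(V, G) \<in> A" "z \<in> overlap U F V G" using chart_at[OF sp \<open>z \<in> U\<close>] by metis
      note t = transition(3)[OF sp VG]
      have "P.H z = mean_curvature f \<eta> G ((inv_into V G \<circ> F) z)"
        by (rule mean_curvature_consistent[OF sp VG(1) that]) (use t in simp_all)
      also have "\<dots> = H0" by (rule H0[OF VG(1)]) (use t in blast)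
      finally show ?thesis .
    qed
    have "pd l P.H z = 0" if "z \<in> U" for z l
      using pd_cong[OF P.U that const P.smooth_H, of l] by simp
    then show "quadratic_form f (gauss_map f \<eta>) F holomorphic_on U"
      using P.quadratic_form_holomorphic_iff conf by (auto simp: conformal_param_def)
  qed
qed

theorem harmonic_iff_constant:
  "harmonic A f (gauss_map f \<eta>) \<longleftrightarrow> constant_mean_curvature A f \<eta>"
proof -
  have "tension f (gauss_map f \<eta>) F z = 0 \<longleftrightarrow> (\<forall>l. pd l (mean_curvature f \<eta> F) z = 0)" if "(U, F) \<in> A" "z \<in> U" for U F z
    by (rule sphere_patch.tension_zero_iff[OF patch_atlas[OF that(1)] that(2)])
  then show ?thesis
    unfolding constant_iff_derivative_zero harmonic_def by fastforce
qed

end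

theorem theorem2:
  fixes M :: "'a topology" and A :: "'a param set" and f \<eta> :: "'a \<Rightarrow> real^4"
  assumes "oriented_immersed_surface M A f \<eta>"
  shows "(constant_mean_curvature A f \<eta> \<longleftrightarrow> harmonic A f (gauss_map f \<eta>)) \<and>
         (harmonic A f (gauss_map f \<eta>) \<longleftrightarrow>
            holomorphic_quadratic_form M A f \<eta> (gauss_map f \<eta>))"
proof -
  interpret immersed M A f \<eta> by standard (rule assms)
  show ?thesis using harmonic_iff_constant holomorphic_iff_constant by blast
qed

end
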